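(* Let $\Omega\subseteq\mathbb R^n$ be a domain, and let $u$ be a nonconstant measurable function on $\mathbb R^n$ such that $$u\in H^s_{\rm loc}(\Omega),\qquad \int_{\mathbb R^n}\frac{|u(x)|}{1+|x|^{n+2s}}\,dx<\infty,\qquad (-\Delta)^su\ge0\ \text{ in }\Omega .$$ Then, up to the choice of a representative of $u$ (i.e. after modifying $u$ on a subset of $\Omega$ of Lebesgue measure zero), $u$ is lower semicontinuous on $\Omega$, locally bounded from below on $\Omega$, and $u(x)>\inf_{\mathbb R^n}u$ for every $x\in\Omega$.
   Context: Let $n\ge1$, $s\in(0,1)$, and $C_{n,s}=\frac{s2^{2s}\Gamma(\frac n2+s)}{\pi^{n/2}\Gamma(1-s)}$. $H^s(\mathbb R^n)$ is the space of $v\in L^2(\mathbb R^n)$ with $\iint_{\mathbb R^n\times\mathbb R^n}\frac{(v(x)-v(y))^2}{|x-y|^{n+2s}}dxdy<\infty$. One writes $u\in H^s_{\rm loc}(\Omega)$ if for every $G\Subset\Omega$, $u$ coincides on $G$ with some $v\in H^s(\mathbb R^n)$. The Dirichlet Laplacian is $(-\Delta)^su(x)=C_{n,s}\,\mathrm{P.V.}\int_{\mathbb R^n}\frac{u(x)-u(y)}{|x-y|^{n+2s}}dy$ for regular $u$; for $u$ as in the statement it is understood as the distribution in $\Omega$ $$\langle(-\Delta)^su,\varphi\rangle=\frac{C_{n,s}}2\iint_{\mathbb R^n\times\mathbb R^n}\frac{(u(x)-u(y))(\varphi(x)-\varphi(y))}{|x-y|^{n+2s}}\,dxdy,\qquad\varphi\in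 C_0^\infty(\Omega)$$ (absolutely convergent). The inequality $(-\Delta)^su\ge0$ in $\Omega$ means $\langle(-\Delta)^su,\varphi\rangle\ge0$ for every $\varphi\in C_0^\infty(\Omega)$ with $\varphi\ge0$. Conventions: $\inf_G u$ denotes the essential infimum of $u$ over $G$ (possibly $-\infty$); "nonconstant" means not almost everywhere equal to a constant; the lower semicontinuous representative takes values in $(-\infty,+\infty]$. *)

theory Defs
  imports "HOL-Analysis.Analysis"
begin

definition frac_const :: "nat \<Rightarrow> real \<Rightarrow> real" where
  "frac_const n s =
     s * 2 powr (2 * s) * Gamma (real n / 2 + s) / (pi powr (real n / 2) * Gamma (1 - s))"

text \<open>On the diagonal the kernel below is a division by zero, hence \<open>0\<close>; the diagonal is a null set.\<close>

definition Hs_space :: "real \<Rightarrow> (real ^ 'n \<Rightarrow> real) set" where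
  "Hs_space s = {v. v \<in> borel_measurable lebesgue
     \<and> integrable lebesgue (\<lambda>x. (v x)\<^sup>2)
     \<and> integrable lebesgue
         (\<lambda>(x, y). (v x - v y)\<^sup>2 / norm (x - y) powr (real CARD('n) + 2 * s))}"

definition compactly_contained :: "'a::topological_space set \<Rightarrow> 'a set \<Rightarrow> bool" where
  "compactly_contained G \<Omega> \<longleftrightarrow> compact (closure G) \<and> closure G \<subseteq> \<Omega>"

definition Hs_loc :: "real \<Rightarrow> (real ^ 'n) set \<Rightarrow> (real ^ 'n \<Rightarrow> real) set" where
  "Hs_loc s \<Omega> = {u. \<forall>G. compactly_contained G \<Omega> \<longrightarrow>
     (\<exists>v\<in>Hs_space s. AE x in lebesgue. x \<in> G \<longrightarrow> u x = v x)}"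

primrec C_k :: "nat \<Rightarrow> (real ^ 'n \<Rightarrow> real) \<Rightarrow> bool" where
  "C_k 0 f \<longleftrightarrow> continuous_on UNIV f"
| "C_k (Suc k) f \<longleftrightarrow>
     (\<forall>x. f differentiable at x) \<and> (\<forall>v. C_k k (\<lambda>x. frechet_derivative f (at x) v))"

definition test_functions :: "(real ^ 'n) set \<Rightarrow> (real ^ 'n \<Rightarrow> real) set" where
  "test_functions \<Omega> = {\<phi>. (\<forall>k. C_k k \<phi>) \<and> compactly_contained {x. \<phi> x \<noteq> 0} \<Omega>}"

text \<open>The distributional pairing. For \<open>u \<in> Hs_loc s \<Omega>\<close> with \<open>u(x) / (1 + |x|^(n + 2s))\<close> integrable and
  \<open>\<phi> \<in> test_functions \<Omega>\<close> the integral converges absolutely, so the default value \<open>0\<close> of a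
  non-convergent Bochner integral does not occur.\<close>

definition frac_laplacian :: "real \<Rightarrow> (real ^ 'n \<Rightarrow> real) \<Rightarrow> (real ^ 'n \<Rightarrow> real) \<Rightarrow> real" where
  "frac_laplacian s u \<phi> = frac_const CARD('n) s / 2 *
     (\<integral>(x, y). (u x - u y) * (\<phi> x - \<phi> y) / norm (x - y) powr (real CARD('n) + 2 * s) \<partial>lebesgue)"

definition frac_superharmonic :: "real \<Rightarrow> (real ^ 'n) set \<Rightarrow> (real ^ 'n \<Rightarrow> real) \<Rightarrow> bool" where
  "frac_superharmonic s \<Omega> u \<longleftrightarrow>
     (\<forall>\<phi>\<in>test_functions \<Omega>. (\<forall>x. \<phi> x \<ge> 0) \<longrightarrow> frac_laplacian s u \<phi> \<ge> 0)"

definition ess_inf :: "'a measure \<Rightarrow> ('a \<Rightarrow> ereal) \<Rightarrow> ereal" where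
  "ess_inf M f = Sup {c. AE x in M. c \<le> f x}"

definition lsc_on :: "'a::topological_space set \<Rightarrow> ('a \<Rightarrow> ereal) \<Rightarrow> bool" where
  "lsc_on S f \<longleftrightarrow> (\<forall>x\<in>S. f x \<le> Liminf (at x within S) f)"

definition locally_bounded_below_on :: "'a::topological_space set \<Rightarrow> ('a \<Rightarrow> ereal) \<Rightarrow> bool" where
  "locally_bounded_below_on S f \<longleftrightarrow>
     (\<forall>G. compactly_contained G S \<longrightarrow> (\<exists>m::real. \<forall>x\<in>G. ereal m \<le> f x))"

end

theory Submission
  imports Defs
begin

text \<open>
  Mollifications \<open>u\<^sub>\<epsilon>\<close> of \<open>u\<close> are continuous and superharmonic in the pointwise principal-value sense
  away from the boundary, so the maximum principle can be run on them with explicit quadratic barriers: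
  if a function touches a smooth barrier from above at \<open>x\<close>, its far-away excess over its value at \<open>x\<close> is
  controlled by the second derivatives of the barrier. Two barriers are enough. A multiple of
  \<open>(1 - |x - x\<^sub>0|\<^sup>2 / r\<^sup>2)\<^sup>-\<^sup>n\<close> gives \<open>u\<^sub>\<epsilon> \<ge> k - C \<integral> (k - u)\<^sup>+ \<omega>\<^sub>r(y - x\<^sub>0) dy\<close> near \<open>x\<^sub>0\<close>, where
  \<open>\<omega>\<^sub>r(y) = r\<^sup>2\<^sup>s / (r + |y|)\<^sup>n\<^sup>+\<^sup>2\<^sup>s\<close>; a small paraboloid gives \<open>u\<^sub>\<epsilon> \<ge> m + \<kappa>\<close> near \<open>x\<^sub>0\<close> when \<open>u \<ge> m\<close> is not
  constant. Both bounds are uniform in \<open>\<epsilon>\<close> and pass to \<open>u\<close>. Since \<open>\<omega>\<^sub>r\<close> is an approximate identity,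
  \<open>\<integral> (k - u)\<^sup>+ \<omega>\<^sub>r(y - x) dy\<close> comes arbitrarily close to \<open>0\<close> for almost every \<open>x\<close> with \<open>u(x) \<ge> k\<close>, so
  \<open>u\<close> agrees almost everywhere in \<open>\<Omega>\<close> with the lower semicontinuous function
  \<open>x \<mapsto> sup {essinf\<^sub>U u | U open neighbourhood of x}\<close>.
\<close>

section \<open>Integrals over Euclidean space\<close>

text \<open>The inequality is known only against smooth test functions, and \<open>u\<close> may be
  unbounded below at the outset, so \<open>u\<close> itself offers no contact point. A translated
  mollifier is an admissible test function, and the pairing against it, truncated near the diagonal
  and symmetrised, is exactly twice the truncated Laplacian of the mollification at the centre.
  Local H^s regularity makes the full pairing absolutely convergent, which lets the truncation
  radius tend to zero. The exponent n of the first barrier is forced by scaling. At a contact point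
  of relative depth t = 1 - |x - x0|^2/r^2 the barrier is quadratically controlled only at scale t
  r. There the kernel has tail mass of order (t r)^(-2s), while comparing it outside that scale with
  the weight of radius r costs t^(-n-2s). The net loss t^(-n) is what the barrier absorbs. In the
  second bound, mass outside a small ball acts on the contact point directly through the kernel. The
  gain depends only on this mass and the radius, hence not on the mollification, and this yields the
  strict inequality at every point and not just almost everywhere.\<close>

lemma nn_integral_lborel_translate:
  fixes a :: "'a::euclidean_space"
  assumes [measurable]: "f \<in> borel_measurable borel"
  shows "(\<integral>\<^sup>+x. f (a + x) \<partial>lborel) = (\<integral>\<^sup>+x. f x \<partial>lborel)"
proof -
  have "(\<integral>\<^sup>+x. f x \<partial>lborel) = (\<integral>\<^sup>+x. f x \<partial>distr lborel borel ((+) a))"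
    by (simp add: lborel_distr_plus)
  also have "\<dots> = (\<integral>\<^sup>+x. f (a + x) \<partial>lborel)"
    by (subst nn_integral_distr) auto
  finally show ?thesis by simp
qed

lemma integrable_lborel_translate_iff:
  fixes a :: "'a::euclidean_space" and f :: "'a \<Rightarrow> real"
  assumes [measurable]: "f \<in> borel_measurable borel"
  shows "integrable lborel (\<lambda>x. f (a + x)) \<longleftrightarrow> integrable lborel f"
proof -
  have "integrable lborel f \<longleftrightarrow> integrable (distr lborel borel ((+) a)) f"
    by (simp add: lborel_distr_plus)
  also have "\<dots> \<longleftrightarrow> integrable lborel (\<lambda>x. f (a + x))"
    by (subst integrable_distr_eq) auto
  finally show ?thesis by simp
qed

lemma integral_lborel_translate:
  fixes a :: "'a::euclidean_space" and f :: "'a \<Rightarrow> real"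
  assumes [measurable]: "f \<in> borel_measurable borel"
  shows "(LBINT x. f (a + x)) = (LBINT x. f x)"
proof -
  have "(LBINT x. f x) = (\<integral>x. f x \<partial>distr lborel borel ((+) a))"
    by (simp add: lborel_distr_plus)
  also have "\<dots> = (LBINT x. f (a + x))"
    by (subst integral_distr) auto
  finally show ?thesis by simp
qed

lemma distr_uminus_lborel: "distr lborel borel uminus = (lborel :: 'a::euclidean_space measure)"
proof -
  have "(lborel :: 'a measure) = density (distr lborel borel (\<lambda>x. 0 + (-1) *\<^sub>R x)) (\<lambda>_. ennreal (\<bar>-1\<bar> ^ DIM('a)))"
    by (rule lborel_affine) simp
  also have "\<dots> = distr lborel borel uminus"
    by (simp add: density_1)
  finally show ?thesis by simp
qed

lemma integral_lborel_odd:
  fixes f :: "'a::euclidean_space \<Rightarrow> real"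
  assumes [measurable]: "f \<in> borel_measurable borel" and odd: "\<And>x. f (- x) = - f x"
  shows "(LBINT x. f x) = 0"
proof -
  have "(LBINT x. f x) = (\<integral>x. f x \<partial>distr lborel borel uminus)"
    by (simp add: distr_uminus_lborel)
  also have "\<dots> = (LBINT x. f (- x))"
    by (subst integral_distr) auto
  also have "\<dots> = - (LBINT x. f x)"
    by (simp add: odd)
  finally show ?thesis by simp
qed

text \<open>Every nonzero value of \<open>f\<close> is majorised by a single term of the series of
  \<open>c j\<close> times the indicator of the ball of radius \<open>R j\<close>; integrating
  termwise leaves only ball volumes. Growing radii give decay estimates at infinity, shrinking radii
  give estimates at a singularity.\<close>

lemma nn_integral_dyadic_bound:
  fixes f :: "'a::euclidean_space \<Rightarrow> ennreal"
  assumes R: "\<And>j. 0 \<le> R j" and c: "\<And>j. 0 \<le> c j"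
    and cover: "\<And>y. f y \<noteq> 0 \<Longrightarrow> \<exists>j. norm y \<le> R j \<and> f y \<le> ennreal (c j)"
    and sm: "(\<lambda>j. c j * R j ^ DIM('a)) sums S"
  shows "(\<integral>\<^sup>+y. f y \<partial>lborel) \<le> ennreal (unit_ball_vol DIM('a) * S)"
proof -
  have "(\<integral>\<^sup>+y. f y \<partial>lborel) \<le> (\<integral>\<^sup>+y. (\<Sum>j. ennreal (c j) * indicator (cball 0 (R j)) (y::'a)) \<partial>lborel)"
  proof (rule nn_integral_mono)
    fix y :: 'a
    show "f y \<le> (\<Sum>j. ennreal (c j) * indicator (cball 0 (R j)) y)"
    proof (cases "f y = 0")
      case False
      then obtain j where j: "norm y \<le> R j" "f y \<le> ennreal (c j)" using cover by blast
      have "f y \<le> (\<Sum>j\<in>{j}. ennreal (c j) * indicator (cball 0 (R j)) y)"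
        using j by simp
      also have "\<dots> \<le> (\<Sum>j. ennreal (c j) * indicator (cball 0 (R j)) y)"
        by (intro sum_le_suminf) auto
      finally show ?thesis .
    qed simp
  qed
  also have "\<dots> = (\<Sum>j. \<integral>\<^sup>+y. ennreal (c j) * indicator (cball 0 (R j)) (y::'a) \<partial>lborel)"
    by (rule nn_integral_suminf) (intro borel_measurable_times_ennreal borel_measurable_indicator; simp)
  also have "\<dots> = (\<Sum>j. ennreal (unit_ball_vol DIM('a) * (c j * R j ^ DIM('a))))"
    by (intro suminf_cong)
      (simp add: nn_integral_cmult_indicator emeasure_cball R c ennreal_mult[symmetric] mult_ac)
  also have "\<dots> = ennreal (unit_ball_vol DIM('a) * S)"
    using sums_mult[OF sm, of "unit_ball_vol DIM('a)"]
    by (intro suminf_ennreal_eq) (auto simp: c R)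
  finally show ?thesis .
qed

lemma integrable_of_nn_integral_le:
  fixes f :: "'a::euclidean_space \<Rightarrow> real"
  assumes "f \<in> borel_measurable borel" "\<And>x. 0 \<le> f x" "(\<integral>\<^sup>+y. ennreal (f y) \<partial>lborel) \<le> ennreal B"
  shows "integrable lborel f"
  using assms by (intro integrableI_nonneg) (auto intro: le_less_trans[OF _ ennreal_less_top])

lemma dyadic_interval:
  fixes t :: real assumes "1 \<le> t"
  shows "\<exists>j::nat. 2 ^ j \<le> t \<and> t \<le> 2 ^ Suc j"
proof -
  obtain m :: nat where m: "t < 2 ^ m" using real_arch_pow[of 2 t] by auto
  define k where "k = (LEAST m. t < 2 ^ m)"
  have k: "t < 2 ^ k" unfolding k_def using m by (rule LeastI)
  have "k \<noteq> 0" using k assms by (intro notI) auto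
  then obtain j where j: "k = Suc j" using not0_implies_Suc by blast
  have "\<not> t < 2 ^ j" using not_less_Least[of j "\<lambda>m. t < 2 ^ m"] j unfolding k_def by simp
  then show ?thesis using k j by (intro exI[of _ j]) auto
qed

text \<open>On the shell where 1 + |y| lies between 2^j and 2^(j+1) the integrand is at most
  2^(-jN), and the enclosing ball has volume of order 2^(jd), so the shells sum to a geometric
  series of ratio 2^(d-N).\<close>

lemma integrable_inverse_powr:
  fixes N :: real
  assumes N: "real DIM('a::euclidean_space) < N"
  shows "integrable lborel (\<lambda>y::'a. 1 / (1 + norm y) powr N)"
proof -
  define d where "d = real DIM('a)"
  have q: "0 < 2 powr (d - N)" "2 powr (d - N) < 1"
    using N by (auto simp: d_def powr_less_one)
  have "(\<integral>\<^sup>+y. ennreal (1 / (1 + norm (y::'a)) powr N) \<partial>lborel)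
      \<le> ennreal (unit_ball_vol DIM('a) * (2 powr d * (1 / (1 - 2 powr (d - N)))))"
  proof (rule nn_integral_dyadic_bound[where R = "\<lambda>j. 2 ^ Suc j" and c = "\<lambda>j. 1 / (2 ^ j) powr N"])
    fix y :: 'a
    obtain j :: nat where j: "2 ^ j \<le> 1 + norm y" "1 + norm y \<le> 2 ^ Suc j"
      using dyadic_interval[of "1 + norm y"] by auto
    have "(2 ^ j) powr N \<le> (1 + norm y) powr N"
      using j N by (intro powr_mono2) auto
    then have "1 / (1 + norm y) powr N \<le> 1 / (2 ^ j) powr N"
      by (intro divide_left_mono) (auto intro!: mult_pos_pos simp: add_pos_nonneg)
    then show "\<exists>j. norm y \<le> 2 ^ Suc j \<and> ennreal (1 / (1 + norm y) powr N) \<le> ennreal (1 / (2 ^ j) powr N)"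
      using j by (intro exI[of _ j]) (auto intro!: ennreal_leI)
  next
    have "(\<lambda>j. 2 powr d * (2 powr (d - N)) ^ j) sums (2 powr d * (1 / (1 - 2 powr (d - N))))"
      using q by (intro sums_mult geometric_sums) auto
    moreover have "2 powr d * (2 powr (d - N)) ^ j = 1 / (2 ^ j) powr N * (2 ^ Suc j) ^ DIM('a)" for j
    proof -
      have "(2 ^ Suc j :: real) ^ DIM('a) = 2 powr (real (Suc j) * d)"
        unfolding d_def by (simp add: powr_realpow[symmetric] powr_powr del: power_Suc)
      moreover have "((2::real) ^ j) powr N = 2 powr (real j * N)"
        by (simp add: powr_realpow[symmetric] powr_powr)
      moreover have "(2 powr (d - N)) ^ j = 2 powr (real j * (d - N))"
        by (simp add: powr_realpow[symmetric] powr_powr mult.commute)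
      ultimately show ?thesis
        by (simp add: powr_add[symmetric] powr_diff divide_simps algebra_simps del: power_Suc)
    qed
    ultimately show "(\<lambda>j. 1 / (2 ^ j) powr N * (2 ^ Suc j) ^ DIM('a)) sums (2 powr d * (1 / (1 - 2 powr (d - N))))"
      by simp
  qed auto
  then show ?thesis
    by (intro integrable_of_nn_integral_le) auto
qed

text \<open>The counterpart at the origin: shells of radius \<tau>/2^j form a geometric series of
  ratio 2^(-e) with e = d + 2 - N. For N = d + 2s this exponent is 2 - 2s, positive because s < 1.
  The constant must not depend on \<tau>, which later shrinks with the depth of the contact
  point.\<close>

lemma kernel_second_moment:
  fixes N :: real
  assumes N: "0 < N" "N < real DIM('a::euclidean_space) + 2"
  obtains C where "0 < C"
    "\<And>\<tau>. 0 < \<tau> \<Longrightarrow> integrable lborel (\<lambda>h::'a. indicator {h. norm h < \<tau>} h * ((norm h)\<^sup>2 / norm h powr N))"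
    "\<And>\<tau>. 0 < \<tau> \<Longrightarrow> (LBINT h. indicator {h. norm h < \<tau>} (h::'a) * ((norm h)\<^sup>2 / norm h powr N))
        \<le> C * \<tau> powr (real DIM('a) + 2 - N)"
proof -
  define d where "d = real DIM('a)"
  define e where "e = d + 2 - N"
  have e: "0 < e" using N by (simp add: e_def d_def)
  have q: "0 < 2 powr (-e)" "2 powr (-e) < 1"
    using e by (auto simp: powr_less_one)
  define C where "C = unit_ball_vol d * (2 powr N * (1 / (1 - 2 powr (-e))))"
  have C0: "0 < C" unfolding C_def d_def using q by (intro mult_pos_pos) (auto simp: unit_ball_vol_pos)
  have main: "(\<integral>\<^sup>+h. ennreal (indicator {h. norm h < \<tau>} (h::'a) * ((norm h)\<^sup>2 / norm h powr N)) \<partial>lborel)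
      \<le> ennreal (C * \<tau> powr e)" if t: "0 < \<tau>" for \<tau>
  proof -
    have "(\<integral>\<^sup>+h. ennreal (indicator {h. norm h < \<tau>} (h::'a) * ((norm h)\<^sup>2 / norm h powr N)) \<partial>lborel)
      \<le> ennreal (unit_ball_vol DIM('a) * (\<tau> powr e * 2 powr N * (1 / (1 - 2 powr (-e)))))"
    proof (rule nn_integral_dyadic_bound[where R = "\<lambda>j. \<tau> / 2 ^ j"
          and c = "\<lambda>j. (\<tau> / 2 ^ j)\<^sup>2 / (\<tau> / 2 ^ Suc j) powr N"])
      fix h :: 'a
      assume "ennreal (indicator {h. norm h < \<tau>} h * ((norm h)\<^sup>2 / norm h powr N)) \<noteq> 0"
      then have h: "norm h < \<tau>" "h \<noteq> 0" by (auto simp: indicator_def split: if_splits)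
      obtain j :: nat where j: "2 ^ j \<le> \<tau> / norm h" "\<tau> / norm h \<le> 2 ^ Suc j"
        using dyadic_interval[of "\<tau> / norm h"] h by auto
      have 1: "norm h \<le> \<tau> / 2 ^ j" "\<tau> / 2 ^ Suc j \<le> norm h"
        using j h by (auto simp: field_simps)
      have "(norm h)\<^sup>2 / norm h powr N \<le> (\<tau> / 2 ^ j)\<^sup>2 / (\<tau> / 2 ^ Suc j) powr N"
        using 1 t N h by (intro frac_le power_mono powr_mono2) auto
      then show "\<exists>j. norm h \<le> \<tau> / 2 ^ j \<and> ennreal (indicator {h. norm h < \<tau>} h * ((norm h)\<^sup>2 / norm h powr N))
             \<le> ennreal ((\<tau> / 2 ^ j)\<^sup>2 / (\<tau> / 2 ^ Suc j) powr N)"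
        using 1 h by (intro exI[of _ j]) (auto intro!: ennreal_leI)
    next
      have "(\<lambda>j. \<tau> powr e * 2 powr N * (2 powr (-e)) ^ j) sums (\<tau> powr e * 2 powr N * (1 / (1 - 2 powr (-e))))"
        using q by (intro sums_mult geometric_sums) auto
      moreover have "\<tau> powr e * 2 powr N * (2 powr (-e)) ^ j
          = (\<tau> / 2 ^ j)\<^sup>2 / (\<tau> / 2 ^ Suc j) powr N * (\<tau> / 2 ^ j) ^ DIM('a)" for j
      proof -
        \<comment> \<open>All factors become exponentials of linear forms in \<open>a\<close> and
          \<open>b\<close>, so an identity mixing real and natural powers reduces to linear
          arithmetic in the exponent.\<close>
        define a where "a = ln \<tau>" define b where "b = ln (2::real)"
        have t': "\<tau> = exp a" using t by (simp add: a_def)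
        have b': "(2::real) = exp b" by (simp add: b_def)
        have p: "(2::real) ^ j = exp (real j * b)" for j
          by (simp add: b_def exp_of_nat_mult)
        have 2: "(\<tau> / 2 ^ j)\<^sup>2 = exp (2 * (a - real j * b))"
          by (simp add: t' p exp_diff[symmetric] power2_eq_square exp_add[symmetric])
        have 3: "(\<tau> / 2 ^ j) ^ DIM('a) = exp (d * (a - real j * b))"
          unfolding d_def exp_of_nat_mult by (simp add: t' p exp_diff)
        have 4: "(\<tau> / 2 ^ Suc j) powr N = exp (N * (a - real (Suc j) * b))"
          by (simp add: t' p d_def exp_diff[symmetric] powr_def del: power_Suc of_nat_Suc)
        have 5: "(2 powr (-e)) ^ j = exp (- e * real j * b)" 
          by (simp add: powr_def b_def[symmetric] exp_of_nat_mult[symmetric] mult_ac)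
        have 6: "\<tau> powr e = exp (e * a)" "2 powr N = exp (N * b)"
          by (simp_all add: t' powr_def b_def)
        show ?thesis unfolding 2 3 4 5 6
          by (simp add: exp_add[symmetric] exp_diff[symmetric] e_def algebra_simps)
      qed
      ultimately show "(\<lambda>j. (\<tau> / 2 ^ j)\<^sup>2 / (\<tau> / 2 ^ Suc j) powr N * (\<tau> / 2 ^ j) ^ DIM('a)) sums
         (\<tau> powr e * 2 powr N * (1 / (1 - 2 powr (-e))))"
        by simp
    qed (use t in auto)
    then show ?thesis by (simp add: C_def d_def mult_ac)
  qed
  show ?thesis
  proof (rule that[OF C0])
    fix \<tau> :: real assume t: "0 < \<tau>"
    show int: "integrable lborel (\<lambda>h::'a. indicator {h. norm h < \<tau>} h * ((norm h)\<^sup>2 / norm h powr N))"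
      by (rule integrable_of_nn_integral_le[OF _ _ main[OF t]]) auto
    have "ennreal (LBINT h. indicator {h. norm h < \<tau>} (h::'a) * ((norm h)\<^sup>2 / norm h powr N)) \<le> ennreal (C * \<tau> powr e)"
      using main[OF t] by (subst nn_integral_eq_integral[symmetric, OF int]) auto
    then show "(LBINT h. indicator {h. norm h < \<tau>} (h::'a) * ((norm h)\<^sup>2 / norm h powr N))
        \<le> C * \<tau> powr (real DIM('a) + 2 - N)"
      using C0 by (simp add: e_def d_def)
  qed
qed

section \<open>Truncated fractional Laplacians and touching barriers\<close>

text \<open>The positive constant C_{n,s} is left out because only signs matter. Division by zero
  makes the value at the origin 0.\<close>

definition frac_kernel :: "real \<Rightarrow> 'a::euclidean_space \<Rightarrow> real" where
  "frac_kernel s h = 1 / norm h powr (real DIM('a) + 2 * s)"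

text \<open>Borel measurability is preserved by translations and passes to product integrands. The
  weight (1 + |y|)^(n+2s) is comparable to 1 + |y|^(n+2s) and behaves better under
  translation.\<close>

definition tail_integrable :: "real \<Rightarrow> ('a::euclidean_space \<Rightarrow> real) \<Rightarrow> bool" where
  "tail_integrable s f \<longleftrightarrow> f \<in> borel_measurable borel
     \<and> integrable lborel (\<lambda>y. f y / (1 + norm y) powr (real DIM('a) + 2 * s))"

abbreviation outside :: "real \<Rightarrow> 'a::euclidean_space \<Rightarrow> real" where
  "outside \<rho> \<equiv> indicator {h. \<rho> \<le> norm h}"

definition truncated_laplacian :: "real \<Rightarrow> ('a::euclidean_space \<Rightarrow> real) \<Rightarrow> 'a \<Rightarrow> real \<Rightarrow> real" where
  "truncated_laplacian s f x \<rho> =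
     (LBINT h. (f x - f (x + h)) * frac_kernel s h * outside \<rho> h)"

text \<open>The principal value is required only along the radii 1/(j+1): one sequence tending to
  zero suffices for the contact argument, and dominated convergence delivers the limit along a
  sequence.\<close>

definition pv_superharmonic_at :: "real \<Rightarrow> ('a::euclidean_space \<Rightarrow> real) \<Rightarrow> 'a \<Rightarrow> bool" where
  "pv_superharmonic_at s f x \<longleftrightarrow>
     (\<exists>l\<ge>0. (\<lambda>j. truncated_laplacian s f x (1 / real (Suc j))) \<longlonglongrightarrow> l)"

lemma borel_measurable_frac_kernel [measurable]:
  "frac_kernel s \<in> borel_measurable borel"
  unfolding frac_kernel_def by measurable

lemma frac_kernel_nonneg [simp]: "0 \<le> frac_kernel s h"
  by (simp add: frac_kernel_def)

lemma frac_kernel_minus [simp]: "frac_kernel s (- h) = frac_kernel s h"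
  by (simp add: frac_kernel_def)

lemma frac_kernel_commute: "frac_kernel s (y - z) = frac_kernel s (z - y)"
  by (simp add: frac_kernel_def norm_minus_commute)

text \<open>The common core of the weight comparisons below: a linear bound between two distances
  becomes a bound between their inverse powers, at the cost A^N.\<close>

lemma inverse_powr_le:
  fixes p A q N :: real
  assumes "0 < p" "0 < q" "p \<le> A * q" "0 \<le> N"
  shows "1 / q powr N \<le> A powr N / p powr N"
proof -
  have A: "0 < A" using assms by (metis less_le_trans zero_less_mult_pos2)
  have "p powr N \<le> (A * q) powr N" using assms by (intro powr_mono2) auto
  also have "\<dots> = A powr N * q powr N" using A assms by (simp add: powr_mult)
  finally show ?thesis using assms by (simp add: divide_simps)
qed

lemma frac_kernel_le:
  fixes h :: "'a::euclidean_space"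
  assumes "0 < s" "0 < p" "p \<le> A * norm h"
  shows "frac_kernel s h \<le> A powr (real DIM('a) + 2 * s) / p powr (real DIM('a) + 2 * s)"
proof -
  have "0 < norm h" using assms by (cases "h = 0") auto
  then show ?thesis
    unfolding frac_kernel_def using assms by (intro inverse_powr_le) auto
qed

section \<open>Integrability against the truncated kernel\<close>

lemma tail_integrable_measurable [measurable_dest]:
  "tail_integrable s f \<Longrightarrow> f \<in> borel_measurable borel"
  by (simp add: tail_integrable_def)

lemma tail_integrable_const: "0 < s \<Longrightarrow> tail_integrable s (\<lambda>y::'a::euclidean_space. c)"
  using integrable_mult_right[OF integrable_inverse_powr[where 'a = 'a, of "real DIM('a) + 2 * s"], of c]
  by (simp add: tail_integrable_def)

lemma tail_integrable_diff:
  "tail_integrable s f \<Longrightarrow> tail_integrable s g \<Longrightarrow> tail_integrable s (\<lambda>y. f y - g y)"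
  by (auto simp: tail_integrable_def diff_divide_distrib)

lemma tail_integrable_bound:
  fixes f g :: "'a::euclidean_space \<Rightarrow> real"
  assumes "tail_integrable s f" "g \<in> borel_measurable borel" "\<And>y. \<bar>g y\<bar> \<le> \<bar>f y\<bar>"
  shows "tail_integrable s g"
proof -
  have [measurable]: "g \<in> borel_measurable borel" by fact
  have "integrable lborel (\<lambda>y. f y / (1 + norm y) powr (real DIM('a) + 2 * s))"
    using assms(1) by (simp add: tail_integrable_def)
  then have "integrable lborel (\<lambda>y. g y / (1 + norm y) powr (real DIM('a) + 2 * s))"
    by (rule Bochner_Integration.integrable_bound) (measurable, simp add: assms(3) divide_right_mono)
  then show ?thesis by (simp add: tail_integrable_def)
qed

lemma tail_integrable_kernel:
  fixes f :: "'a::euclidean_space \<Rightarrow> real"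
  assumes f: "tail_integrable s f" and s: "0 < s" and t: "0 < \<tau>"
  shows "integrable lborel (\<lambda>h. f (x + h) * frac_kernel s h * outside \<tau> h)"
proof -
  define N where "N = real DIM('a) + 2 * s"
  define A where "A = (1 + norm x) / \<tau> + 1"
  have [measurable]: "f \<in> borel_measurable borel" using f by measurable
  have "integrable lborel (\<lambda>y. f y / (1 + norm y) powr N)"
    using f by (simp add: tail_integrable_def N_def)
  then have "integrable lborel (\<lambda>h. f (x + h) / (1 + norm (x + h)) powr N)"
    by (subst integrable_lborel_translate_iff[where f = "\<lambda>y. f y / (1 + norm y) powr N"]) measurable
  then have "integrable lborel (\<lambda>h. A powr N * (f (x + h) / (1 + norm (x + h)) powr N))"
    by (rule integrable_mult_right)
  then show ?thesis
  proof (rule Bochner_Integration.integrable_bound)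
    show "AE h in lborel. norm (f (x + h) * frac_kernel s h * outside \<tau> h)
        \<le> norm (A powr N * (f (x + h) / (1 + norm (x + h)) powr N))"
    proof (rule AE_I2)
      fix h
      show "norm (f (x + h) * frac_kernel s h * outside \<tau> h)
        \<le> norm (A powr N * (f (x + h) / (1 + norm (x + h)) powr N))"
      proof (cases "\<tau> \<le> norm h")
        case True
        \<comment> \<open>Outside radius \<tau> the bounded part 1 + |x| is paid for by |h|/\<tau>
          >= 1; this makes the distance to the origin comparable to the distance to x.\<close>
        have "1 + norm x \<le> ((1 + norm x) / \<tau>) * norm h"
          using True t mult_left_mono[OF True, of "1 + norm x"] by (simp add: field_simps)
        then have "1 + norm (x + h) \<le> A * norm h"
          using norm_triangle_ineq[of x h] by (simp add: A_def algebra_simps)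
        then have "frac_kernel s h \<le> A powr N / (1 + norm (x + h)) powr N"
          unfolding N_def using s by (intro frac_kernel_le) (auto simp: add_pos_nonneg)
        then have "\<bar>f (x + h)\<bar> * frac_kernel s h \<le> \<bar>f (x + h)\<bar> * (A powr N / (1 + norm (x + h)) powr N)"
          by (intro mult_left_mono) auto
        then show ?thesis using True by (simp add: abs_mult mult_ac)
      qed simp
    qed
  qed measurable
qed

lemma truncated_kernel_integrable:
  "0 < s \<Longrightarrow> 0 < \<tau> \<Longrightarrow> integrable lborel (\<lambda>h. frac_kernel s h * outside \<tau> h)"
  using tail_integrable_kernel[OF tail_integrable_const, of s \<tau> 1] by simp

lemma truncated_laplacian_integrable:
  assumes "tail_integrable s f" "0 < s" "0 < \<tau>"
  shows "integrable lborel (\<lambda>h. (f x - f (x + h)) * frac_kernel s h * outside \<tau> h)"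
    and "integrable lborel (\<lambda>h. (f (x + h) - f x) * frac_kernel s h * outside \<tau> h)"
proof -
  have "tail_integrable s (\<lambda>y. f x - f y)" "tail_integrable s (\<lambda>y. f y - f x)"
    using assms by (auto intro: tail_integrable_diff tail_integrable_const)
  then show "integrable lborel (\<lambda>h. (f x - f (x + h)) * frac_kernel s h * outside \<tau> h)"
    and "integrable lborel (\<lambda>h. (f (x + h) - f x) * frac_kernel s h * outside \<tau> h)"
    using tail_integrable_kernel[OF _ assms(2,3)] by blast+
qed

text \<open>Only the annulus \<tau> < |h| <= 2\<tau> is counted: the kernel is at least
  (2\<tau>)^(-N) there, and the volume is at least that of the ball of radius \<tau> because 2^n - 1
  >= 1.\<close>

lemma kernel_tail_lower_bound:
  fixes s :: real
  assumes s: "0 < s"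
  obtains c where "0 < c"
    "\<And>\<tau>. 0 < \<tau> \<Longrightarrow> c * \<tau> powr (- 2 * s) \<le> (LBINT h. frac_kernel s (h::'a::euclidean_space) * outside \<tau> h)"
proof -
  define n where "n = DIM('a)"
  define N where "N = real n + 2 * s"
  define c where "c = 2 powr (- N) * unit_ball_vol n"
  have "0 < c" by (simp add: c_def)
  moreover have "c * \<tau> powr (- 2 * s) \<le> (LBINT h. frac_kernel s (h::'a) * outside \<tau> h)"
    if t: "0 < \<tau>" for \<tau>
  proof -
    have fin: "integrable lborel (indicator (cball 0 r) :: 'a \<Rightarrow> real)" for r
      using emeasure_lborel_cball_finite[of "0::'a" r] by (intro integrable_real_indicator) auto
    have "c * \<tau> powr (- 2 * s) = (2 * \<tau>) powr (-N) * (unit_ball_vol n * \<tau> ^ n)"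
      using t by (simp add: c_def N_def powr_mult powr_realpow[symmetric] powr_add[symmetric])
    also have "\<dots> \<le> (2 * \<tau>) powr (-N) * (unit_ball_vol n * (2 * \<tau>) ^ n - unit_ball_vol n * \<tau> ^ n)"
    proof (intro mult_left_mono)
      have "(2::real) ^ 1 \<le> 2 ^ n" by (intro power_increasing) (auto simp: n_def Suc_le_eq)
      then have "2 * \<tau> ^ n \<le> (2 * \<tau>) ^ n" using t by (simp add: power_mult_distrib)
      then have "unit_ball_vol n * (2 * \<tau> ^ n) \<le> unit_ball_vol n * (2 * \<tau>) ^ n"
        by (intro mult_left_mono) auto
      then show "unit_ball_vol n * \<tau> ^ n \<le> unit_ball_vol n * (2 * \<tau>) ^ n - unit_ball_vol n * \<tau> ^ n" by simp
    qed auto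
    also have "\<dots> = (LBINT h. (2 * \<tau>) powr (-N) * (indicator (cball 0 (2 * \<tau>)) (h::'a) - indicator (cball 0 \<tau>) h))"
      using t fin by (simp add: content_cball n_def)
    also have "\<dots> \<le> (LBINT h. frac_kernel s (h::'a) * outside \<tau> h)"
    proof (intro integral_mono truncated_kernel_integrable s t)
      show "integrable lborel (\<lambda>h::'a. (2 * \<tau>) powr (-N) * (indicator (cball 0 (2 * \<tau>)) h - indicator (cball 0 \<tau>) h))"
        using fin by (intro integrable_mult_right Bochner_Integration.integrable_diff)
      fix h :: 'a
      show "(2 * \<tau>) powr (-N) * (indicator (cball 0 (2 * \<tau>)) h - indicator (cball 0 \<tau>) h)
          \<le> frac_kernel s h * outside \<tau> h"
      proof (cases "\<tau> < norm h \<and> norm h \<le> 2 * \<tau>")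
        case True
        then have "norm h powr N \<le> (2 * \<tau>) powr N"
          using s by (intro powr_mono2) (auto simp: N_def)
        moreover have "0 < norm h" using True t by linarith
        ultimately have "(2 * \<tau>) powr (-N) \<le> 1 / norm h powr N"
          using t by (simp add: powr_minus divide_simps)
        then show ?thesis using True by (simp add: frac_kernel_def N_def n_def)
      next
        case False
        then have "(indicator (cball 0 (2 * \<tau>)) h - indicator (cball 0 \<tau>) h :: real) = 0"
          using t by (auto simp: indicator_def)
        then show ?thesis by (simp only:) simp
      qed
    qed
    finally show ?thesis .
  qed
  ultimately show ?thesis by (rule that)
qed

text \<open>The odd part of the barrier is invisible to the principal value, so only its quadratic part is paid for.\<close>

lemma touching_from_below:
  fixes s :: real
  assumes s: "0 < s" "s < 1"
  obtains C where "0 < C"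
    "\<And>v (x::'a::euclidean_space) \<tau> a l. \<lbrakk>tail_integrable s v; pv_superharmonic_at s v x; 0 < \<tau>; 0 \<le> a;
        \<And>h. norm h < \<tau> \<Longrightarrow> l \<bullet> h - a * (norm h)\<^sup>2 \<le> v (x + h) - v x\<rbrakk> \<Longrightarrow>
      (LBINT h. (v (x + h) - v x) * frac_kernel s h * outside \<tau> h)
        \<le> C * a * \<tau> powr (2 - 2 * s)"
proof -
  define N where "N = real DIM('a) + 2 * s"
  obtain C where C: "0 < C"
    "\<And>\<tau>. 0 < \<tau> \<Longrightarrow> integrable lborel (\<lambda>h::'a. indicator {h. norm h < \<tau>} h * ((norm h)\<^sup>2 / norm h powr N))"
    "\<And>\<tau>. 0 < \<tau> \<Longrightarrow> (LBINT h. indicator {h. norm h < \<tau>} (h::'a) * ((norm h)\<^sup>2 / norm h powr N))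
        \<le> C * \<tau> powr (real DIM('a) + 2 - N)"
    by (rule kernel_second_moment[where 'a = 'a, of N]) (use s in \<open>auto simp: N_def\<close>)
  have "(LBINT h. (v (x + h) - v x) * frac_kernel s h * outside \<tau> h)
        \<le> C * a * \<tau> powr (2 - 2 * s)"
    if v: "tail_integrable s v" and sup: "pv_superharmonic_at s v x" and t: "0 < \<tau>" and a: "0 \<le> a"
      and touch: "\<And>h. norm h < \<tau> \<Longrightarrow> l \<bullet> h - a * (norm h)\<^sup>2 \<le> v (x + h) - v x"
    for v and x :: 'a and \<tau> a l
  proof -
    let ?T = "\<lambda>h. (v (x + h) - v x) * frac_kernel s h * outside \<tau> h"
    let ?Q = "\<lambda>h::'a. indicator {h. norm h < \<tau>} h * ((norm h)\<^sup>2 / norm h powr N)"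
    have intT: "integrable lborel ?T"
      by (rule truncated_laplacian_integrable) fact+
    \<comment> \<open>The right-hand side is free of \<rho>, so the bound survives \<rho> tending to
      0. The integrand is split at |h| = \<tau>, and the barrier is used only inside.\<close>
    have le: "truncated_laplacian s v x \<rho> \<le> - integral\<^sup>L lborel ?T + a * integral\<^sup>L lborel ?Q"
      if r: "0 < \<rho>" "\<rho> < \<tau>" for \<rho>
    proof -
      \<comment> \<open>The linear part, restricted to the annulus between \<rho> and \<tau>.
        Against the full kernel it need not be integrable at the origin; on the annulus it is, and
        oddness makes its integral vanish.\<close>
      let ?O = "\<lambda>h. (l \<bullet> h) * frac_kernel s h * indicator {h. \<rho> \<le> norm h \<and> norm h < \<tau>} h"
      have "integrable lborel (\<lambda>h::'a. (norm l * \<tau>) * (frac_kernel s h * outside \<rho> h))"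
        using r s by (intro integrable_mult_right truncated_kernel_integrable) auto
      then have intO: "integrable lborel ?O"
      proof (rule Bochner_Integration.integrable_bound)
        show "AE h in lborel. norm (?O h) \<le> norm ((norm l * \<tau>) * (frac_kernel s h * outside \<rho> h))"
        proof (rule AE_I2)
          fix h
          show "norm (?O h) \<le> norm ((norm l * \<tau>) * (frac_kernel s h * outside \<rho> h))"
          proof (cases "\<rho> \<le> norm h \<and> norm h < \<tau>")
            case True
            have "\<bar>l \<bullet> h\<bar> \<le> norm l * norm h" by (rule Cauchy_Schwarz_ineq2)
            also have "\<dots> \<le> norm l * \<tau>" using True by (intro mult_left_mono) auto
            finally show ?thesis using True t by (simp add: abs_mult mult_right_mono)
          qed simp
        qed
      qed measurable
      have odd: "integral\<^sup>L lborel ?O = 0"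
        by (rule integral_lborel_odd) (measurable, auto simp: indicator_def)
      have "truncated_laplacian s v x \<rho> \<le> (LBINT h. - ?T h - ?O h + a * ?Q h)"
        unfolding truncated_laplacian_def
      proof (rule integral_mono)
        show "integrable lborel (\<lambda>h. (v x - v (x + h)) * frac_kernel s h * outside \<rho> h)"
          using v s r by (intro truncated_laplacian_integrable) auto
        show "integrable lborel (\<lambda>h. - ?T h - ?O h + a * ?Q h)"
          by (intro Bochner_Integration.integrable_add Bochner_Integration.integrable_diff integrable_minus
              integrable_mult_right intT intO C(2)[OF t])
        fix h :: 'a
        show "(v x - v (x + h)) * frac_kernel s h * outside \<rho> h \<le> - ?T h - ?O h + a * ?Q h"
        proof (cases "norm h < \<tau>")
          case False
          then show ?thesis using r by (simp add: algebra_simps)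
        next
          case True
          show ?thesis
          proof (cases "\<rho> \<le> norm h")
            case False
            then show ?thesis using True a by simp
          next
            case 2: True
            have "(v x - v (x + h)) * frac_kernel s h \<le> (- (l \<bullet> h) + a * (norm h)\<^sup>2) * frac_kernel s h"
              using touch[OF True] by (intro mult_right_mono) auto
            moreover have "a * ?Q h = a * (norm h)\<^sup>2 * frac_kernel s h"
              using True by (simp add: frac_kernel_def N_def)
            ultimately show ?thesis using True 2 by (simp add: distrib_right left_diff_distrib)
          qed
        qed
      qed
      also have "\<dots> = - integral\<^sup>L lborel ?T - integral\<^sup>L lborel ?O + a * integral\<^sup>L lborel ?Q"
      proof -
        have "(LBINT h. - ?T h - ?O h + a * ?Q h) = (LBINT h. - ?T h - ?O h) + (LBINT h. a * ?Q h)"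
          by (intro Bochner_Integration.integral_add Bochner_Integration.integrable_diff integrable_minus
              integrable_mult_right intT intO C(2)[OF t])
        also have "(LBINT h. - ?T h - ?O h) = (LBINT h. - ?T h) - (LBINT h. ?O h)"
          by (intro Bochner_Integration.integral_diff integrable_minus intT intO)
        finally show ?thesis unfolding integral_minus integral_mult_right_zero .
      qed
      finally show ?thesis unfolding odd by linarith
    qed
    obtain L where L: "0 \<le> L" "(\<lambda>j. truncated_laplacian s v x (1 / real (Suc j))) \<longlonglongrightarrow> L"
      using sup by (auto simp: pv_superharmonic_at_def)
    have "(\<lambda>j. 1 / real (Suc j)) \<longlonglongrightarrow> 0"
      using LIMSEQ_inverse_real_of_nat by (simp add: inverse_eq_divide)
    then have "\<forall>\<^sub>F j in sequentially. 1 / real (Suc j) < \<tau>"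
      using t by (rule order_tendstoD)
    then have "\<forall>\<^sub>F j in sequentially. truncated_laplacian s v x (1 / real (Suc j)) \<le> - integral\<^sup>L lborel ?T + a * integral\<^sup>L lborel ?Q"
      by eventually_elim (intro le, auto)
    then have "L \<le> - integral\<^sup>L lborel ?T + a * integral\<^sup>L lborel ?Q"
      by (intro tendsto_upperbound[OF L(2)]) auto
    moreover have "a * integral\<^sup>L lborel ?Q \<le> a * (C * \<tau> powr (2 - 2 * s))"
      using C(3)[OF t] a by (intro mult_left_mono) (auto simp: N_def)
    moreover have "a * (C * \<tau> powr (2 - 2 * s)) = C * a * \<tau> powr (2 - 2 * s)"
      by (simp only: mult_ac)
    ultimately show ?thesis using L(1) by linarith
  qed
  with C(1) show ?thesis by (rule that)
qed

section \<open>Pointwise lower bounds\<close>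

text \<open>This is r^(-n) times the profile of radius 1 at y/r, so its total mass does not depend
  on r. It is also r^(2s) times the kernel with the singularity smoothed at scale r, so a single
  weight measures nearby mass and tails together.\<close>

definition tail_weight :: "real \<Rightarrow> real \<Rightarrow> 'a::euclidean_space \<Rightarrow> real" where
  "tail_weight s r y = r powr (2 * s) / (r + norm y) powr (real DIM('a) + 2 * s)"

lemma borel_measurable_tail_weight [measurable]:
  "tail_weight s r \<in> borel_measurable borel"
  unfolding tail_weight_def by measurable

lemma tail_weight_nonneg [simp]: "0 \<le> tail_weight s r y"
  by (simp add: tail_weight_def)

lemma tail_weight_pos: "0 < r \<Longrightarrow> 0 < tail_weight s r y"
  unfolding tail_weight_def by (intro divide_pos_pos powr_gt_zero[THEN iffD2]) (auto dest: add_pos_nonneg[OF _ norm_ge_zero, of _ y])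

lemma tail_integrable_weight:
  fixes f :: "'a::euclidean_space \<Rightarrow> real"
  assumes f: "tail_integrable s f" and s: "0 < s" and r: "0 < r"
  shows "integrable lborel (\<lambda>y. f y * tail_weight s r (y - x))"
proof -
  define N where "N = real DIM('a) + 2 * s"
  define A where "A = 1 + (1 + norm x) / r"
  have [measurable]: "f \<in> borel_measurable borel" using f by measurable
  have "integrable lborel (\<lambda>y. r powr (2 * s) * A powr N * (f y / (1 + norm y) powr N))"
    using f by (intro integrable_mult_right) (simp add: tail_integrable_def N_def)
  then show ?thesis
  proof (rule Bochner_Integration.integrable_bound)
    show "AE y in lborel. norm (f y * tail_weight s r (y - x))
        \<le> norm (r powr (2 * s) * A powr N * (f y / (1 + norm y) powr N))"
    proof (rule AE_I2)
      fix y
      have "1 + norm y \<le> 1 + norm x + norm (y - x)"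
        using norm_triangle_ineq[of x "y - x"] by simp
      also have "\<dots> \<le> A * (r + norm (y - x))"
        using r by (simp add: A_def field_simps)
      finally have "1 / (r + norm (y - x)) powr N \<le> A powr N / (1 + norm y) powr N"
        using r s by (intro inverse_powr_le) (auto simp: N_def add_pos_nonneg)
      then have "\<bar>f y\<bar> * r powr (2 * s) * (1 / (r + norm (y - x)) powr N)
          \<le> \<bar>f y\<bar> * r powr (2 * s) * (A powr N / (1 + norm y) powr N)"
        by (intro mult_left_mono) auto
      then show "norm (f y * tail_weight s r (y - x)) \<le> norm (r powr (2 * s) * A powr N * (f y / (1 + norm y) powr N))"
        by (simp add: tail_weight_def N_def abs_mult mult_ac)
    qed
  qed measurable
qed

text \<open>Supplies the second-order expansion of the barrier at the contact point; only an upper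
  bound is needed, since the barrier majorises the deficit. The induction divides by 1 + x and
  compares with the next quadratic: constant and linear terms match, leaving a multiple of
  x^2.\<close>

lemma inverse_power_quadratic_bound:
  obtains K :: real where "0 < K"
    "\<And>x. \<bar>x\<bar> \<le> 1 / 2 \<Longrightarrow> 1 / (1 + x) ^ n \<le> 1 - real n * x + K * x\<^sup>2"
proof -
  have "\<exists>K>0. \<forall>x::real. \<bar>x\<bar> \<le> 1 / 2 \<longrightarrow> 1 / (1 + x) ^ n \<le> 1 - real n * x + K * x\<^sup>2"
  proof (induction n)
    case 0
    show ?case by (intro exI[of _ 1]) auto
  next
    case (Suc n)
    then obtain K where K: "0 < K" "\<And>x. \<bar>x\<bar> \<le> 1 / 2 \<Longrightarrow> 1 / (1 + x) ^ n \<le> 1 - real n * x + K * x\<^sup>2"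
      by blast
    \<comment> \<open>Chosen so that \<open>K' - real (Suc n) - K\<close> equals K'/2, which
      dominates \<open>- K' * x\<close> for |x| <= 1/2.\<close>
    define K' where "K' = 2 * K + 2 + 2 * real n"
    have "1 / (1 + x) ^ Suc n \<le> 1 - real (Suc n) * x + K' * x\<^sup>2" if x: "\<bar>x\<bar> \<le> 1 / 2" for x :: real
    proof -
      have p: "0 < 1 + x" using x by linarith
      have "1 / (1 + x) ^ Suc n = 1 / (1 + x) ^ n / (1 + x)" by simp
      also have "\<dots> \<le> (1 - real n * x + K * x\<^sup>2) / (1 + x)"
        using K(2)[OF x] p by (intro divide_right_mono) auto
      also have "\<dots> \<le> 1 - real (Suc n) * x + K' * x\<^sup>2"
      proof -
        have "(1 - real (Suc n) * x + K' * x\<^sup>2) * (1 + x) - (1 - real n * x + K * x\<^sup>2)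
            = (K' - real (Suc n) - K + K' * x) * x\<^sup>2"
          by (simp add: algebra_simps power2_eq_square power3_eq_cube)
        moreover have "0 \<le> K' - real (Suc n) - K + K' * x"
        proof -
          have "K' * (- 1 / 2) \<le> K' * x"
            using x K(1) by (intro mult_left_mono) (auto simp: K'_def)
          moreover have "K' - real (Suc n) - K = K' / 2" by (simp add: K'_def)
          ultimately show ?thesis by linarith
        qed
        ultimately have "1 - real n * x + K * x\<^sup>2 \<le> (1 - real (Suc n) * x + K' * x\<^sup>2) * (1 + x)"
          by (metis diff_ge_0_iff_ge mult_nonneg_nonneg zero_le_power2)
        then show ?thesis using p by (simp add: pos_divide_le_eq)
      qed
      finally show ?thesis .
    qed
    moreover have "0 < K'" using K(1) by (simp add: K'_def)
    ultimately show ?case by blast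
  qed
  then show ?thesis using that by blast
qed

text \<open>Compare \<open>(k - v)\<^sup>+\<close> with the barrier \<open>M (1 - |x - x\<^sub>0|\<^sup>2 / r\<^sup>2)\<^sup>-\<^sup>n\<close> with \<open>M\<close> minimal: at the
  contact point the mass at distance at least \<open>\<tau>\<close>, a small multiple of the distance to the boundary,
  dominates the quadratic error of the barrier, and this bounds \<open>M\<close>.\<close>

lemma local_lower_bound:
  fixes s :: real
  assumes s: "0 < s" "s < 1"
  obtains C where "0 < C"
    "\<And>v (x0::'a::euclidean_space) r k x. \<lbrakk>tail_integrable s v; 0 < r; continuous_on (cball x0 r) v;
        \<And>x. x \<in> ball x0 r \<Longrightarrow> pv_superharmonic_at s v x; x \<in> ball x0 (r / 2)\<rbrakk> \<Longrightarrow>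
      k - C * (LBINT y. max 0 (k - v y) * tail_weight s r (y - x0)) \<le> v x"
proof -
  define n where "n = DIM('a)"
  define N where "N = real n + 2 * s"
  obtain C1 where C1: "0 < C1"
    "\<And>v (x::'a) \<tau> a l. \<lbrakk>tail_integrable s v; pv_superharmonic_at s v x; 0 < \<tau>; 0 \<le> a;
        \<And>h. norm h < \<tau> \<Longrightarrow> l \<bullet> h - a * (norm h)\<^sup>2 \<le> v (x + h) - v x\<rbrakk> \<Longrightarrow>
      (LBINT h. (v (x + h) - v x) * frac_kernel s h * outside \<tau> h)
        \<le> C1 * a * \<tau> powr (2 - 2 * s)"
    by (rule touching_from_below[OF s, where 'a = 'a]) blast
  obtain c0 where c0: "0 < c0"
    "\<And>\<tau>. 0 < \<tau> \<Longrightarrow> c0 * \<tau> powr (- 2 * s) \<le> (LBINT h. frac_kernel s (h::'a) * outside \<tau> h)"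
    by (rule kernel_tail_lower_bound[OF s(1), where 'a = 'a]) blast
  obtain K where K: "0 < K"
    "\<And>x::real. \<bar>x\<bar> \<le> 1 / 2 \<Longrightarrow> 1 / (1 + x) ^ n \<le> 1 - real n * x + K * x\<^sup>2"
    by (rule inverse_power_quadratic_bound[of n]) blast
  \<comment> \<open>The quadratic coefficient of the barrier at contact: n comes from the |h|^2 part
    of the increment of |y - x0|^2, and 9K from the squared relative increment, at most (3|h|/(r
    t))^2.\<close>
  define B where "B = real n + 9 * K"
  have B: "0 < B" using K by (simp add: B_def)
  \<comment> \<open>The bound 1/6 keeps the relative change of \<open>t\<close> at most 1/2, where
    the quadratic expansion holds. The square root makes the barrier error at most half of the
    kernel tail, so that it can be absorbed.\<close>
  define \<theta> where "\<theta> = min (1 / 6) (sqrt (c0 / (2 * C1 * B)))"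
  have th: "0 < \<theta>" "\<theta> \<le> 1 / 6" using B C1 c0 by (auto simp: \<theta>_def)
  have th2: "C1 * B * \<theta>\<^sup>2 \<le> c0 / 2"
  proof -
    have "\<theta>\<^sup>2 \<le> (sqrt (c0 / (2 * C1 * B)))\<^sup>2"
      using th by (intro power_mono) (auto simp: \<theta>_def)
    also have "\<dots> = c0 / (2 * C1 * B)" using B C1 c0 by simp
    finally show ?thesis using B C1 by (simp add: field_simps)
  qed
  \<comment> \<open>3^N and \<theta>^(-n) come from comparing the kernel outside \<tau> with the
    weight of radius r; 2/c0 comes from the half of the kernel tail left after absorption.\<close>
  define C2 where "C2 = 2 / c0 * 3 powr N / \<theta> ^ n"
  have C2: "0 < C2" using c0 th by (simp add: C2_def)
  have main: "k - (4 / 3) ^ n * C2 * (LBINT y. max 0 (k - v y) * tail_weight s r (y - x0)) \<le> v x"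
    if v: "tail_integrable s v" and r: "0 < r" and cont: "continuous_on (cball x0 r) v"
      and sup: "\<And>x. x \<in> ball x0 r \<Longrightarrow> pv_superharmonic_at s v x" and x: "x \<in> ball x0 (r / 2)"
    for v and x0 :: 'a and r k x
  proof -
    define z where "z y = max 0 (k - v y)" for y
    define t where "t y = 1 - (norm (y - x0))\<^sup>2 / r\<^sup>2" for y
    define Z where "Z = (LBINT y. z y * tail_weight s r (y - x0))"
    have z0: "0 \<le> z y" for y by (simp add: z_def)
    have vz: "k - z y \<le> v y" for y by (simp add: z_def)
    have [measurable]: "v \<in> borel_measurable borel" using v by measurable
    have zt: "tail_integrable s z"
    proof (rule tail_integrable_bound)
      show "tail_integrable s (\<lambda>y. k - v y)"
        using v s by (intro tail_integrable_diff tail_integrable_const)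
      show "z \<in> borel_measurable borel" unfolding z_def by measurable
    qed (simp add: z_def)
    have [measurable]: "z \<in> borel_measurable borel" using zt by measurable
    have Z0: "0 \<le> Z" unfolding Z_def by (intro integral_nonneg_AE AE_I2) (simp add: z0)
    have t_pos: "0 < t y \<longleftrightarrow> y \<in> ball x0 r" for y
    proof -
      have "0 < t y \<longleftrightarrow> (norm (y - x0))\<^sup>2 < r\<^sup>2" using r by (simp add: t_def)
      also have "\<dots> \<longleftrightarrow> norm (y - x0) < r"
        using r power2_less_imp_less[of "norm (y - x0)" r] power_strict_mono[of "norm (y - x0)" r 2] by auto
      finally show ?thesis by (simp add: dist_norm norm_minus_commute)
    qed
    have t_nonneg: "0 \<le> t y" if "y \<in> cball x0 r" for y
    proof -
      have "(norm (y - x0))\<^sup>2 \<le> r\<^sup>2" using that by (intro power_mono) (auto simp: dist_norm norm_minus_commute)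
      then show ?thesis using r by (simp add: t_def)
    qed
    \<comment> \<open>The least M with z <= M t^(-n) is the maximum of z t^n. Maximising the product
      avoids the blow-up of the barrier at the boundary.\<close>
    have "continuous_on (cball x0 r) (\<lambda>y. z y * t y ^ n)"
      unfolding z_def t_def by (intro continuous_intros cont) (use r in auto)
    then have "\<exists>x\<in>cball x0 r. \<forall>y\<in>cball x0 r. z y * t y ^ n \<le> z x * t x ^ n"
      using r by (intro continuous_attains_sup) auto
    then obtain x1 where x1: "x1 \<in> cball x0 r" "\<And>y. y \<in> cball x0 r \<Longrightarrow> z y * t y ^ n \<le> z x1 * t x1 ^ n"
      by blast
    have M: "z x1 * t x1 ^ n \<le> C2 * Z"
    proof (cases "z x1 = 0 \<or> t x1 = 0")
      case True
      \<comment> \<open>When \<open>t x1\<close> vanishes, so does its power, because the dimension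
        n is at least 1.\<close>
      then have "z x1 * t x1 ^ n = 0" by (auto simp: n_def)
      moreover have "0 \<le> C2 * Z" using C2 Z0 by simp
      ultimately show ?thesis by linarith
    next
      case False
      define z1 where "z1 = z x1" define t1 where "t1 = t x1"
      have z1: "0 < z1" using False z0[of x1] by (simp add: z1_def)
      have t1: "0 < t1" using False t_nonneg[OF x1(1)] unfolding t1_def by linarith
      have t1': "t1 \<le> 1" by (simp add: t1_def t_def)
      note t1 = t1 t1'
      have x1b: "x1 \<in> ball x0 r" using t1 t_pos by (simp add: t1_def)
      have vx1: "v x1 = k - z1" using z1 by (auto simp: z1_def z_def max_def split: if_splits)
      define \<tau> where "\<tau> = \<theta> * r * t1"
      have tau: "0 < \<tau>" "\<tau> \<le> r"
      proof -
        show "0 < \<tau>" using th r t1 by (simp add: \<tau>_def)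
        have "\<theta> * t1 * r \<le> 1 * 1 * r" using th r t1 by (intro mult_right_mono mult_mono) auto
        then show "\<tau> \<le> r" by (simp add: \<tau>_def mult_ac)
      qed
      \<comment> \<open>\<open>l\<close> is the gradient at \<open>x1\<close> of k - z1 (t1/t)^n,
        the barrier read as a minorant of \<open>v\<close>; \<open>a\<close> bounds its second-order
        loss on the ball of radius \<tau>.\<close>
      define l where "l = (- (2 * real n * z1 / (r\<^sup>2 * t1))) *\<^sub>R (x1 - x0)"
      define a where "a = z1 * B / (r\<^sup>2 * t1\<^sup>2)"
      have touch: "l \<bullet> h - a * (norm h)\<^sup>2 \<le> v (x1 + h) - v x1" if h: "norm h < \<tau>" for h
      proof -
        \<comment> \<open>\<open>p\<close> is the increment of |y - x0|^2 from \<open>x1\<close> to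
          \<open>x1 + h\<close>, and \<open>\<xi>\<close> is the resulting relative change of
          \<open>t\<close>, so that t(x1 + h) = t1 (1 + \<xi>).\<close>
        define p where "p = 2 * ((x1 - x0) \<bullet> h) + (norm h)\<^sup>2"
        define \<xi> where "\<xi> = - p / (r\<^sup>2 * t1)"
        have "\<bar>p\<bar> \<le> 2 * \<bar>(x1 - x0) \<bullet> h\<bar> + (norm h)\<^sup>2"
          unfolding p_def using zero_le_power2[of "norm h"] by linarith
        also have "\<dots> \<le> 2 * (r * norm h) + r * norm h"
        proof (intro add_mono mult_left_mono)
          have "\<bar>(x1 - x0) \<bullet> h\<bar> \<le> norm (x1 - x0) * norm h" by (rule Cauchy_Schwarz_ineq2)
          also have "\<dots> \<le> r * norm h" using x1b by (intro mult_right_mono) (auto simp: dist_norm norm_minus_commute)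
          finally show "\<bar>(x1 - x0) \<bullet> h\<bar> \<le> r * norm h" .
          show "(norm h)\<^sup>2 \<le> r * norm h" using h tau by (simp add: power2_eq_square mult_right_mono)
        qed auto
        finally have p: "\<bar>p\<bar> \<le> 3 * r * norm h" by simp
        have xi: "\<bar>\<xi>\<bar> \<le> 3 * norm h / (r * t1)"
        proof -
          have "\<bar>\<xi>\<bar> = \<bar>p\<bar> / (r\<^sup>2 * t1)" using r t1 by (simp add: \<xi>_def abs_mult)
          also have "\<dots> \<le> 3 * r * norm h / (r\<^sup>2 * t1)" using p r t1 by (intro divide_right_mono) auto
          also have "\<dots> = 3 * norm h / (r * t1)" using r t1 by (simp add: field_simps power2_eq_square)
          finally show ?thesis .
        qed
        also have "\<dots> \<le> 3 * \<tau> / (r * t1)" using h r t1 by (intro divide_right_mono) auto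
        also have "\<dots> = 3 * \<theta>" using r t1 by (simp add: \<tau>_def)
        finally have xi2: "\<bar>\<xi>\<bar> \<le> 1 / 2" using th by simp
        then have xi3: "0 < 1 + \<xi>" by linarith
        have ty: "t (x1 + h) = t1 * (1 + \<xi>)"
        proof -
          have "(norm (x1 + h - x0))\<^sup>2 = (norm (x1 - x0))\<^sup>2 + p"
            unfolding power2_norm_eq_inner p_def by (simp add: inner_diff inner_add inner_commute algebra_simps)
          then have "t (x1 + h) = t1 - p / r\<^sup>2"
            by (simp add: t1_def t_def add_divide_distrib)
          moreover have "t1 * \<xi> = - p / r\<^sup>2" using t1 r by (simp add: \<xi>_def)
          ultimately show ?thesis by (simp add: distrib_left)
        qed
        have "0 < t (x1 + h)" using ty t1 xi3 by simp
        then have "x1 + h \<in> cball x0 r" using t_pos[of "x1 + h"] by auto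
        then have "z (x1 + h) * (t1 * (1 + \<xi>)) ^ n \<le> z1 * t1 ^ n"
          using x1(2)[of "x1 + h"] by (simp add: ty z1_def t1_def)
        then have "(z (x1 + h) * (1 + \<xi>) ^ n) * t1 ^ n \<le> z1 * t1 ^ n"
          by (simp only: power_mult_distrib mult_ac)
        then have "z (x1 + h) * (1 + \<xi>) ^ n \<le> z1"
          using t1 by (simp only: mult_le_cancel_right_pos zero_less_power)
        then have "z (x1 + h) \<le> z1 * (1 / (1 + \<xi>) ^ n)"
          using xi3 by (simp add: pos_le_divide_eq)
        also have "\<dots> \<le> z1 * (1 - real n * \<xi> + K * \<xi>\<^sup>2)"
          using K(2)[OF xi2] z1 by (intro mult_left_mono) auto
        finally have 1: "z1 * (real n * \<xi> - K * \<xi>\<^sup>2) \<le> v (x1 + h) - v x1"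
          using vz[of "x1 + h"] vx1 by (simp add: algebra_simps)
        have "\<xi>\<^sup>2 \<le> (3 * norm h / (r * t1))\<^sup>2"
          using xi by (metis abs_ge_zero power2_abs power_mono)
        also have "\<dots> = 9 * ((norm h)\<^sup>2 / (r\<^sup>2 * t1\<^sup>2))" by (simp add: power_divide power_mult_distrib)
        finally have "K * \<xi>\<^sup>2 \<le> K * (9 * ((norm h)\<^sup>2 / (r\<^sup>2 * t1\<^sup>2)))"
          using K(1) by (intro mult_left_mono) auto
        then have 2: "K * \<xi>\<^sup>2 \<le> 9 * K * ((norm h)\<^sup>2 / (r\<^sup>2 * t1\<^sup>2))"
          by (simp only: mult_ac)
        \<comment> \<open>Since t1 <= 1, one power of 1/t1 can be given away so that both quadratic
          contributions share the coefficient \<open>a\<close>.\<close>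
        have "(norm h)\<^sup>2 / (r\<^sup>2 * t1) \<le> (norm h)\<^sup>2 / (r\<^sup>2 * t1\<^sup>2)"
          using t1 r by (intro divide_left_mono mult_left_mono) (auto simp: power2_eq_square)
        then have 3: "real n * ((norm h)\<^sup>2 / (r\<^sup>2 * t1)) \<le> real n * ((norm h)\<^sup>2 / (r\<^sup>2 * t1\<^sup>2))"
          by (intro mult_left_mono) auto
        have "real n * \<xi> = - (2 * real n / (r\<^sup>2 * t1)) * ((x1 - x0) \<bullet> h) - real n * ((norm h)\<^sup>2 / (r\<^sup>2 * t1))"
          by (simp add: \<xi>_def p_def add_divide_distrib diff_divide_distrib distrib_left right_diff_distrib)
        then have "- (2 * real n / (r\<^sup>2 * t1)) * ((x1 - x0) \<bullet> h) - B * ((norm h)\<^sup>2 / (r\<^sup>2 * t1\<^sup>2)) \<le> real n * \<xi> - K * \<xi>\<^sup>2"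
          using 2 3 unfolding B_def distrib_right by linarith
        then have "z1 * (- (2 * real n / (r\<^sup>2 * t1)) * ((x1 - x0) \<bullet> h) - B * ((norm h)\<^sup>2 / (r\<^sup>2 * t1\<^sup>2))) \<le> z1 * (real n * \<xi> - K * \<xi>\<^sup>2)"
          using z1 by (intro mult_left_mono) auto
        moreover have "l \<bullet> h - a * (norm h)\<^sup>2 = z1 * (- (2 * real n / (r\<^sup>2 * t1)) * ((x1 - x0) \<bullet> h) - B * ((norm h)\<^sup>2 / (r\<^sup>2 * t1\<^sup>2)))"
          unfolding l_def a_def inner_scaleR_left right_diff_distrib by (simp add: mult_ac)
        ultimately show ?thesis using 1 by linarith
      qed
      let ?K = "\<lambda>h::'a. frac_kernel s h * outside \<tau> h"
      have a0: "0 \<le> a" using z1 B by (simp add: a_def)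
      have up0: "(LBINT h. (v (x1 + h) - v x1) * frac_kernel s h * outside \<tau> h) \<le> C1 * a * \<tau> powr (2 - 2 * s)"
        by (rule C1(2)[OF v sup[OF x1b] tau(1) a0]) (rule touch)
      have up1: "C1 * a * \<tau> powr (2 - 2 * s) = z1 * (C1 * B * \<theta>\<^sup>2) * \<tau> powr (- 2 * s)"
      proof -
        have "\<tau> powr (2 - 2 * s) = \<tau>\<^sup>2 * \<tau> powr (- 2 * s)"
          using tau powr_add[of \<tau> 2 "- 2 * s"] by simp
        moreover have "a * \<tau>\<^sup>2 = z1 * B * \<theta>\<^sup>2"
          using r t1 by (simp add: a_def \<tau>_def power_mult_distrib)
        ultimately have "C1 * a * \<tau> powr (2 - 2 * s) = C1 * (z1 * B * \<theta>\<^sup>2) * \<tau> powr (- 2 * s)"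
          by (simp only: mult.assoc) (simp only: mult.assoc[symmetric])
        then show ?thesis by (simp only: mult_ac)
      qed
      have "z1 * (C1 * B * \<theta>\<^sup>2) * \<tau> powr (- 2 * s) \<le> z1 * (c0 / 2) * \<tau> powr (- 2 * s)"
        using th2 z1 by (intro mult_right_mono mult_left_mono) auto
      with up0 have up: "(LBINT h. (v (x1 + h) - v x1) * frac_kernel s h * outside \<tau> h)
          \<le> z1 * (c0 / 2) * \<tau> powr (- 2 * s)"
        unfolding up1 by (rule order_trans)
      have iK: "integrable lborel ?K" using s tau by (intro truncated_kernel_integrable) auto
      have iz: "integrable lborel (\<lambda>h. z (x1 + h) * frac_kernel s h * outside \<tau> h)"
        using zt s tau by (intro tail_integrable_kernel) auto
      \<comment> \<open>The excess of \<open>v\<close> over v(x1) is at least z1 - z(x1 + h). The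
        constant part meets the full kernel tail, twice the allowed barrier error, so the mass of
        \<open>z\<close> outside \<tau> must carry the other half.\<close>
      have "z1 * (c0 * \<tau> powr (- 2 * s)) - (LBINT h. z (x1 + h) * frac_kernel s h * outside \<tau> h)
          \<le> z1 * integral\<^sup>L lborel ?K - (LBINT h. z (x1 + h) * frac_kernel s h * outside \<tau> h)"
        using c0(2)[OF tau(1)] z1 by (intro diff_right_mono mult_left_mono) auto
      also have "\<dots> = (LBINT h. z1 * ?K h - z (x1 + h) * frac_kernel s h * outside \<tau> h)"
        by (subst Bochner_Integration.integral_diff) (auto intro: iK iz integrable_mult_right)
      also have "\<dots> \<le> (LBINT h. (v (x1 + h) - v x1) * frac_kernel s h * outside \<tau> h)"
      proof (rule integral_mono)
        show "integrable lborel (\<lambda>h. z1 * ?K h - z (x1 + h) * frac_kernel s h * outside \<tau> h)"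
          by (intro Bochner_Integration.integrable_diff integrable_mult_right iK iz)
        show "integrable lborel (\<lambda>h. (v (x1 + h) - v x1) * frac_kernel s h * outside \<tau> h)"
          using v s tau by (intro truncated_laplacian_integrable) auto
        fix h
        have "z1 - z (x1 + h) \<le> v (x1 + h) - v x1" using vz[of "x1 + h"] vx1 by simp
        then have "(z1 - z (x1 + h)) * ?K h \<le> (v (x1 + h) - v x1) * ?K h"
          by (intro mult_right_mono) auto
        then show "z1 * ?K h - z (x1 + h) * frac_kernel s h * outside \<tau> h
            \<le> (v (x1 + h) - v x1) * frac_kernel s h * outside \<tau> h"
          by (simp only: left_diff_distrib mult.assoc)
      qed
      finally have lo: "z1 * (c0 / 2) * \<tau> powr (- 2 * s) \<le> (LBINT h. z (x1 + h) * frac_kernel s h * outside \<tau> h)"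
        using up by (simp add: algebra_simps)
      \<comment> \<open>For |h| >= \<tau> one has r + |x1 + h - x0| <= 2r + |h| <= (3r/\<tau>)|h|,
        because \<tau> <= r.\<close>
      define A where "A = 3 * r / \<tau>"
      have A: "0 < A" using r tau by (simp add: A_def)
      have iw: "integrable lborel (\<lambda>y. z y * tail_weight s r (y - x0))"
        using zt s r by (intro tail_integrable_weight) auto
      have "(LBINT h. z (x1 + h) * frac_kernel s h * outside \<tau> h)
          \<le> (LBINT h. A powr N * r powr (- 2 * s) * (z (x1 + h) * tail_weight s r (x1 + h - x0)))"
      proof (intro integral_mono iz integrable_mult_right)
        show "integrable lborel (\<lambda>h. z (x1 + h) * tail_weight s r (x1 + h - x0))"
          by (subst integrable_lborel_translate_iff[where f = "\<lambda>y. z y * tail_weight s r (y - x0)"]) (measurable, rule iw)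
        fix h
        show "z (x1 + h) * frac_kernel s h * outside \<tau> h
            \<le> A powr N * r powr (- 2 * s) * (z (x1 + h) * tail_weight s r (x1 + h - x0))"
        proof (cases "\<tau> \<le> norm h")
          case True
          have "r + norm (x1 + h - x0) \<le> r + norm (x1 - x0) + norm h"
            using norm_triangle_ineq[of "x1 - x0" h] by (simp add: algebra_simps)
          also have "\<dots> \<le> 2 * r + norm h"
            using x1b by (simp add: dist_norm norm_minus_commute)
          also have "\<dots> \<le> A * norm h"
          proof -
            have "r * \<tau> \<le> r * norm h" "\<tau> * norm h \<le> r * norm h"
              using True r tau by (auto intro!: mult_left_mono mult_right_mono)
            moreover have "(2 * r + norm h) * \<tau> = 2 * (r * \<tau>) + \<tau> * norm h" by (simp add: algebra_simps)
            ultimately have "(2 * r + norm h) * \<tau> \<le> 3 * r * norm h" by linarith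
            then show ?thesis using tau by (simp add: A_def pos_le_divide_eq)
          qed
          finally have "frac_kernel s h \<le> A powr N / (r + norm (x1 + h - x0)) powr N"
            unfolding N_def n_def using s r by (intro frac_kernel_le) (auto simp: add_pos_nonneg)
          also have "\<dots> = A powr N * r powr (- 2 * s) * tail_weight s r (x1 + h - x0)"
            using r by (simp add: tail_weight_def N_def n_def powr_minus)
          finally have "z (x1 + h) * frac_kernel s h \<le> z (x1 + h) * (A powr N * r powr (- 2 * s) * tail_weight s r (x1 + h - x0))"
            by (intro mult_left_mono z0)
          then show ?thesis using True by (simp add: mult_ac)
        next
          case False
          then show ?thesis by (simp add: z0)
        qed
      qed
      also have "\<dots> = A powr N * r powr (- 2 * s) * Z"
        by (simp add: Z_def integral_lborel_translate[where f = "\<lambda>y. z y * tail_weight s r (y - x0)"])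
      finally have "z1 * (c0 / 2) * \<tau> powr (- 2 * s) \<le> A powr N * r powr (- 2 * s) * Z"
        using lo by simp
      then have "z1 * (c0 / 2) * \<tau> powr (- 2 * s) * \<tau> powr (2 * s) \<le> A powr N * r powr (- 2 * s) * Z * \<tau> powr (2 * s)"
        by (rule mult_right_mono) simp
      moreover have "\<tau> powr (- 2 * s) * \<tau> powr (2 * s) = 1"
        using tau by (simp add: powr_minus)
      \<comment> \<open>The powers of the depth balance here: A^N contributes t1^(-n-2s) and
        \<tau>^(2s) returns t1^(2s). The remaining t1^(-n), moved to the other side, completes the
        maximised product.\<close>
      moreover have "A powr N * r powr (- 2 * s) * \<tau> powr (2 * s) = 3 powr N / (\<theta> * t1) ^ n"
      proof -
        have "A = 3 / (\<theta> * t1)" using r by (simp add: A_def \<tau>_def)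
        then have A': "A powr N = 3 powr N / (\<theta> * t1) powr N" using th t1 by (simp add: powr_divide)
        have Nn: "(\<theta> * t1) powr N = (\<theta> * t1) ^ n * (\<theta> * t1) powr (2 * s)"
          using th t1 by (simp add: N_def powr_add powr_realpow)
        have "\<tau> powr (2 * s) = r powr (2 * s) * (\<theta> * t1) powr (2 * s)"
          using th t1 r by (simp add: \<tau>_def powr_mult mult_ac)
        then have "A powr N * r powr (- 2 * s) * \<tau> powr (2 * s)
            = A powr N * (r powr (- 2 * s) * r powr (2 * s)) * (\<theta> * t1) powr (2 * s)"
          by (simp only: mult.assoc)
        also have "r powr (- 2 * s) * r powr (2 * s) = 1"
          using r by (simp add: powr_minus)
        also have "A powr N * 1 * (\<theta> * t1) powr (2 * s) = 3 powr N / (\<theta> * t1) ^ n"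
          using th t1 unfolding A' Nn by simp
        finally show ?thesis .
      qed
      ultimately have "z1 * (c0 / 2) \<le> 3 powr N / (\<theta> * t1) ^ n * Z"
        by (metis (no_types, lifting) mult.assoc mult.commute mult.right_neutral)
      then have "z1 * t1 ^ n \<le> C2 * Z"
        using c0(1) th t1 by (simp add: C2_def power_mult_distrib field_simps)
      then show ?thesis by (simp add: z1_def t1_def)
    qed
    have xc: "norm (x - x0) < r / 2" using x by (simp add: dist_norm norm_minus_commute)
    have "(norm (x - x0))\<^sup>2 \<le> (r / 2)\<^sup>2" using xc by (intro power_mono) auto
    then have tx: "3 / 4 \<le> t x" using r by (simp add: t_def field_simps power2_eq_square)
    have "z x * (3 / 4) ^ n \<le> z x * t x ^ n"
      using tx z0 by (intro mult_left_mono power_mono) auto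
    also have "\<dots> \<le> C2 * Z"
      using x1(2)[of x] xc r M by (force simp: dist_norm norm_minus_commute)
    finally have "z x \<le> (4 / 3) ^ n * C2 * Z" by (simp add: field_simps)
    then show ?thesis using vz[of x] unfolding Z_def z_def by linarith
  qed
  have "0 < (4 / 3) ^ n * C2" using C2 by simp
  then show ?thesis using main by (rule that)
qed

text \<open>The same touching argument with a paraboloid: mass away from \<open>x\<^sub>0\<close> pushes \<open>v\<close> above its minimum,
  by an amount that does not depend on \<open>v\<close>.\<close>

lemma positive_lower_bound:
  fixes s r J :: real and x0 :: "'a::euclidean_space"
  assumes s: "0 < s" "s < 1" and r: "0 < r" and J: "0 < J"
  obtains \<kappa> where "0 < \<kappa>"
    "\<And>v m x. \<lbrakk>tail_integrable s v; continuous_on (cball x0 r) v;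
        \<And>x. x \<in> ball x0 r \<Longrightarrow> pv_superharmonic_at s v x; \<And>y. m \<le> v y;
        J \<le> (LBINT y. (v y - m) * tail_weight s r (y - x0) * indicator {y. 2 * r \<le> norm (y - x0)} y);
        x \<in> ball x0 (r / 2)\<rbrakk> \<Longrightarrow> m + \<kappa> \<le> v x"
proof -
  define N where "N = real DIM('a) + 2 * s"
  obtain C1 where C1: "0 < C1"
    "\<And>v (x::'a) \<tau> a l. \<lbrakk>tail_integrable s v; pv_superharmonic_at s v x; 0 < \<tau>; 0 \<le> a;
        \<And>h. norm h < \<tau> \<Longrightarrow> l \<bullet> h - a * (norm h)\<^sup>2 \<le> v (x + h) - v x\<rbrakk> \<Longrightarrow>
      (LBINT h. (v (x + h) - v x) * frac_kernel s h * outside \<tau> h)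
        \<le> C1 * a * \<tau> powr (2 - 2 * s)"
    by (rule touching_from_below[OF s, where 'a = 'a]) blast
  let ?K = "\<lambda>h::'a. frac_kernel s h * outside r h"
  define P where "P = integral\<^sup>L lborel ?K"
  have P: "0 \<le> P" unfolding P_def by (intro integral_nonneg_AE AE_I2) simp
  have iK: "integrable lborel ?K" using s r by (intro truncated_kernel_integrable) auto
  \<comment> \<open>\<open>D\<close> collects, per unit of \<kappa>, what opposes the gain: the
    quadratic error of the paraboloid, and the kernel tail against which v(x1) - m <= \<kappa> is
    charged. The factor 2 in \<open>\<kappa>\<close> makes the final contradiction strict.\<close>
  define D where "D = C1 * r powr (- 2 * s) + P"
  have D: "0 < D" using C1(1) r P by (simp add: D_def add_pos_nonneg)
  define \<kappa> where "\<kappa> = r powr (- 2 * s) * J / (2 * D)"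
  have k: "0 < \<kappa>" using r J D by (simp add: \<kappa>_def)
  have kD: "\<kappa> * D < r powr (- 2 * s) * J" using r J D by (simp add: \<kappa>_def)
  have main: "m + 3 / 4 * \<kappa> \<le> v x"
    if v: "tail_integrable s v" and cont: "continuous_on (cball x0 r) v"
      and sup: "\<And>x. x \<in> ball x0 r \<Longrightarrow> pv_superharmonic_at s v x" and vm: "\<And>y. m \<le> v y"
      and vJ: "J \<le> (LBINT y. (v y - m) * tail_weight s r (y - x0) * indicator {y. 2 * r \<le> norm (y - x0)} y)"
      and x: "x \<in> ball x0 (r / 2)" for v m x
  proof -
    have [measurable]: "v \<in> borel_measurable borel" using v by measurable
    define q where "q y = \<kappa> * (1 - (norm (y - x0))\<^sup>2 / r\<^sup>2)" for y
    have "continuous_on (cball x0 r) (\<lambda>y. v y - q y)"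
      unfolding q_def by (intro continuous_intros cont) (use r in auto)
    then have "\<exists>x\<in>cball x0 r. \<forall>y\<in>cball x0 r. v x - q x \<le> v y - q y"
      using r by (intro continuous_attains_inf) auto
    then obtain x1 where x1: "x1 \<in> cball x0 r" "\<And>y. y \<in> cball x0 r \<Longrightarrow> v x1 - q x1 \<le> v y - q y"
      by blast
    have q_le: "q y \<le> \<kappa>" for y using k by (simp add: q_def mult_le_cancel_left1)
    have q_out: "q y \<le> 0" if "y \<notin> ball x0 r" for y
    proof -
      have "r\<^sup>2 \<le> (norm (y - x0))\<^sup>2" using that r by (intro power_mono) (auto simp: dist_norm norm_minus_commute)
      then show ?thesis using r k by (simp add: q_def mult_le_0_iff)
    qed
    have "m \<le> v x1 - q x1"
    proof (rule ccontr)
      assume neg: "\<not> m \<le> v x1 - q x1"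
      then have x1b: "x1 \<in> ball x0 r" using q_out[of x1] vm[of x1] by force
      \<comment> \<open>The barrier touches globally: outside the ball it is nonpositive while
        \<open>v\<close> stays above m, and the minimum of v - q is assumed below m. Hence radius r
        may be used for touching even when \<open>x1\<close> is close to the boundary.\<close>
      have ge: "q y - q x1 \<le> v y - v x1" for y
        using x1(2)[of y] q_out[of y] vm[of y] neg by (cases "y \<in> cball x0 r") auto
      define l where "l = (- 2 * \<kappa> / r\<^sup>2) *\<^sub>R (x1 - x0)"
      have touch: "l \<bullet> h - \<kappa> / r\<^sup>2 * (norm h)\<^sup>2 \<le> v (x1 + h) - v x1" for h
      proof -
        have "(norm (x1 + h - x0))\<^sup>2 = (norm (x1 - x0))\<^sup>2 + 2 * ((x1 - x0) \<bullet> h) + (norm h)\<^sup>2"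
          unfolding power2_norm_eq_inner by (simp add: inner_diff inner_add inner_commute algebra_simps)
        moreover have "l \<bullet> h = (- 2 * \<kappa> / r\<^sup>2) * ((x1 - x0) \<bullet> h)"
          unfolding l_def by (rule inner_scaleR_left)
        ultimately have "q (x1 + h) - q x1 = l \<bullet> h - \<kappa> / r\<^sup>2 * (norm h)\<^sup>2"
          by (simp only: q_def add_divide_distrib) (simp add: right_diff_distrib distrib_left)
        then show ?thesis using ge[of "x1 + h"] by simp
      qed
      have "0 \<le> \<kappa> / r\<^sup>2" using k by simp
      from C1(2)[OF v sup[OF x1b] r this touch]
      have up: "(LBINT h. (v (x1 + h) - v x1) * frac_kernel s h * outside r h)
          \<le> \<kappa> * (C1 * r powr (- 2 * s))"
        using r by (simp add: powr_diff powr_minus field_simps)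
      let ?F = "\<lambda>y. (v y - m) * tail_weight s r (y - x0) * indicator {y. 2 * r \<le> norm (y - x0)} y"
      have iF: "integrable lborel ?F"
      proof -
        have "integrable lborel (\<lambda>y. (v y - m) * tail_weight s r (y - x0))"
          using v s r by (intro tail_integrable_weight tail_integrable_diff tail_integrable_const) auto
        then show ?thesis by (intro integrable_real_mult_indicator) measurable
      qed
      have "r powr (- 2 * s) * J - \<kappa> * P \<le> r powr (- 2 * s) * integral\<^sup>L lborel ?F - \<kappa> * P"
        using vJ by (intro diff_right_mono mult_left_mono) auto
      also have "\<dots> = (LBINT h. r powr (- 2 * s) * ?F (x1 + h) - \<kappa> * ?K h)"
      proof (subst Bochner_Integration.integral_diff)
        show 1: "integrable lborel (\<lambda>h. r powr (- 2 * s) * ?F (x1 + h))"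
          by (intro integrable_mult_right, subst integrable_lborel_translate_iff[where f = ?F]) (measurable, rule iF)
        show "integrable lborel (\<lambda>h. \<kappa> * ?K h)" by (intro integrable_mult_right iK)
        have "(LBINT h. ?F (x1 + h)) = integral\<^sup>L lborel ?F"
          by (rule integral_lborel_translate) measurable
        then show "r powr (- 2 * s) * integral\<^sup>L lborel ?F - \<kappa> * P
            = (LBINT h. r powr (- 2 * s) * ?F (x1 + h)) - (LBINT h. \<kappa> * ?K h)"
          unfolding integral_mult_right_zero P_def by simp
      qed
      also have "\<dots> \<le> (LBINT h. (v (x1 + h) - v x1) * frac_kernel s h * outside r h)"
      proof (rule integral_mono)
        show "integrable lborel (\<lambda>h. r powr (- 2 * s) * ?F (x1 + h) - \<kappa> * ?K h)"
        proof (intro Bochner_Integration.integrable_diff integrable_mult_right iK)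
          show "integrable lborel (\<lambda>h. ?F (x1 + h))"
            by (subst integrable_lborel_translate_iff[where f = ?F]) (measurable, rule iF)
        qed
        show "integrable lborel (\<lambda>h. (v (x1 + h) - v x1) * frac_kernel s h * outside r h)"
          using v s r by (intro truncated_laplacian_integrable) auto
        fix h
        \<comment> \<open>Up to \<kappa> times the kernel, the excess over v(x1) is the excess over
          m. The latter is nonnegative, so it may be cut down to the region outside 2r.\<close>
        have vx1: "v x1 \<le> m + \<kappa>" using neg q_le[of x1] by linarith
        have vh: "0 \<le> v (x1 + h) - m" using vm[of "x1 + h"] by simp
        have "r powr (- 2 * s) * ?F (x1 + h) \<le> (v (x1 + h) - m) * ?K h"
        proof (cases "2 * r \<le> norm (x1 + h - x0)")
          case True
          have tri: "norm (x1 + h - x0) \<le> norm h + norm (x1 - x0)" "norm h \<le> norm (x1 + h - x0) + norm (x1 - x0)"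
            using norm_triangle_ineq[of h "x1 - x0"] norm_triangle_ineq4[of "x1 + h - x0" "x1 - x0"]
            by (simp_all add: algebra_simps)
          have nx: "norm (x1 - x0) < r" using x1b by (simp add: dist_norm norm_minus_commute)
          \<comment> \<open>This is the reason for the radius 2r: \<open>x1\<close> is within r of
            \<open>x0\<close>, so points outside 2r are at least r away from \<open>x1\<close>,
            where the truncation does not remove them.\<close>
          have h: "r \<le> norm h" using tri True nx by linarith
          have "norm h powr N \<le> (r + norm (x1 + h - x0)) powr N"
            using tri nx s by (intro powr_mono2) (auto simp: N_def)
          then have "1 / (r + norm (x1 + h - x0)) powr N \<le> frac_kernel s h"
            unfolding frac_kernel_def N_def[symmetric] using h r
            by (intro divide_left_mono mult_pos_pos) (auto simp: add_pos_nonneg)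
          moreover have "r powr (- 2 * s) * tail_weight s r (x1 + h - x0) = 1 / (r + norm (x1 + h - x0)) powr N"
            using r by (simp add: tail_weight_def N_def powr_minus)
          ultimately have "(v (x1 + h) - m) * (r powr (- 2 * s) * tail_weight s r (x1 + h - x0)) \<le> (v (x1 + h) - m) * frac_kernel s h"
            using vh by (intro mult_left_mono) auto
          then show ?thesis using True h by (simp add: mult_ac)
        next
          case False
          then show ?thesis using vh by simp
        qed
        moreover have "(v (x1 + h) - m) * ?K h - \<kappa> * ?K h \<le> (v (x1 + h) - v x1) * ?K h"
          using vx1 mult_right_mono[of "v (x1 + h) - m - \<kappa>" "v (x1 + h) - v x1" "?K h"]
          by (simp only: left_diff_distrib[symmetric]) simp
        ultimately have "r powr (- 2 * s) * ?F (x1 + h) - \<kappa> * ?K h \<le> (v (x1 + h) - v x1) * ?K h"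
          by linarith
        then show "r powr (- 2 * s) * ?F (x1 + h) - \<kappa> * ?K h
            \<le> (v (x1 + h) - v x1) * frac_kernel s h * outside r h"
          by (simp only: mult.assoc)
      qed
      finally have "r powr (- 2 * s) * J - \<kappa> * P \<le> \<kappa> * (C1 * r powr (- 2 * s))"
        using up by linarith
      then show False using kD by (simp add: D_def distrib_left)
    qed
    moreover have xc: "norm (x - x0) < r / 2" using x by (simp add: dist_norm norm_minus_commute)
    moreover have "3 / 4 * \<kappa> \<le> q x"
    proof -
      have "(norm (x - x0))\<^sup>2 \<le> (r / 2)\<^sup>2" using xc by (intro power_mono) auto
      then have "3 / 4 \<le> 1 - (norm (x - x0))\<^sup>2 / r\<^sup>2" using r by (simp add: field_simps power2_eq_square)
      then have "3 / 4 * \<kappa> \<le> (1 - (norm (x - x0))\<^sup>2 / r\<^sup>2) * \<kappa>" using k by (intro mult_right_mono) auto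
      then show ?thesis by (simp add: q_def mult.commute)
    qed
    ultimately show ?thesis using x1(2)[of x] r by (force simp: dist_norm norm_minus_commute)
  qed
  have "0 < 3 / 4 * \<kappa>" using k by simp
  then show ?thesis using main by (rule that)
qed

section \<open>Smooth mollifiers\<close>

text \<open>Dividing exp(-1/t) by powers of t gives a family in which each derivative is a
  combination of two other members; j = 0 is the classical flat function.\<close>

definition bump_exp :: "nat \<Rightarrow> real \<Rightarrow> real" where
  "bump_exp j t = (if t \<le> 0 then 0 else exp (- 1 / t) / t ^ j)"

lemma power_le_fact_mult_exp:
  fixes x :: real assumes "0 \<le> x"
  shows "x ^ n \<le> fact n * exp x"
proof -
  have "(\<Sum>k\<in>{n}. inverse (fact k) *\<^sub>R x ^ k) \<le> (\<Sum>k. inverse (fact k) *\<^sub>R x ^ k)"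
    by (rule sum_le_suminf) (use assms summable_exp_generic[of x] in auto)
  then have "inverse (fact n) * x ^ n \<le> exp x" by (simp add: exp_def)
  then show ?thesis by (simp add: field_simps)
qed

lemma bump_exp_nonneg: "0 \<le> bump_exp j t"
  by (simp add: bump_exp_def)

lemma bump_exp_le: "bump_exp j t \<le> fact j"
proof (cases "t \<le> 0")
  case False
  have "(1 / t) ^ j \<le> fact j * exp (1 / t)" using False by (intro power_le_fact_mult_exp) auto
  then show ?thesis using False by (simp add: bump_exp_def exp_minus field_simps)
qed (simp add: bump_exp_def)

text \<open>Only t = 0 is delicate. There the difference quotient of index j is the function of
  index j + 1, which is at most (j+2)! |h| by the uniform bound for index j + 2.\<close>

lemma bump_exp_has_derivative:
  "(bump_exp j has_real_derivative (bump_exp (j + 2) t - real j * bump_exp (j + 1) t)) (at t)"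
proof -
  consider "t < 0" | "t = 0" | "0 < t" by linarith
  then show ?thesis
  proof cases
    case 1
    have "\<forall>\<^sub>F x in nhds t. bump_exp j x = 0"
      using eventually_nhds_in_open[of "{..<0}" t] 1 by (auto elim!: eventually_mono simp: bump_exp_def)
    then have "(bump_exp j has_real_derivative 0) (at t)"
      by (subst DERIV_cong_ev[OF refl _ refl]) auto
    then show ?thesis using 1 by (simp add: bump_exp_def)
  next
    case 2
    have lim: "(bump_exp (Suc j) \<longlongrightarrow> 0) (at 0)"
    proof (rule Lim_null_comparison)
      show "\<forall>\<^sub>F h in at 0. norm (bump_exp (Suc j) h) \<le> fact (j + 2) * \<bar>h\<bar>"
      proof (rule always_eventually, rule allI)
        fix h :: real
        show "norm (bump_exp (Suc j) h) \<le> fact (j + 2) * \<bar>h\<bar>"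
        proof (cases "h \<le> 0")
          case True
          have "0 \<le> fact (j + 2) * \<bar>h\<bar>" by (intro mult_nonneg_nonneg) auto
          moreover have "bump_exp (Suc j) h = 0" using True by (simp add: bump_exp_def)
          ultimately show ?thesis by (simp only: norm_zero)
        next
          case False
          have "bump_exp (Suc j) h = bump_exp (j + 2) h * h"
            using False by (simp add: bump_exp_def)
          also have "\<dots> \<le> fact (j + 2) * h"
            using False by (intro mult_right_mono bump_exp_le) auto
          finally show ?thesis using False bump_exp_nonneg[of "Suc j" h] by simp
        qed
      qed
      show "((\<lambda>h. fact (j + 2) * \<bar>h\<bar>) \<longlongrightarrow> 0) (at (0::real))"
        by (auto intro!: tendsto_eq_intros)
    qed
    have "((\<lambda>h. (bump_exp j (0 + h) - bump_exp j 0) / h) \<longlongrightarrow> 0) (at 0)"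
    proof (rule Lim_transform_eventually[OF lim])
      show "\<forall>\<^sub>F h in at 0. bump_exp (Suc j) h = (bump_exp j (0 + h) - bump_exp j 0) / h"
        by (auto simp: eventually_at_filter bump_exp_def)
    qed
    then have "(bump_exp j has_real_derivative 0) (at 0)"
      by (simp add: DERIV_def)
    then show ?thesis using 2 by (simp add: bump_exp_def)
  next
    case 3
    have "((\<lambda>t. exp (- 1 / t) / t ^ j) has_real_derivative (bump_exp (j + 2) t - real j * bump_exp (j + 1) t)) (at t)"
      using 3 by (auto intro!: derivative_eq_intros simp: bump_exp_def field_simps power2_eq_square) (cases j, auto)
    moreover have "\<forall>\<^sub>F x in nhds t. bump_exp j x = exp (- 1 / x) / x ^ j"
      using eventually_nhds_in_open[of "{0<..}" t] 3 by (auto elim!: eventually_mono simp: bump_exp_def)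
    ultimately show ?thesis by (subst DERIV_cong_ev[OF refl _ refl]) auto
  qed
qed

text \<open>A class generated so that directional derivatives stay inside it; membership then gives
  all orders of differentiability at once. Constants and inner products enter through the chain rule
  for |x - a|^2.\<close>

inductive bump_algebra :: "'a::euclidean_space \<Rightarrow> real \<Rightarrow> ('a \<Rightarrow> real) \<Rightarrow> bool" for a r where
  const: "bump_algebra a r (\<lambda>x. c)"
| inner: "bump_algebra a r (\<lambda>x. x \<bullet> v)"
| add: "bump_algebra a r f \<Longrightarrow> bump_algebra a r g \<Longrightarrow> bump_algebra a r (\<lambda>x. f x + g x)"
| mult: "bump_algebra a r f \<Longrightarrow> bump_algebra a r g \<Longrightarrow> bump_algebra a r (\<lambda>x. f x * g x)"
| bump: "bump_algebra a r (\<lambda>x. bump_exp j (1 - (norm (x - a))\<^sup>2 / r\<^sup>2))"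

lemma bump_algebra_derivative:
  assumes "bump_algebra a r f"
  shows "\<exists>f'. (\<forall>x. (f has_derivative f' x) (at x)) \<and> (\<forall>v. bump_algebra a r (\<lambda>x. f' x v))"
  using assms
proof induction
  case (const c)
  show ?case by (intro exI[of _ "\<lambda>x v. 0"]) (auto intro: bump_algebra.const)
next
  case (inner v)
  show ?case
    by (intro exI[of _ "\<lambda>x w. w \<bullet> v"]) (auto intro!: bump_algebra.const derivative_eq_intros)
next
  case (add f g)
  then obtain f' g' where
    "\<And>x. (f has_derivative f' x) (at x)" "\<And>v. bump_algebra a r (\<lambda>x. f' x v)"
    "\<And>x. (g has_derivative g' x) (at x)" "\<And>v. bump_algebra a r (\<lambda>x. g' x v)" by blast
  then show ?case
    by (intro exI[of _ "\<lambda>x v. f' x v + g' x v"]) (auto intro!: bump_algebra.add has_derivative_add)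
next
  case (mult f g)
  then obtain f' g' where
    "\<And>x. (f has_derivative f' x) (at x)" "\<And>v. bump_algebra a r (\<lambda>x. f' x v)"
    "\<And>x. (g has_derivative g' x) (at x)" "\<And>v. bump_algebra a r (\<lambda>x. g' x v)" by blast
  then show ?case using mult.hyps
    by (intro exI[of _ "\<lambda>x v. f x * g' x v + f' x v * g x"])
      (auto intro!: bump_algebra.add bump_algebra.mult has_derivative_mult)
next
  case (bump j)
  let ?q = "\<lambda>x. 1 - (norm (x - a))\<^sup>2 / r\<^sup>2"
  let ?D = "\<lambda>x. bump_exp (j + 2) (?q x) + - real j * bump_exp (j + 1) (?q x)"
  let ?f' = "\<lambda>x v. ?D x * ((x \<bullet> v + - (a \<bullet> v)) * (- 2 / r\<^sup>2))"
  have "((\<lambda>x. bump_exp j (?q x)) has_derivative ?f' x) (at x)" for x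
  proof -
    have "((\<lambda>x. (x - a) \<bullet> (x - a)) has_derivative (\<lambda>v. (x - a) \<bullet> v + v \<bullet> (x - a))) (at x)"
      by (auto intro!: derivative_eq_intros)
    then have "((\<lambda>x. 1 + (- 1 / r\<^sup>2) * ((x - a) \<bullet> (x - a))) has_derivative
        (\<lambda>v. 0 + (- 1 / r\<^sup>2) * ((x - a) \<bullet> v + v \<bullet> (x - a)))) (at x)"
      by (intro has_derivative_add has_derivative_const has_derivative_mult_right)
    moreover have "?q = (\<lambda>x. 1 + (- 1 / r\<^sup>2) * ((x - a) \<bullet> (x - a)))"
      by (simp add: power2_norm_eq_inner)
    moreover have "(\<lambda>v. 0 + (- 1 / r\<^sup>2) * ((x - a) \<bullet> v + v \<bullet> (x - a)))
        = (\<lambda>v. (x \<bullet> v + - (a \<bullet> v)) * (- 2 / r\<^sup>2))"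
      by (simp add: fun_eq_iff inner_diff inner_commute diff_divide_distrib left_diff_distrib mult.commute)
    ultimately have 1: "(?q has_derivative (\<lambda>v. (x \<bullet> v + - (a \<bullet> v)) * (- 2 / r\<^sup>2))) (at x)" by simp
    have 2: "(bump_exp j has_derivative (\<lambda>h. ?D x * h)) (at (?q x))"
      using bump_exp_has_derivative[of j "?q x"] by (simp add: has_field_derivative_def)
    show ?thesis using diff_chain_at[OF 1 2] by (simp add: o_def)
  qed
  moreover have "bump_algebra a r (\<lambda>x. ?f' x v)" for v
    by (intro bump_algebra.intros)
  ultimately show ?case by (intro exI[of _ ?f'] conjI allI)
qed

text \<open>The recursion of \<open>C_k\<close> asks for directional derivatives of one order less,
  which is exactly what closure of the class under differentiation supplies.\<close>

lemma bump_algebra_C_k: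
  fixes f :: "real ^ 'n \<Rightarrow> real"
  assumes "bump_algebra a r f"
  shows "C_k k f"
  using assms
proof (induction k arbitrary: f)
  case 0
  then obtain f' where "\<And>x. (f has_derivative f' x) (at x)"
    using bump_algebra_derivative by blast
  then show ?case
    by (auto intro!: continuous_at_imp_continuous_on has_derivative_continuous)
next
  case (Suc k)
  from bump_algebra_derivative[OF Suc.prems] obtain f' where
    f': "\<And>x. (f has_derivative f' x) (at x)" "\<And>v. bump_algebra a r (\<lambda>x. f' x v)" by blast
  have "frechet_derivative f (at x) = f' x" for x
    using frechet_derivative_at[OF f'(1)] by simp
  then show ?case using f' Suc.IH by (auto intro: differentiableI)
qed

section \<open>Normalised bumps\<close>

lemma bump_exp_continuous: "continuous_on S (bump_exp j)"
  using bump_exp_has_derivative by (meson DERIV_isCont continuous_at_imp_continuous_on)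

lemma bump_exp_measurable [measurable]: "bump_exp j \<in> borel_measurable borel"
  using bump_exp_continuous by (rule borel_measurable_continuous_onI)

text \<open>The derivative is the member of index 2, bounded by 2! = 2.\<close>

lemma bump_exp_0_lipschitz: "\<bar>bump_exp 0 t - bump_exp 0 t'\<bar> \<le> 2 * \<bar>t - t'\<bar>"
proof -
  have "norm (bump_exp 0 t - bump_exp 0 t') \<le> 2 * norm (t - t')"
  proof (rule field_differentiable_bound[of UNIV])
    fix t :: real
    show "(bump_exp 0 has_field_derivative bump_exp 2 t) (at t within UNIV)"
      using bump_exp_has_derivative[of 0 t] by (simp add: numeral_2_eq_2)
    show "norm (bump_exp 2 t) \<le> 2"
      using bump_exp_le[of 2 t] bump_exp_nonneg[of 2 t] by (simp add: fact_numeral)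
  qed auto
  then show ?thesis by simp
qed

text \<open>The \<open>itself\<close> argument fixes the space, hence the dimension, which
  \<epsilon> alone does not determine.\<close>

definition bump_mass :: "'a::euclidean_space itself \<Rightarrow> real \<Rightarrow> real" where
  "bump_mass _ \<epsilon> = (LBINT y. bump_exp 0 (1 - (norm (y::'a))\<^sup>2 / \<epsilon>\<^sup>2))"

definition mollifier :: "real \<Rightarrow> 'a::euclidean_space \<Rightarrow> real" where
  "mollifier \<epsilon> y = bump_exp 0 (1 - (norm y)\<^sup>2 / \<epsilon>\<^sup>2) / bump_mass TYPE('a) \<epsilon>"

lemma bump_exp_0_support:
  assumes "0 < \<epsilon>" "bump_exp 0 (1 - (norm y)\<^sup>2 / \<epsilon>\<^sup>2) \<noteq> 0"
  shows "norm y < \<epsilon>"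
proof -
  have "(norm y)\<^sup>2 / \<epsilon>\<^sup>2 < 1" using assms(2) by (auto simp: bump_exp_def split: if_splits)
  then have "(norm y)\<^sup>2 < \<epsilon>\<^sup>2" using assms(1) by (simp add: field_simps)
  then show ?thesis using assms(1) by (simp add: power_less_imp_less_base)
qed

lemma bump_integrable:
  assumes "0 < \<epsilon>"
  shows "integrable lborel (\<lambda>y::'a::euclidean_space. bump_exp 0 (1 - (norm y)\<^sup>2 / \<epsilon>\<^sup>2))"
proof (rule Bochner_Integration.integrable_bound)
  show "integrable lborel (indicator (cball 0 \<epsilon>) :: 'a \<Rightarrow> real)"
    using emeasure_lborel_cball_finite[of "0::'a" \<epsilon>] by (intro integrable_real_indicator) auto
  have "norm (bump_exp 0 (1 - (norm y)\<^sup>2 / \<epsilon>\<^sup>2)) \<le> norm (indicator (cball 0 \<epsilon>) y :: real)" for y :: 'a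
    using bump_exp_0_support[OF assms, of y] bump_exp_le[of 0 "1 - (norm y)\<^sup>2 / \<epsilon>\<^sup>2"] bump_exp_nonneg[of 0 "1 - (norm y)\<^sup>2 / \<epsilon>\<^sup>2"]
    by (cases "bump_exp 0 (1 - (norm y)\<^sup>2 / \<epsilon>\<^sup>2) = 0") auto
  then show "AE y::'a in lborel. norm (bump_exp 0 (1 - (norm y)\<^sup>2 / \<epsilon>\<^sup>2)) \<le> norm (indicator (cball 0 \<epsilon>) y :: real)"
    by (intro AE_I2)
qed measurable

text \<open>On the ball of radius \<epsilon>/2 the argument of the bump is at least 3/4, so the bump
  is at least exp(-4/3). This bounds the mollifier by a multiple of \<epsilon>^(-n), uniformly in
  \<epsilon>.\<close>

lemma bump_mass_lower_bound:
  assumes e: "0 < \<epsilon>"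
  shows "exp (- 4 / 3) * (unit_ball_vol DIM('a) * (\<epsilon> / 2) ^ DIM('a)) \<le> bump_mass TYPE('a::euclidean_space) \<epsilon>"
proof -
  have fin: "integrable lborel (indicator (cball 0 (\<epsilon> / 2)) :: 'a \<Rightarrow> real)"
    using emeasure_lborel_cball_finite[of "0::'a" "\<epsilon> / 2"] by (intro integrable_real_indicator) auto
  have "exp (- 4 / 3) * (unit_ball_vol DIM('a) * (\<epsilon> / 2) ^ DIM('a))
      = (LBINT y. exp (- 4 / 3) * indicator (cball (0::'a) (\<epsilon> / 2)) y)"
    using e by (simp add: content_cball)
  also have "\<dots> \<le> bump_mass TYPE('a) \<epsilon>"
    unfolding bump_mass_def
  proof (rule integral_mono)
    show "integrable lborel (\<lambda>y::'a. exp (- 4 / 3 :: real) * indicator (cball (0::'a) (\<epsilon> / 2)) y)"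
      using fin by (intro integrable_mult_right)
    show "integrable lborel (\<lambda>y::'a. bump_exp 0 (1 - (norm y)\<^sup>2 / \<epsilon>\<^sup>2))" by (rule bump_integrable[OF e])
    fix y :: 'a
    show "exp (- 4 / 3) * indicator (cball 0 (\<epsilon> / 2)) y \<le> bump_exp 0 (1 - (norm y)\<^sup>2 / \<epsilon>\<^sup>2)"
    proof (cases "y \<in> cball 0 (\<epsilon> / 2)")
      case True
      then have "(norm y)\<^sup>2 \<le> (\<epsilon> / 2)\<^sup>2" by (intro power_mono) auto
      then have q: "3 / 4 \<le> 1 - (norm y)\<^sup>2 / \<epsilon>\<^sup>2" using e by (simp add: field_simps power2_eq_square)
      then have "1 / (1 - (norm y)\<^sup>2 / \<epsilon>\<^sup>2) \<le> 1 / (3 / 4)" by (intro divide_left_mono) auto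
      then have "exp (- 4 / 3) \<le> exp (- 1 / (1 - (norm y)\<^sup>2 / \<epsilon>\<^sup>2))" by simp
      moreover have "bump_exp 0 (1 - (norm y)\<^sup>2 / \<epsilon>\<^sup>2) = exp (- 1 / (1 - (norm y)\<^sup>2 / \<epsilon>\<^sup>2))"
        unfolding bump_exp_def using q by (subst if_not_P) (linarith, simp)
      ultimately show ?thesis using True by simp
    next
      case False
      then show ?thesis by (simp add: bump_exp_nonneg)
    qed
  qed
  finally show ?thesis .
qed

lemma bump_mass_pos: "0 < \<epsilon> \<Longrightarrow> 0 < bump_mass TYPE('a::euclidean_space) \<epsilon>"
  using bump_mass_lower_bound[of \<epsilon>, where 'a = 'a]
  by (rule less_le_trans[rotated]) (auto intro!: mult_pos_pos)

lemma mollifier_nonneg: "0 < \<epsilon> \<Longrightarrow> 0 \<le> mollifier \<epsilon> y"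
  by (simp add: mollifier_def bump_exp_nonneg bump_mass_pos less_imp_le)

lemma mollifier_minus [simp]: "mollifier \<epsilon> (- y) = mollifier \<epsilon> y"
  by (simp add: mollifier_def)

lemma mollifier_support: "0 < \<epsilon> \<Longrightarrow> mollifier \<epsilon> y \<noteq> 0 \<Longrightarrow> norm y < \<epsilon>"
  using bump_exp_0_support by (auto simp: mollifier_def)

lemma mollifier_continuous: "continuous_on S (mollifier \<epsilon>)"
  unfolding mollifier_def divide_inverse
  by (intro continuous_intros continuous_on_compose2[OF bump_exp_continuous[of UNIV]]) auto

lemma mollifier_measurable [measurable]: "mollifier \<epsilon> \<in> borel_measurable borel"
  by (intro borel_measurable_continuous_onI mollifier_continuous)

lemma mollifier_integrable: "0 < \<epsilon> \<Longrightarrow> integrable lborel (mollifier \<epsilon>)"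
  unfolding mollifier_def by (intro integrable_divide bump_integrable)

lemma mollifier_integral:
  assumes "0 < \<epsilon>" shows "(LBINT y. mollifier \<epsilon> (y::'a::euclidean_space)) = 1"
proof -
  have "(LBINT y. mollifier \<epsilon> (y::'a)) = bump_mass TYPE('a) \<epsilon> / bump_mass TYPE('a) \<epsilon>"
    unfolding mollifier_def by (simp add: bump_mass_def)
  then show ?thesis using bump_mass_pos[OF assms, where 'a = 'a] by simp
qed

text \<open>The squared norm is Lipschitz only on bounded sets, hence the restriction to radius
  2\<epsilon>. That radius covers the support together with a collar of width \<epsilon>, which is
  where the pairing needs the estimate.\<close>

lemma mollifier_lipschitz:
  fixes x :: "'a::euclidean_space"
  assumes e: "0 < \<epsilon>"
  obtains L where "0 < L" "\<And>y z. norm y < 2 * \<epsilon> \<Longrightarrow> norm z < 2 * \<epsilon> \<Longrightarrow> \<bar>mollifier \<epsilon> (y::'a) - mollifier \<epsilon> z\<bar> \<le> L * norm (y - z)"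
proof -
  let ?m = "bump_mass TYPE('a) \<epsilon>"
  define L where "L = 8 / \<epsilon> / ?m"
  have m: "0 < ?m" using e by (rule bump_mass_pos)
  have "\<bar>mollifier \<epsilon> (y::'a) - mollifier \<epsilon> z\<bar> \<le> L * norm (y - z)" if y: "norm y < 2 * \<epsilon>" "norm z < 2 * \<epsilon>" for y z
  proof -
    have "\<bar>mollifier \<epsilon> y - mollifier \<epsilon> z\<bar> = \<bar>bump_exp 0 (1 - (norm y)\<^sup>2 / \<epsilon>\<^sup>2) - bump_exp 0 (1 - (norm z)\<^sup>2 / \<epsilon>\<^sup>2)\<bar> / ?m"
      using m by (simp add: mollifier_def diff_divide_distrib[symmetric])
    also have "\<dots> \<le> 2 * \<bar>(1 - (norm y)\<^sup>2 / \<epsilon>\<^sup>2) - (1 - (norm z)\<^sup>2 / \<epsilon>\<^sup>2)\<bar> / ?m"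
      using m by (intro divide_right_mono bump_exp_0_lipschitz) auto
    also have "(1 - (norm y)\<^sup>2 / \<epsilon>\<^sup>2) - (1 - (norm z)\<^sup>2 / \<epsilon>\<^sup>2) = (norm z - norm y) * (norm z + norm y) / \<epsilon>\<^sup>2"
      by (simp add: diff_divide_distrib power2_eq_square algebra_simps)
    also have "2 * \<bar>(norm z - norm y) * (norm z + norm y) / \<epsilon>\<^sup>2\<bar> / ?m \<le> 2 * (norm (y - z) * (4 * \<epsilon>) / \<epsilon>\<^sup>2) / ?m"
    proof (intro divide_right_mono mult_left_mono)
      have "\<bar>(norm z - norm y) * (norm z + norm y) / \<epsilon>\<^sup>2\<bar> = \<bar>norm z - norm y\<bar> * (norm z + norm y) / \<epsilon>\<^sup>2"
        by (simp add: abs_mult)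
      also have "\<dots> \<le> norm (y - z) * (4 * \<epsilon>) / \<epsilon>\<^sup>2"
        using y norm_triangle_ineq3[of z y] by (intro divide_right_mono mult_mono) (auto simp: norm_minus_commute)
      finally show "\<bar>(norm z - norm y) * (norm z + norm y) / \<epsilon>\<^sup>2\<bar> \<le> norm (y - z) * (4 * \<epsilon>) / \<epsilon>\<^sup>2" .
    qed (use m in auto)
    also have "\<dots> = L * norm (y - z)" using e by (simp add: L_def power2_eq_square)
    finally show ?thesis .
  qed
  moreover have "0 < L" using m e by (simp add: L_def)
  ultimately show ?thesis using that by blast
qed

lemma mollifier_test_function:
  fixes x :: "real ^ 'n"
  assumes e: "0 < \<epsilon>" and sub: "cball x \<epsilon> \<subseteq> \<Omega>"
  shows "(\<lambda>y. mollifier \<epsilon> (y - x)) \<in> test_functions \<Omega>"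
proof -
  have "bump_algebra x \<epsilon> (\<lambda>y. mollifier \<epsilon> (y - x))"
    unfolding mollifier_def divide_inverse[of "bump_exp _ _"] by (intro bump_algebra.intros)
  then have "C_k k (\<lambda>y. mollifier \<epsilon> (y - x))" for k by (rule bump_algebra_C_k)
  moreover have "compactly_contained {y. mollifier \<epsilon> (y - x) \<noteq> 0} \<Omega>"
  proof -
    have "{y. mollifier \<epsilon> (y - x) \<noteq> 0} \<subseteq> cball x \<epsilon>"
      using mollifier_support[OF e] by (force simp: dist_norm norm_minus_commute)
    then have "closure {y. mollifier \<epsilon> (y - x) \<noteq> 0} \<subseteq> cball x \<epsilon>"
      by (rule closure_minimal) simp
    then show ?thesis unfolding compactly_contained_def using sub
      by (meson compact_cball closed_closure compact_closure bounded_cball bounded_subset order_trans closure_subset)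
  qed
  ultimately show ?thesis by (simp add: test_functions_def)
qed

section \<open>Mollification\<close>

lemma tail_weight_minus [simp]: "tail_weight s r (- y) = tail_weight s r y"
  by (simp add: tail_weight_def)

text \<open>A Harnack-type bound: moving by a distance comparable to r changes the weight only by a
  bounded factor, which lets mollification at scale \<epsilon> <= r pass through the weight.\<close>

lemma tail_weight_shift:
  fixes a b :: "'a::euclidean_space"
  assumes "0 < s" "0 < r"
  shows "tail_weight s r a \<le> (1 + norm (a - b) / r) powr (real DIM('a) + 2 * s) * tail_weight s r b"
proof -
  define N where "N = real DIM('a) + 2 * s"
  have "norm b \<le> norm a + norm (a - b)"
    using norm_triangle_ineq4[of a "a - b"] by simp
  then have "r + norm b \<le> r + norm a + norm (a - b)" by simp
  also have "\<dots> \<le> (1 + norm (a - b) / r) * (r + norm a)"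
    using assms by (simp add: field_simps)
  finally have "1 / (r + norm a) powr N \<le> (1 + norm (a - b) / r) powr N / (r + norm b) powr N"
    using assms by (intro inverse_powr_le) (auto simp: N_def intro: add_pos_nonneg)
  then have "r powr (2 * s) * (1 / (r + norm a) powr N)
      \<le> r powr (2 * s) * ((1 + norm (a - b) / r) powr N / (r + norm b) powr N)"
    by (intro mult_left_mono) auto
  then show ?thesis by (simp add: tail_weight_def N_def mult_ac)
qed

text \<open>On its support the mollifier is at most a multiple of \<epsilon>^(-n), and \<epsilon> +
  |y| <= 2\<epsilon> makes the weight at least a multiple of the same power. Mollification is thus
  controlled by the tail average at the same scale, and one almost-everywhere statement serves
  both.\<close>

lemma mollifier_le_tail_weight:
  fixes s :: real
  assumes s: "0 < s"
  obtains C where "0 < C" "\<And>\<epsilon> (y::'a::euclidean_space). 0 < \<epsilon> \<Longrightarrow> mollifier \<epsilon> y \<le> C * tail_weight s \<epsilon> y"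
proof -
  define n where "n = DIM('a)"
  define N where "N = real n + 2 * s"
  define b where "b = exp (- 4 / 3) * unit_ball_vol n / 2 ^ n"
  have b: "0 < b" by (simp add: b_def)
  define C where "C = 2 powr N / b"
  have C: "0 < C" using b by (simp add: C_def)
  have "mollifier \<epsilon> y \<le> C * tail_weight s \<epsilon> y" if e: "0 < \<epsilon>" for \<epsilon> and y :: 'a
  proof (cases "mollifier \<epsilon> y = 0")
    case True
    then show ?thesis using C by simp
  next
    case False
    then have y: "norm y < \<epsilon>" using mollifier_support e by blast
    have "b * \<epsilon> ^ n \<le> bump_mass TYPE('a) \<epsilon>"
      using bump_mass_lower_bound[OF e, where 'a = 'a] by (simp add: b_def n_def power_divide)
    then have "mollifier \<epsilon> y \<le> 1 / (b * \<epsilon> ^ n)"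
      unfolding mollifier_def using bump_exp_le[of 0] bump_exp_nonneg b e
      by (intro frac_le) auto
    also have "\<dots> = C * (\<epsilon> powr (2 * s) / (2 * \<epsilon>) powr N)"
      using b e by (simp add: C_def N_def powr_mult powr_add powr_realpow)
    also have "\<dots> \<le> C * tail_weight s \<epsilon> y"
      unfolding tail_weight_def N_def[symmetric] n_def[symmetric] using C e y s
      by (intro mult_left_mono divide_left_mono powr_mono2 mult_pos_pos powr_gt_zero[THEN iffD2])
        (auto simp: N_def dest: add_pos_nonneg[OF _ norm_ge_zero, of _ y])
    finally show ?thesis .
  qed
  with C show ?thesis by (rule that)
qed

definition mollify :: "('a::euclidean_space \<Rightarrow> real) \<Rightarrow> real \<Rightarrow> 'a \<Rightarrow> real" where
  "mollify f \<epsilon> x = (LBINT y. f y * mollifier \<epsilon> (y - x))"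

lemma mollify_integrable:
  fixes f :: "'a::euclidean_space \<Rightarrow> real"
  assumes f: "tail_integrable s f" and s: "0 < s" and e: "0 < \<epsilon>"
  shows "integrable lborel (\<lambda>y. f y * mollifier \<epsilon> (y - x))"
proof -
  obtain C where C: "0 < C" "\<And>\<epsilon> (y::'a). 0 < \<epsilon> \<Longrightarrow> mollifier \<epsilon> y \<le> C * tail_weight s \<epsilon> y"
    by (rule mollifier_le_tail_weight[OF s, where 'a = 'a]) blast
  have [measurable]: "f \<in> borel_measurable borel" using f by measurable
  have "integrable lborel (\<lambda>y. C * (f y * tail_weight s \<epsilon> (y - x)))"
    using f s e by (intro integrable_mult_right tail_integrable_weight)
  then show ?thesis
  proof (rule Bochner_Integration.integrable_bound)
    show "AE y in lborel. norm (f y * mollifier \<epsilon> (y - x)) \<le> norm (C * (f y * tail_weight s \<epsilon> (y - x)))"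
    proof (rule AE_I2)
      fix y
      have "\<bar>f y\<bar> * mollifier \<epsilon> (y - x) \<le> \<bar>f y\<bar> * (C * tail_weight s \<epsilon> (y - x))"
        using C(2)[OF e] by (intro mult_left_mono) auto
      then show "norm (f y * mollifier \<epsilon> (y - x)) \<le> norm (C * (f y * tail_weight s \<epsilon> (y - x)))"
        using C(1) mollifier_nonneg[OF e, of "y - x"] by (simp add: abs_mult mult_ac)
    qed
  qed measurable
qed

lemma nn_integral_mollifier_shift:
  fixes y :: "'a::euclidean_space"
  assumes "0 < \<epsilon>"
  shows "(\<integral>\<^sup>+x. ennreal (mollifier \<epsilon> (y - x)) \<partial>lborel) = 1"
proof -
  have "(\<integral>\<^sup>+x. ennreal (mollifier \<epsilon> (y - x)) \<partial>lborel) = (\<integral>\<^sup>+x. ennreal (mollifier \<epsilon> (y - (y + x))) \<partial>lborel)"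
    by (subst nn_integral_lborel_translate[where f = "\<lambda>x. ennreal (mollifier \<epsilon> (y - x))"]) auto
  also have "\<dots> = (\<integral>\<^sup>+x. ennreal (mollifier \<epsilon> (x::'a)) \<partial>lborel)" by simp
  also have "\<dots> = 1"
    using mollifier_integrable[OF assms] mollifier_integral[OF assms] mollifier_nonneg[OF assms]
    by (subst nn_integral_eq_integral) auto
  finally show ?thesis .
qed

lemma integral_mollifier_shift:
  fixes x :: "'a::euclidean_space"
  assumes "0 < \<epsilon>"
  shows "(LBINT y. mollifier \<epsilon> (y - x)) = 1"
  using integral_lborel_translate[of "mollifier \<epsilon>" "- x"] mollifier_integral[OF assms, where 'a = 'a]
  by (simp add: add.commute)

lemma mollify_measurable [measurable]:
  fixes f :: "'a::euclidean_space \<Rightarrow> real"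
  assumes [measurable]: "f \<in> borel_measurable borel"
  shows "mollify f \<epsilon> \<in> borel_measurable borel"
  unfolding mollify_def by measurable

lemma mollify_nonneg: "0 < \<epsilon> \<Longrightarrow> (\<And>y. 0 \<le> f y) \<Longrightarrow> 0 \<le> mollify f \<epsilon> x"
  unfolding mollify_def by (intro integral_nonneg_AE AE_I2 mult_nonneg_nonneg mollifier_nonneg)

lemma mollify_const: "0 < \<epsilon> \<Longrightarrow> mollify (\<lambda>y. c) \<epsilon> x = c"
  unfolding mollify_def by (simp add: integral_mollifier_shift)

lemma mollify_diff:
  assumes "tail_integrable s f" "tail_integrable s g" "0 < s" "0 < \<epsilon>"
  shows "mollify (\<lambda>y. f y - g y) \<epsilon> x = mollify f \<epsilon> x - mollify g \<epsilon> x"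
  unfolding mollify_def using assms
  by (subst Bochner_Integration.integral_diff[symmetric])
    (auto intro: mollify_integrable simp: left_diff_distrib)

lemma mollify_mono:
  assumes "tail_integrable s f" "tail_integrable s g" "0 < s" "0 < \<epsilon>" "\<And>y. f y \<le> g y"
  shows "mollify f \<epsilon> x \<le> mollify g \<epsilon> x"
  unfolding mollify_def using assms
  by (intro integral_mono mollify_integrable mult_right_mono mollifier_nonneg) auto

lemma mollify_mono_AE:
  assumes "tail_integrable s f" "tail_integrable s g" "0 < s" "0 < \<epsilon>" "AE y in lborel. f y \<le> g y"
  shows "mollify f \<epsilon> x \<le> mollify g \<epsilon> x"
  unfolding mollify_def
proof (rule integral_mono_AE)
  show "AE y in lborel. f y * mollifier \<epsilon> (y - x) \<le> g y * mollifier \<epsilon> (y - x)"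
    using assms(5) by eventually_elim (intro mult_right_mono mollifier_nonneg assms)
qed (use assms in \<open>auto intro: mollify_integrable\<close>)

lemma mollify_continuous:
  fixes f :: "'a::euclidean_space \<Rightarrow> real"
  assumes f: "tail_integrable s f" and s: "0 < s" and e: "0 < \<epsilon>"
  shows "continuous_on S (mollify f \<epsilon>)"
proof -
  define N where "N = real DIM('a) + 2 * s"
  obtain C where C: "0 < C" "\<And>\<epsilon> (y::'a). 0 < \<epsilon> \<Longrightarrow> mollifier \<epsilon> y \<le> C * tail_weight s \<epsilon> y"
    by (rule mollifier_le_tail_weight[OF s, where 'a = 'a]) blast
  have [measurable]: "f \<in> borel_measurable borel" using f by measurable
  have "isCont (mollify f \<epsilon>) x" for x
    unfolding continuous_at_sequentially o_def
  proof (intro allI impI)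
    fix X assume X: "X \<longlonglongrightarrow> x"
    then have "Bseq (\<lambda>i. X i - x)"
      by (intro convergent_imp_Bseq convergentI[of _ "x - x"] tendsto_intros)
    then obtain D where D: "0 < D" "\<And>i. norm (X i - x) \<le> D" by (auto simp: Bseq_def)
    \<comment> \<open>The sequence stays within distance D of its limit, so all weights centred at
      \<open>X i\<close> are dominated by one centred at x; this gives a single integrable
      majorant.\<close>
    define A where "A = C * (1 + D / \<epsilon>) powr N"
    show "(\<lambda>i. mollify f \<epsilon> (X i)) \<longlonglongrightarrow> mollify f \<epsilon> x"
      unfolding mollify_def
    proof (rule integral_dominated_convergence[where w = "\<lambda>y. A * (\<bar>f y\<bar> * tail_weight s \<epsilon> (y - x))"])
      have "tail_integrable s (\<lambda>y. \<bar>f y\<bar>)"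
        using f by (rule tail_integrable_bound) auto
      then show "integrable lborel (\<lambda>y. A * (\<bar>f y\<bar> * tail_weight s \<epsilon> (y - x)))"
        using s e by (intro integrable_mult_right tail_integrable_weight)
      show "AE y in lborel. (\<lambda>i. f y * mollifier \<epsilon> (y - X i)) \<longlonglongrightarrow> f y * mollifier \<epsilon> (y - x)"
      proof (intro AE_I2 tendsto_intros)
        fix y
        have "isCont (mollifier \<epsilon>) (y - x)"
          using mollifier_continuous[of UNIV \<epsilon>] continuous_on_eq_continuous_at[of UNIV] by blast
        then show "(\<lambda>i. mollifier \<epsilon> (y - X i)) \<longlonglongrightarrow> mollifier \<epsilon> (y - x)"
          by (rule isCont_tendsto_compose) (intro tendsto_intros X)
      qed
      fix i
      show "AE y in lborel. norm (f y * mollifier \<epsilon> (y - X i)) \<le> A * (\<bar>f y\<bar> * tail_weight s \<epsilon> (y - x))"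
      proof (rule AE_I2)
        fix y
        have "mollifier \<epsilon> (y - X i) \<le> C * tail_weight s \<epsilon> (y - X i)" by (rule C(2)[OF e])
        also have "\<dots> \<le> C * ((1 + norm ((y - X i) - (y - x)) / \<epsilon>) powr N * tail_weight s \<epsilon> (y - x))"
          unfolding N_def using C(1) s e by (intro mult_left_mono tail_weight_shift) auto
        also have "\<dots> \<le> C * ((1 + D / \<epsilon>) powr N * tail_weight s \<epsilon> (y - x))"
          using C(1) s e D by (intro mult_left_mono mult_right_mono powr_mono2 add_left_mono divide_right_mono)
            (auto simp: N_def norm_minus_commute)
        finally have "\<bar>f y\<bar> * mollifier \<epsilon> (y - X i) \<le> \<bar>f y\<bar> * (A * tail_weight s \<epsilon> (y - x))"
          by (intro mult_left_mono) (auto simp: A_def mult_ac)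
        then show "norm (f y * mollifier \<epsilon> (y - X i)) \<le> A * (\<bar>f y\<bar> * tail_weight s \<epsilon> (y - x))"
          using mollifier_nonneg[OF e, of "y - X i"] by (simp add: abs_mult mult_ac)
      qed
    qed measurable
  qed
  then show ?thesis by (simp add: continuous_at_imp_continuous_on)
qed

section \<open>Moving a mollification onto the weight\<close>

lemma nn_integral_mollify:
  fixes f w :: "'a::euclidean_space \<Rightarrow> real"
  assumes f: "tail_integrable s f" "\<And>y. 0 \<le> f y" and s: "0 < s" and e: "0 < \<epsilon>"
    and [measurable]: "w \<in> borel_measurable borel" and w: "\<And>x. 0 \<le> w x"
  shows "(\<integral>\<^sup>+x. ennreal (mollify f \<epsilon> x * w x) \<partial>lborel)
    = (\<integral>\<^sup>+y. (\<integral>\<^sup>+x. ennreal (f y * w x * mollifier \<epsilon> (y - x)) \<partial>lborel) \<partial>lborel)"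
proof -
  have [measurable]: "f \<in> borel_measurable borel" using f by measurable
  have "ennreal (mollify f \<epsilon> x * w x) = (\<integral>\<^sup>+y. ennreal (f y * w x * mollifier \<epsilon> (y - x)) \<partial>lborel)" for x
  proof -
    have "mollify f \<epsilon> x * w x = (LBINT y. f y * mollifier \<epsilon> (y - x) * w x)"
      by (simp add: mollify_def)
    moreover have "ennreal \<dots> = (\<integral>\<^sup>+y. ennreal (f y * mollifier \<epsilon> (y - x) * w x) \<partial>lborel)"
      using f s e w mollifier_nonneg[OF e]
      by (intro nn_integral_eq_integral[symmetric] integrable_mult_left mollify_integrable AE_I2 mult_nonneg_nonneg) auto
    ultimately show ?thesis by (simp add: mult_ac)
  qed
  then have "(\<integral>\<^sup>+x. ennreal (mollify f \<epsilon> x * w x) \<partial>lborel)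
    = (\<integral>\<^sup>+x. (\<integral>\<^sup>+y. ennreal (f y * w x * mollifier \<epsilon> (y - x)) \<partial>lborel) \<partial>lborel)" by simp
  also have "\<dots> = (\<integral>\<^sup>+y. (\<integral>\<^sup>+x. ennreal (f y * w x * mollifier \<epsilon> (y - x)) \<partial>lborel) \<partial>lborel)"
    by (rule lborel_pair.Fubini') measurable
  finally show ?thesis .
qed

text \<open>After exchanging the integrals, the mollifier couples only points closer than \<epsilon>
  and has integral one in x, so \<open>w\<close> near y may be replaced by \<open>w'\<close> at
  y.\<close>

lemma nn_integral_mollify_le:
  fixes f w w' :: "'a::euclidean_space \<Rightarrow> real"
  assumes f: "tail_integrable s f" "\<And>y. 0 \<le> f y" and s: "0 < s" and e: "0 < \<epsilon>"
    and [measurable]: "w \<in> borel_measurable borel" "w' \<in> borel_measurable borel"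
    and w: "\<And>x. 0 \<le> w x" "\<And>x. 0 \<le> w' x"
    and le: "\<And>x y. norm (y - x) < \<epsilon> \<Longrightarrow> w x \<le> w' y"
  shows "(\<integral>\<^sup>+x. ennreal (mollify f \<epsilon> x * w x) \<partial>lborel) \<le> (\<integral>\<^sup>+y. ennreal (f y * w' y) \<partial>lborel)"
proof -
  have [measurable]: "f \<in> borel_measurable borel" using f by measurable
  have "(\<integral>\<^sup>+x. ennreal (mollify f \<epsilon> x * w x) \<partial>lborel)
      = (\<integral>\<^sup>+y. (\<integral>\<^sup>+x. ennreal (f y * w x * mollifier \<epsilon> (y - x)) \<partial>lborel) \<partial>lborel)"
    by (rule nn_integral_mollify) fact+
  also have "\<dots> \<le> (\<integral>\<^sup>+y. (\<integral>\<^sup>+x. ennreal (f y * w' y) * ennreal (mollifier \<epsilon> (y - x)) \<partial>lborel) \<partial>lborel)"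
  proof (intro nn_integral_mono)
    fix x y
    have "f y * w x * mollifier \<epsilon> (y - x) \<le> f y * w' y * mollifier \<epsilon> (y - x)"
    proof (cases "mollifier \<epsilon> (y - x) = 0")
      case False
      then have "w x \<le> w' y" using le mollifier_support[OF e] by blast
      then show ?thesis using f mollifier_nonneg[OF e] by (intro mult_right_mono mult_left_mono)
    qed simp
    then show "ennreal (f y * w x * mollifier \<epsilon> (y - x)) \<le> ennreal (f y * w' y) * ennreal (mollifier \<epsilon> (y - x))"
      using f w mollifier_nonneg[OF e] by (subst ennreal_mult[symmetric]) (auto intro: ennreal_leI)
  qed
  also have "\<dots> = (\<integral>\<^sup>+y. ennreal (f y * w' y) \<partial>lborel)"
    by (simp add: nn_integral_cmult nn_integral_mollifier_shift[OF e])
  finally show ?thesis .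
qed

lemma nn_integral_mollify_ge:
  fixes f w w' :: "'a::euclidean_space \<Rightarrow> real"
  assumes f: "tail_integrable s f" "\<And>y. 0 \<le> f y" and s: "0 < s" and e: "0 < \<epsilon>"
    and [measurable]: "w \<in> borel_measurable borel" "w' \<in> borel_measurable borel"
    and w: "\<And>x. 0 \<le> w x" "\<And>x. 0 \<le> w' x"
    and le: "\<And>x y. norm (y - x) < \<epsilon> \<Longrightarrow> w' y \<le> w x"
  shows "(\<integral>\<^sup>+y. ennreal (f y * w' y) \<partial>lborel) \<le> (\<integral>\<^sup>+x. ennreal (mollify f \<epsilon> x * w x) \<partial>lborel)"
proof -
  have [measurable]: "f \<in> borel_measurable borel" using f by measurable
  have "(\<integral>\<^sup>+y. ennreal (f y * w' y) \<partial>lborel)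
      = (\<integral>\<^sup>+y. (\<integral>\<^sup>+x. ennreal (f y * w' y) * ennreal (mollifier \<epsilon> (y - x)) \<partial>lborel) \<partial>lborel)"
    by (simp add: nn_integral_cmult nn_integral_mollifier_shift[OF e])
  also have "\<dots> \<le> (\<integral>\<^sup>+y. (\<integral>\<^sup>+x. ennreal (f y * w x * mollifier \<epsilon> (y - x)) \<partial>lborel) \<partial>lborel)"
  proof (intro nn_integral_mono)
    fix x y
    have "f y * w' y * mollifier \<epsilon> (y - x) \<le> f y * w x * mollifier \<epsilon> (y - x)"
    proof (cases "mollifier \<epsilon> (y - x) = 0")
      case False
      then have "w' y \<le> w x" using le mollifier_support[OF e] by blast
      then show ?thesis using f mollifier_nonneg[OF e] by (intro mult_right_mono mult_left_mono)
    qed simp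
    then show "ennreal (f y * w' y) * ennreal (mollifier \<epsilon> (y - x)) \<le> ennreal (f y * w x * mollifier \<epsilon> (y - x))"
      using f w mollifier_nonneg[OF e] by (subst ennreal_mult[symmetric]) (auto intro: ennreal_leI)
  qed
  also have "\<dots> = (\<integral>\<^sup>+x. ennreal (mollify f \<epsilon> x * w x) \<partial>lborel)"
    by (rule nn_integral_mollify[symmetric]) fact+
  finally show ?thesis .
qed

text \<open>The weight of radius 1 changes by at most (1 + \<epsilon>)^N over a distance \<epsilon>,
  so the transfer estimate applies to |f|; the mollification of |f| dominates that of f.\<close>

lemma mollify_tail_integrable:
  fixes f :: "'a::euclidean_space \<Rightarrow> real"
  assumes f: "tail_integrable s f" and s: "0 < s" and e: "0 < \<epsilon>"
  shows "tail_integrable s (mollify f \<epsilon>)"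
proof -
  define N where "N = real DIM('a) + 2 * s"
  define g where "g y = \<bar>f y\<bar>" for y
  have [measurable]: "f \<in> borel_measurable borel" using f by measurable
  have g: "tail_integrable s g" "\<And>y. 0 \<le> g y"
    unfolding g_def using f by (auto intro: tail_integrable_bound)
  have [measurable]: "g \<in> borel_measurable borel" using g by measurable
  have w1: "tail_weight s 1 y = 1 / (1 + norm y) powr N" for y :: 'a
    by (simp add: tail_weight_def N_def)
  have "(\<integral>\<^sup>+x. ennreal (mollify g \<epsilon> x * tail_weight s 1 x) \<partial>lborel)
      \<le> (\<integral>\<^sup>+y. ennreal (g y * ((1 + \<epsilon>) powr N * tail_weight s 1 y)) \<partial>lborel)"
  proof (rule nn_integral_mollify_le[OF g s e])
    fix x y :: 'a assume "norm (y - x) < \<epsilon>"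
    then have "(1 + norm (x - y) / 1) powr N \<le> (1 + \<epsilon>) powr N"
      using e s by (intro powr_mono2) (auto simp: N_def norm_minus_commute add_nonneg_nonneg)
    then have "(1 + norm (x - y) / 1) powr N * tail_weight s 1 y \<le> (1 + \<epsilon>) powr N * tail_weight s 1 y"
      by (intro mult_right_mono) auto
    then show "tail_weight s 1 x \<le> (1 + \<epsilon>) powr N * tail_weight s 1 y"
      using tail_weight_shift[OF s, of 1 x y] by (simp add: N_def)
  qed auto
  also have "\<dots> < \<infinity>"
  proof -
    have "integrable lborel (\<lambda>y. (1 + \<epsilon>) powr N * (g y * tail_weight s 1 (y - 0)))"
      using g s by (intro integrable_mult_right tail_integrable_weight) auto
    then have "integrable lborel (\<lambda>y. g y * ((1 + \<epsilon>) powr N * tail_weight s 1 y))" by (simp add: mult_ac)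
    then show ?thesis using g
      by (subst nn_integral_eq_integral) auto
  qed
  finally have "integrable lborel (\<lambda>x. mollify g \<epsilon> x * tail_weight s 1 x)"
    by (intro integrableI_nonneg AE_I2 mult_nonneg_nonneg mollify_nonneg[OF e g(2)]) auto
  then have "integrable lborel (\<lambda>x. mollify f \<epsilon> x * tail_weight s 1 x)"
  proof (rule Bochner_Integration.integrable_bound)
    have "\<bar>mollify f \<epsilon> x\<bar> \<le> mollify g \<epsilon> x" for x
    proof -
      have "norm (mollify f \<epsilon> x) \<le> (LBINT y. norm (f y * mollifier \<epsilon> (y - x)))"
        unfolding mollify_def by (rule integral_norm_bound)
      moreover have "(\<lambda>y. norm (f y * mollifier \<epsilon> (y - x))) = (\<lambda>y. g y * mollifier \<epsilon> (y - x))"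
        using mollifier_nonneg[OF e, where 'a = 'a] by (simp add: g_def abs_mult fun_eq_iff)
      ultimately show ?thesis by (simp only: mollify_def real_norm_def)
    qed
    then show "AE x in lborel. norm (mollify f \<epsilon> x * tail_weight s 1 x) \<le> norm (mollify g \<epsilon> x * tail_weight s 1 x)"
      by (intro AE_I2) (auto simp: abs_mult intro!: mult_right_mono order_trans[OF _ abs_ge_self])
  qed measurable
  then show ?thesis by (simp add: tail_integrable_def w1 N_def)
qed

lemma nn_integral_lborel_scale:
  fixes f :: "'a::euclidean_space \<Rightarrow> ennreal"
  assumes [measurable]: "f \<in> borel_measurable borel" and r: "0 < r"
  shows "(\<integral>\<^sup>+y. f y \<partial>lborel) = ennreal (r ^ DIM('a)) * (\<integral>\<^sup>+x. f (r *\<^sub>R x) \<partial>lborel)"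
proof -
  have "(\<integral>\<^sup>+y. f y \<partial>lborel)
      = (\<integral>\<^sup>+y. f y \<partial>density (distr lborel borel (\<lambda>x. 0 + r *\<^sub>R x)) (\<lambda>_. ennreal (\<bar>r\<bar> ^ DIM('a))))"
    using r by (subst lborel_affine[of r 0]) auto
  also have "\<dots> = ennreal (r ^ DIM('a)) * (\<integral>\<^sup>+x. f (r *\<^sub>R x) \<partial>lborel)"
    using r by (subst nn_integral_density) (auto simp: nn_integral_distr nn_integral_cmult)
  finally show ?thesis .
qed

text \<open>The weight is an L^1-normalised dilation, so rescaling removes r. This is the bound that
  stays uniform while the radius tends to zero.\<close>

lemma nn_integral_tail_weight:
  fixes y :: "'a::euclidean_space"
  assumes r: "0 < r"
  shows "(\<integral>\<^sup>+x. ennreal (tail_weight s r (y - x)) \<partial>lborel) = (\<integral>\<^sup>+x. ennreal (tail_weight s 1 (x::'a)) \<partial>lborel)"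
proof -
  have "(\<integral>\<^sup>+x. ennreal (tail_weight s r (y - x)) \<partial>lborel) = (\<integral>\<^sup>+x. ennreal (tail_weight s r (y - (y + x))) \<partial>lborel)"
    by (subst nn_integral_lborel_translate[where f = "\<lambda>x. ennreal (tail_weight s r (y - x))"]) auto
  also have "\<dots> = (\<integral>\<^sup>+x. ennreal (tail_weight s r (x::'a)) \<partial>lborel)" by simp
  also have "\<dots> = ennreal (r ^ DIM('a)) * (\<integral>\<^sup>+x. ennreal (tail_weight s r (r *\<^sub>R x :: 'a)) \<partial>lborel)"
    by (rule nn_integral_lborel_scale) (use r in auto)
  also have "\<dots> = (\<integral>\<^sup>+x. ennreal (r ^ DIM('a)) * ennreal (tail_weight s r (r *\<^sub>R x :: 'a)) \<partial>lborel)"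
    by (rule nn_integral_cmult[symmetric]) measurable
  also have "\<dots> = (\<integral>\<^sup>+x. ennreal (tail_weight s 1 (x::'a)) \<partial>lborel)"
  proof (intro nn_integral_cong)
    fix x :: 'a
    have "r + norm (r *\<^sub>R x) = r * (1 + norm x)" using r by (simp add: algebra_simps)
    then have "r ^ DIM('a) * tail_weight s r (r *\<^sub>R x) = tail_weight s 1 x"
      using r by (simp add: tail_weight_def powr_mult powr_add powr_realpow)
    then show "ennreal (r ^ DIM('a)) * ennreal (tail_weight s r (r *\<^sub>R x)) = ennreal (tail_weight s 1 x)"
      using r by (subst ennreal_mult[symmetric]) auto
  qed
  finally show ?thesis .
qed

section \<open>Essential lower bounds\<close>

lemma tail_weight_integrable:
  fixes x :: "'a::euclidean_space"
  assumes "0 < s" "0 < r" shows "integrable lborel (\<lambda>y. tail_weight s r (y - x))"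
  using tail_integrable_weight[OF tail_integrable_const[OF assms(1), of 1] assms, of x] by simp

lemma mollify_diff_const:
  assumes "tail_integrable s f" "0 < s" "0 < \<epsilon>"
  shows "mollify (\<lambda>y. f y - c) \<epsilon> x = mollify f \<epsilon> x - c"
    and "mollify (\<lambda>y. c - f y) \<epsilon> x = c - mollify f \<epsilon> x"
  using mollify_diff[OF assms(1) tail_integrable_const[OF assms(2)] assms(2,3)]
    mollify_diff[OF tail_integrable_const[OF assms(2)] assms(1) assms(2,3)] mollify_const[OF assms(3)]
  by metis+

text \<open>By Tonelli the integral pairs \<open>f\<close> with \<open>\<Psi> j\<close>, the weight
  of radius 1/(j+1) integrated over K. Points of K do not count because \<open>f\<close> vanishes
  there; off K the distance to K is positive and \<open>\<Psi> j\<close> decays like the power 2s of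
  the radius.\<close>

lemma tail_weight_average_compact:
  fixes f :: "'a::euclidean_space \<Rightarrow> real"
  assumes f: "tail_integrable s f" "\<And>y. 0 \<le> f y" and s: "0 < s"
    and K: "compact K" "\<And>x. x \<in> K \<Longrightarrow> f x = 0"
  shows "(\<lambda>j. \<integral>\<^sup>+x. (\<integral>\<^sup>+y. ennreal (f y * tail_weight s (1 / real (Suc j)) (y - x)) \<partial>lborel)
            * indicator K x \<partial>lborel) \<longlonglongrightarrow> 0"
proof -
  define N where "N = real DIM('a) + 2 * s"
  define \<rho> where "\<rho> j = 1 / real (Suc j)" for j
  have rho: "0 < \<rho> j" "\<rho> j \<le> 1" for j by (auto simp: \<rho>_def)
  have [measurable]: "f \<in> borel_measurable borel" using f by measurable
  have [measurable]: "K \<in> sets borel" using K(1) by (rule borel_compact)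
  define \<Psi> where "\<Psi> j y = (\<integral>\<^sup>+x. ennreal (tail_weight s (\<rho> j) (y - x)) * indicator K x \<partial>lborel)" for j y
  have [measurable]: "\<Psi> j \<in> borel_measurable borel" for j unfolding \<Psi>_def by measurable
  have swap: "(\<integral>\<^sup>+x. (\<integral>\<^sup>+y. ennreal (f y * tail_weight s (\<rho> j) (y - x)) \<partial>lborel) * indicator K x \<partial>lborel)
      = (\<integral>\<^sup>+y. ennreal (f y) * \<Psi> j y \<partial>lborel)" for j
  proof -
    have "(\<integral>\<^sup>+x. (\<integral>\<^sup>+y. ennreal (f y * tail_weight s (\<rho> j) (y - x)) \<partial>lborel) * indicator K x \<partial>lborel)
      = (\<integral>\<^sup>+x. (\<integral>\<^sup>+y. ennreal (f y) * (ennreal (tail_weight s (\<rho> j) (y - x)) * indicator K x) \<partial>lborel) \<partial>lborel)"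
      using f by (simp add: nn_integral_multc[symmetric] ennreal_mult mult.assoc)
    also have "\<dots> = (\<integral>\<^sup>+y. (\<integral>\<^sup>+x. ennreal (f y) * (ennreal (tail_weight s (\<rho> j) (y - x)) * indicator K x) \<partial>lborel) \<partial>lborel)"
      by (rule lborel_pair.Fubini') measurable
    also have "\<dots> = (\<integral>\<^sup>+y. ennreal (f y) * \<Psi> j y \<partial>lborel)"
      unfolding \<Psi>_def by (simp add: nn_integral_cmult)
    finally show ?thesis .
  qed
  obtain R where R: "0 < R" "K \<subseteq> cball 0 R"
    using compact_imp_bounded[OF K(1)] bounded_pos by (metis mem_cball_0 subsetI)
  define W where "W = (LBINT x. tail_weight s 1 (x::'a))"
  have W: "(\<integral>\<^sup>+x. ennreal (tail_weight s 1 (x::'a)) \<partial>lborel) = ennreal W" "0 \<le> W"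
    unfolding W_def using tail_weight_integrable[OF s, of 1 "0::'a"]
    by (auto intro!: nn_integral_eq_integral integral_nonneg_AE)
  define \<kappa> where "\<kappa> = measure lborel K"
  have kap: "emeasure lborel K = ennreal \<kappa>" "0 \<le> \<kappa>"
    unfolding \<kappa>_def using emeasure_compact_finite[OF K(1)] by (auto intro!: emeasure_eq_ennreal_measure)
  have le_const: "\<Psi> j y \<le> ennreal (c * \<kappa>)" if "0 \<le> c" "\<And>x. x \<in> K \<Longrightarrow> tail_weight s (\<rho> j) (y - x) \<le> c" for j y c
  proof -
    have "\<Psi> j y \<le> (\<integral>\<^sup>+x. ennreal c * indicator K x \<partial>lborel)"
      unfolding \<Psi>_def using that by (intro nn_integral_mono) (auto simp: indicator_def intro: ennreal_leI)
    also have "\<dots> = ennreal (c * \<kappa>)"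
      using that kap by (simp add: nn_integral_cmult_indicator ennreal_mult)
    finally show ?thesis .
  qed
  \<comment> \<open>Two regimes give a majorant uniform in j. For |y| <= 2R + 1 the total mass W is
    used, turned into the decay (1 + |y|)^(-N) by the factor (2R + 2)^N; further out, the distance
    to K is comparable to 1 + |y|.\<close>
  define B where "B = W * (2 * R + 2) powr N + 2 powr N * \<kappa>"
  have B: "0 \<le> B" using W kap by (simp add: B_def)
  have bound: "\<Psi> j y \<le> ennreal (B / (1 + norm y) powr N)" for j y
  proof (cases "norm y \<le> 2 * R + 1")
    case True
    have "\<Psi> j y \<le> (\<integral>\<^sup>+x. ennreal (tail_weight s (\<rho> j) (y - x)) \<partial>lborel)"
      unfolding \<Psi>_def by (intro nn_integral_mono) (auto simp: indicator_def)
    also have "\<dots> = ennreal W" by (simp only: nn_integral_tail_weight[OF rho(1)] W)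
    also have "\<dots> \<le> ennreal (B / (1 + norm y) powr N)"
    proof (rule ennreal_leI)
      have "(1 + norm y) powr N \<le> (2 * R + 2) powr N"
        using True s by (intro powr_mono2) (auto simp: N_def)
      then have "W * (1 + norm y) powr N \<le> W * (2 * R + 2) powr N" using W by (intro mult_left_mono)
      also have "\<dots> \<le> B" using kap by (simp add: B_def)
      finally have le: "W * (1 + norm y) powr N \<le> B" .
      have "0 < 1 + norm y" by (rule add_pos_nonneg) auto
      then have "0 < (1 + norm y) powr N" by simp
      then show "W \<le> B / (1 + norm y) powr N" using le by (simp only: pos_le_divide_eq)
    qed
    finally show ?thesis .
  next
    case False
    have p: "0 < 1 + norm y" by (rule add_pos_nonneg) auto
    have "\<Psi> j y \<le> ennreal (2 powr N / (1 + norm y) powr N * \<kappa>)"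
    proof (rule le_const)
      fix x assume "x \<in> K"
      then have "norm x \<le> R" using R by auto
      then have "norm y - R \<le> norm (y - x)"
        using norm_triangle_sub[of y x] by linarith
      then have "1 + norm y \<le> 2 * (\<rho> j + norm (y - x))"
        unfolding distrib_left using False rho(1)[of j] by linarith
      then have "1 / (\<rho> j + norm (y - x)) powr N \<le> 2 powr N / (1 + norm y) powr N"
        using p rho s by (intro inverse_powr_le) (auto simp: N_def intro: add_pos_nonneg)
      moreover have "\<rho> j powr (2 * s) \<le> 1" using rho[of j] s by (intro powr_le1) auto
      ultimately have "\<rho> j powr (2 * s) * (1 / (\<rho> j + norm (y - x)) powr N) \<le> 1 * (2 powr N / (1 + norm y) powr N)"
        by (intro mult_mono) auto
      then show "tail_weight s (\<rho> j) (y - x) \<le> 2 powr N / (1 + norm y) powr N"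
        by (simp add: tail_weight_def N_def)
    qed auto
    also have "\<dots> \<le> ennreal (B / (1 + norm y) powr N)"
      using W by (intro ennreal_leI) (simp add: B_def divide_right_mono)
    finally show ?thesis .
  qed
  have "(\<lambda>j. \<integral>\<^sup>+y. ennreal (f y) * \<Psi> j y \<partial>lborel) \<longlonglongrightarrow> (\<integral>\<^sup>+y. 0 \<partial>(lborel :: 'a measure))"
  proof (rule nn_integral_dominated_convergence)
    show "AE y in lborel. ennreal (f y) * \<Psi> j y \<le> ennreal (f y) * ennreal (B / (1 + norm y) powr N)" for j
      using bound by (intro AE_I2 mult_left_mono) auto
    have "integrable lborel (\<lambda>y. B * (f y / (1 + norm y) powr N))"
      using f by (intro integrable_mult_right) (simp add: tail_integrable_def N_def)
    then have "(\<integral>\<^sup>+y. ennreal (B * (f y / (1 + norm y) powr N)) \<partial>lborel) < \<infinity>"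
      using f B by (subst nn_integral_eq_integral) auto
    moreover have "ennreal (B * (f y / (1 + norm y) powr N)) = ennreal (f y) * ennreal (B / (1 + norm y) powr N)" for y
      using f B by (subst ennreal_mult[symmetric]) auto
    ultimately show "(\<integral>\<^sup>+y. ennreal (f y) * ennreal (B / (1 + norm y) powr N) \<partial>lborel) < \<infinity>" by simp
    show "AE y in lborel. (\<lambda>j. ennreal (f y) * \<Psi> j y) \<longlonglongrightarrow> 0"
    proof (rule AE_I2)
      fix y
      show "(\<lambda>j. ennreal (f y) * \<Psi> j y) \<longlonglongrightarrow> 0"
      proof (cases "y \<in> K")
        case True
        then show ?thesis using K(2) by simp
      next
        case False
        then obtain \<delta> where d: "0 < \<delta>" "\<And>x. x \<in> K \<Longrightarrow> \<delta> \<le> norm (y - x)"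
          using separate_point_closed[OF compact_imp_closed[OF K(1)] False] unfolding dist_norm by blast
        have le: "ennreal (f y) * \<Psi> j y \<le> ennreal (f y * (\<rho> j powr (2 * s) / \<delta> powr N * \<kappa>))" for j
        proof -
          have "\<Psi> j y \<le> ennreal (\<rho> j powr (2 * s) / \<delta> powr N * \<kappa>)"
          proof (rule le_const)
            fix x assume "x \<in> K"
            then have "\<delta> powr N \<le> (\<rho> j + norm (y - x)) powr N"
              using d s rho(1)[of j] by (intro powr_mono2) (auto simp: N_def intro: add_increasing)
            then show "tail_weight s (\<rho> j) (y - x) \<le> \<rho> j powr (2 * s) / \<delta> powr N"
              unfolding tail_weight_def N_def[symmetric] using d
                by (intro divide_left_mono mult_pos_pos) (auto intro: less_le_trans[of 0 "\<delta> powr N"])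
          qed auto
          then have "ennreal (f y) * \<Psi> j y \<le> ennreal (f y) * ennreal (\<rho> j powr (2 * s) / \<delta> powr N * \<kappa>)"
            by (intro mult_left_mono) auto
          then show ?thesis by (subst ennreal_mult'[OF f(2)])
        qed
        have "(\<lambda>j. \<rho> j powr (2 * s)) \<longlonglongrightarrow> 0"
        proof (rule tendsto_zero_powrI)
          show "\<rho> \<longlonglongrightarrow> 0" unfolding \<rho>_def
            using LIMSEQ_inverse_real_of_nat by (simp add: inverse_eq_divide)
          show "(\<lambda>_. 2 * s) \<longlonglongrightarrow> 2 * s" by (rule tendsto_const)
          show "\<forall>\<^sub>F j in sequentially. 0 \<le> \<rho> j" using rho(1) by (intro always_eventually allI less_imp_le)
        qed (use s in simp)
        then have "(\<lambda>j. f y * (\<rho> j powr (2 * s) / \<delta> powr N * \<kappa>)) \<longlonglongrightarrow> f y * (0 / \<delta> powr N * \<kappa>)"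
          using d by (intro tendsto_intros) auto
        then have "(\<lambda>j. ennreal (f y * (\<rho> j powr (2 * s) / \<delta> powr N * \<kappa>))) \<longlonglongrightarrow> ennreal 0"
          by (intro tendsto_ennrealI) simp
        then have upper: "(\<lambda>j. ennreal (f y * (\<rho> j powr (2 * s) / \<delta> powr N * \<kappa>))) \<longlonglongrightarrow> 0"
          unfolding ennreal_0 .
        show ?thesis
        proof (rule tendsto_sandwich[OF _ _ tendsto_const upper])
          show "\<forall>\<^sub>F j in sequentially. 0 \<le> ennreal (f y) * \<Psi> j y" by simp
          show "\<forall>\<^sub>F j in sequentially. ennreal (f y) * \<Psi> j y
              \<le> ennreal (f y * (\<rho> j powr (2 * s) / \<delta> powr N * \<kappa>))"
            using le by (intro always_eventually allI)
        qed
      qed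
    qed
  qed measurable
  then show ?thesis unfolding swap[unfolded \<rho>_def] nn_integral_const by simp
qed

text \<open>A one-sided form of Lebesgue differentiation. The zero set is exhausted, up to a null
  set, by closed pieces whose compact parts fall under the averaging lemma; the Fatou lemma turns
  convergence of the integrals into liminf 0 almost everywhere. Some arbitrarily small radius at
  each point is all that is used later.\<close>

lemma AE_tail_weight_average_zero:
  fixes f :: "'a::euclidean_space \<Rightarrow> real"
  assumes f: "tail_integrable s f" "\<And>y. 0 \<le> f y" and s: "0 < s"
  shows "AE x in lborel. f x = 0 \<longrightarrow>
    (\<forall>e>0. \<forall>\<delta>>0. \<exists>r. 0 < r \<and> r < \<delta> \<and> (LBINT y. f y * tail_weight s r (y - x)) < e)"
proof -
  have [measurable]: "f \<in> borel_measurable borel" using f by measurable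
  define X where "X j x = (\<integral>\<^sup>+y. ennreal (f y * tail_weight s (1 / real (Suc j)) (y - x)) \<partial>lborel)" for j x
  have [measurable]: "X j \<in> borel_measurable borel" for j unfolding X_def by measurable
  define Z where "Z = {x. f x = 0}"
  have Zb: "Z \<in> sets borel" unfolding Z_def by measurable
  then have Zl: "Z \<in> sets lebesgue" by simp
  \<comment> \<open>Closed pieces are needed because the averaging lemma relies on a positive
    distance from every outside point to the compact set.\<close>
  have "\<exists>T. closed T \<and> T \<subseteq> Z \<and> emeasure lebesgue (Z - T) < ennreal (1 / real (Suc i))" for i
    by (rule sets_lebesgue_inner_closed[OF Zl, of "1 / real (Suc i)"]) auto
  then obtain T where T: "\<And>i. closed (T i)" "\<And>i. T i \<subseteq> Z"
    "\<And>i. emeasure lebesgue (Z - T i) < ennreal (1 / real (Suc i))" by metis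
  have [measurable]: "T i \<in> sets borel" for i using T by auto
  have "AE x in lborel. x \<notin> Z - (\<Union>i. T i)"
  proof -
    have "emeasure lborel (Z - (\<Union>i. T i)) = 0"
    proof (rule ccontr)
      assume "emeasure lborel (Z - (\<Union>i. T i)) \<noteq> 0"
      moreover have "emeasure lborel (Z - (\<Union>i. T i)) \<le> ennreal (1 / real (Suc i))" for i
      proof -
        have "emeasure lborel (Z - (\<Union>i. T i)) \<le> emeasure lborel (Z - T i)"
          using Zb by (intro emeasure_mono) auto
        also have "\<dots> = emeasure lebesgue (Z - T i)" using Zb by simp
        finally show ?thesis using T(3)[of i] by simp
      qed
      moreover have "(\<lambda>i. ennreal (1 / real (Suc i))) \<longlonglongrightarrow> ennreal 0"
        using LIMSEQ_inverse_real_of_nat by (intro tendsto_ennrealI) (simp add: inverse_eq_divide)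
      ultimately show False
        using LIMSEQ_le_const[of "\<lambda>i. ennreal (1 / real (Suc i))" "ennreal 0"] by (metis ennreal_0 le_zero_eq)
    qed
    then show ?thesis using Zb by (intro AE_not_in) auto
  qed
  moreover have "AE x in lborel. \<forall>i m. x \<in> T i \<inter> cball 0 (real m) \<longrightarrow> liminf (\<lambda>j. X j x) = 0"
    unfolding AE_all_countable
  proof (intro allI)
    fix i m
    define K where "K = T i \<inter> cball 0 (real m)"
    have K: "compact K" unfolding K_def using T by (simp add: closed_Int_compact)
    have [measurable]: "K \<in> sets borel" using K by (rule borel_compact)
    have "(\<lambda>j. \<integral>\<^sup>+x. X j x * indicator K x \<partial>lborel) \<longlonglongrightarrow> 0"
      unfolding X_def by (rule tail_weight_average_compact[OF f s K]) (use T Z_def K_def in auto)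
    then have "liminf (\<lambda>j. \<integral>\<^sup>+x. X j x * indicator K x \<partial>lborel) = 0"
      by (intro lim_imp_Liminf) auto
    moreover have "(\<integral>\<^sup>+x. liminf (\<lambda>j. X j x * indicator K x) \<partial>lborel) \<le> liminf (\<lambda>j. \<integral>\<^sup>+x. X j x * indicator K x \<partial>lborel)"
      by (rule nn_integral_liminf) measurable
    ultimately have "(\<integral>\<^sup>+x. liminf (\<lambda>j. X j x * indicator K x) \<partial>lborel) = 0" by simp
    then have "AE x in lborel. liminf (\<lambda>j. X j x * indicator K x) = 0"
      by (subst (asm) nn_integral_0_iff_AE) measurable
    then show "AE x in lborel. x \<in> T i \<inter> cball 0 (real m) \<longrightarrow> liminf (\<lambda>j. X j x) = 0"
      unfolding K_def[symmetric] by eventually_elim auto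
  qed
  ultimately show ?thesis
  proof eventually_elim
    case (elim x)
    show ?case
    proof (intro impI allI)
      fix e \<delta> :: real
      assume fx: "f x = 0" and e: "0 < e" and d: "0 < \<delta>"
      then obtain i where i: "x \<in> T i" using elim(1) by (auto simp: Z_def)
      obtain m :: nat where "norm x \<le> real m" using real_arch_simple by blast
      then have lim: "liminf (\<lambda>j. X j x) = 0" using elim(2) i by auto
      have "\<exists>j. 1 / real (Suc j) < \<delta> \<and> X j x < ennreal e"
      proof (rule ccontr)
        assume neg: "\<not> ?thesis"
        have "(\<lambda>j. 1 / real (Suc j)) \<longlonglongrightarrow> 0"
          using LIMSEQ_inverse_real_of_nat by (simp add: inverse_eq_divide)
        then have "\<forall>\<^sub>F j in sequentially. 1 / real (Suc j) < \<delta>"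
          using d by (rule order_tendstoD)
        then have "\<forall>\<^sub>F j in sequentially. ennreal e \<le> X j x"
          by eventually_elim (use neg not_le in blast)
        then have "ennreal e \<le> liminf (\<lambda>j. X j x)" by (rule Liminf_bounded)
        then show False using lim e by simp
      qed
      then obtain j where j: "1 / real (Suc j) < \<delta>" "X j x < ennreal e" by blast
      have "X j x = ennreal (LBINT y. f y * tail_weight s (1 / real (Suc j)) (y - x))"
        unfolding X_def using f s
        by (intro nn_integral_eq_integral tail_integrable_weight) auto
      then have "ennreal (LBINT y. f y * tail_weight s (1 / real (Suc j)) (y - x)) < ennreal e"
        using j(2) by simp
      then have "(LBINT y. f y * tail_weight s (1 / real (Suc j)) (y - x)) < e"
        by (subst (asm) ennreal_less_iff) (use f in \<open>auto intro!: integral_nonneg_AE\<close>)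
      then show "\<exists>r. 0 < r \<and> r < \<delta> \<and> (LBINT y. f y * tail_weight s r (y - x)) < e"
        using j(1) by (intro exI[of _ "1 / real (Suc j)"]) auto
    qed
  qed
qed

section \<open>From mollifications back to the function\<close>

lemma tail_integrable_pos_part:
  assumes "tail_integrable s f" "0 < s"
  shows "tail_integrable s (\<lambda>y. max 0 (f y - k))" "tail_integrable s (\<lambda>y. max 0 (k - f y))"
proof -
  have [measurable]: "f \<in> borel_measurable borel" using assms by measurable
  show "tail_integrable s (\<lambda>y. max 0 (f y - k))"
    by (rule tail_integrable_bound[of s "\<lambda>y. f y - k"])
      (use assms in \<open>auto intro: tail_integrable_diff tail_integrable_const\<close>)
  show "tail_integrable s (\<lambda>y. max 0 (k - f y))"
    by (rule tail_integrable_bound[of s "\<lambda>y. k - f y"])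
      (use assms in \<open>auto intro: tail_integrable_diff tail_integrable_const\<close>)
qed

text \<open>If u(x) < q < k, the positive part of u - q vanishes at x, so its tail averages, and
  with them its mollifications, fall below k - q at some small radius. That contradicts the lower
  bound k at this radius. Rational q keeps the number of exceptional null sets countable.\<close>

lemma AE_ge_of_mollify_ge:
  fixes u :: "'a::euclidean_space \<Rightarrow> real"
  assumes u: "tail_integrable s u" and s: "0 < s" and e0: "0 < \<epsilon>\<^sub>0"
    and ge: "\<And>\<epsilon> x. 0 < \<epsilon> \<Longrightarrow> \<epsilon> < \<epsilon>\<^sub>0 \<Longrightarrow> x \<in> U \<Longrightarrow> k \<le> mollify u \<epsilon> x"
  shows "AE x in lborel. x \<in> U \<longrightarrow> k \<le> u x"
proof -
  obtain C where C: "0 < C" "\<And>\<epsilon> (y::'a). 0 < \<epsilon> \<Longrightarrow> mollifier \<epsilon> y \<le> C * tail_weight s \<epsilon> y"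
    by (rule mollifier_le_tail_weight[OF s, where 'a = 'a]) blast
  define f where "f q y = max 0 (u y - of_rat q)" for q y
  have f: "tail_integrable s (f q)" "0 \<le> f q y" for q y
    unfolding f_def using tail_integrable_pos_part[OF u s] by auto
  have "AE x in lborel. \<forall>q. f q x = 0 \<longrightarrow>
    (\<forall>e>0. \<forall>\<delta>>0. \<exists>r. 0 < r \<and> r < \<delta> \<and> (LBINT y. f q y * tail_weight s r (y - x)) < e)"
    unfolding AE_all_countable using AE_tail_weight_average_zero[OF f s] by blast
  then show ?thesis
  proof eventually_elim
    case (elim x)
    show ?case
    proof (intro impI, rule ccontr)
      assume x: "x \<in> U" and "\<not> k \<le> u x"
      then obtain q where q: "u x < of_rat q" "of_rat q < k" using of_rat_dense[of "u x" k] by auto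
      have "f q x = 0" using q by (simp add: f_def)
      moreover have "0 < (k - of_rat q) / C" using q C by simp
      ultimately obtain r where r: "0 < r" "r < \<epsilon>\<^sub>0"
        "(LBINT y. f q y * tail_weight s r (y - x)) < (k - of_rat q) / C"
        using elim e0 by blast
      have "k - of_rat q \<le> mollify u r x - of_rat q" using ge[OF r(1,2) x] by simp
      also have "\<dots> = mollify (\<lambda>y. u y - of_rat q) r x"
        by (rule mollify_diff_const(1)[OF u s r(1), symmetric])
      also have "\<dots> \<le> mollify (f q) r x"
        using u s r f by (intro mollify_mono tail_integrable_diff tail_integrable_const) (auto simp: f_def)
      also have "\<dots> \<le> (LBINT y. C * (f q y * tail_weight s r (y - x)))"
        unfolding mollify_def
      proof (rule integral_mono)
        show "integrable lborel (\<lambda>y. f q y * mollifier r (y - x))"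
          using f s r by (intro mollify_integrable)
        show "integrable lborel (\<lambda>y. C * (f q y * tail_weight s r (y - x)))"
          using f s r by (intro integrable_mult_right tail_integrable_weight)
        fix y
        have "f q y * mollifier r (y - x) \<le> f q y * (C * tail_weight s r (y - x))"
          using C(2)[OF r(1)] f by (intro mult_left_mono) auto
        then show "f q y * mollifier r (y - x) \<le> C * (f q y * tail_weight s r (y - x))"
          by (simp add: mult_ac)
      qed
      also have "\<dots> < k - of_rat q" using r(3) C(1) by (simp add: field_simps)
      finally show False by simp
    qed
  qed
qed

text \<open>Convexity bounds the positive part of k - mollify u by the mollification of the positive
  part of k - u, and for \<epsilon> <= r the weight varies by at most 2^N over the mollification
  scale. The error term thus becomes independent of \<epsilon>.\<close>

lemma mollify_negative_part:
  fixes u :: "'a::euclidean_space \<Rightarrow> real"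
  assumes u: "tail_integrable s u" and s: "0 < s" and e: "0 < \<epsilon>" "\<epsilon> \<le> r"
  shows "(LBINT y. max 0 (k - mollify u \<epsilon> y) * tail_weight s r (y - x0))
    \<le> 2 powr (real DIM('a) + 2 * s) * (LBINT y. max 0 (k - u y) * tail_weight s r (y - x0))"
proof -
  define N where "N = real DIM('a) + 2 * s"
  define g where "g y = max 0 (k - u y)" for y
  have r: "0 < r" using e by simp
  have g: "tail_integrable s g" "\<And>y. 0 \<le> g y"
    unfolding g_def using tail_integrable_pos_part[OF u s] by auto
  have [measurable]: "u \<in> borel_measurable borel" using u by measurable
  have v: "tail_integrable s (mollify u \<epsilon>)" by (rule mollify_tail_integrable[OF u s e(1)])
  have le: "max 0 (k - mollify u \<epsilon> x) \<le> mollify g \<epsilon> x" for x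
  proof -
    have "k - mollify u \<epsilon> x = mollify (\<lambda>y. k - u y) \<epsilon> x"
      by (rule mollify_diff_const(2)[OF u s e(1), symmetric])
    also have "\<dots> \<le> mollify g \<epsilon> x"
      using u s e g by (intro mollify_mono tail_integrable_diff tail_integrable_const) (auto simp: g_def)
    finally show ?thesis using mollify_nonneg[OF e(1) g(2)] by simp
  qed
  have "ennreal (LBINT y. max 0 (k - mollify u \<epsilon> y) * tail_weight s r (y - x0))
      = (\<integral>\<^sup>+y. ennreal (max 0 (k - mollify u \<epsilon> y) * tail_weight s r (y - x0)) \<partial>lborel)"
    by (intro nn_integral_eq_integral[symmetric] tail_integrable_weight tail_integrable_pos_part v s r) auto
  also have "\<dots> \<le> (\<integral>\<^sup>+y. ennreal (mollify g \<epsilon> y * tail_weight s r (y - x0)) \<partial>lborel)"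
    using le by (intro nn_integral_mono ennreal_leI mult_right_mono) auto
  also have "\<dots> \<le> (\<integral>\<^sup>+y. ennreal (g y * (2 powr N * tail_weight s r (y - x0))) \<partial>lborel)"
  proof (rule nn_integral_mollify_le[OF g s e(1)])
    fix x y :: 'a assume "norm (y - x) < \<epsilon>"
    then have "norm (x - y) / r \<le> 1" using e r by (simp add: norm_minus_commute)
    then have "(1 + norm ((x - x0) - (y - x0)) / r) powr N \<le> 2 powr N"
      using r s by (intro powr_mono2) (auto simp: N_def)
    then have "(1 + norm ((x - x0) - (y - x0)) / r) powr N * tail_weight s r (y - x0) \<le> 2 powr N * tail_weight s r (y - x0)"
      by (intro mult_right_mono) auto
    then show "tail_weight s r (x - x0) \<le> 2 powr N * tail_weight s r (y - x0)"
      using tail_weight_shift[OF s r, of "x - x0" "y - x0"] by (simp only: N_def)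
  qed auto
  also have "\<dots> = (\<integral>\<^sup>+y. ennreal (2 powr N * (g y * tail_weight s r (y - x0))) \<partial>lborel)"
    by (simp add: mult_ac)
  also have "\<dots> = ennreal (2 powr N * (LBINT y. g y * tail_weight s r (y - x0)))"
    using g s r by (subst nn_integral_eq_integral) (auto intro!: integrable_mult_right tail_integrable_weight)
  finally show ?thesis
    using g by (subst (asm) ennreal_le_iff) (auto simp: g_def[symmetric] N_def intro!: mult_nonneg_nonneg integral_nonneg_AE)
qed

text \<open>Once the error term is expressed through \<open>u\<close>, the bound for the
  mollifications has a right-hand side free of \<epsilon> and passes to almost every point; the
  constant only gains the factor 2^N.\<close>

lemma local_ess_lower_bound:
  fixes s :: real
  assumes s: "0 < s" "s < 1"
  obtains C where "0 < C"
    "\<And>u (x0::'a::euclidean_space) r k \<epsilon>\<^sub>0. \<lbrakk>tail_integrable s u; 0 < r; 0 < \<epsilon>\<^sub>0;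
        \<And>\<epsilon> x. 0 < \<epsilon> \<Longrightarrow> \<epsilon> < \<epsilon>\<^sub>0 \<Longrightarrow> x \<in> ball x0 r \<Longrightarrow> pv_superharmonic_at s (mollify u \<epsilon>) x\<rbrakk> \<Longrightarrow>
      AE x in lborel. x \<in> ball x0 (r / 2) \<longrightarrow>
        k - C * (LBINT y. max 0 (k - u y) * tail_weight s r (y - x0)) \<le> u x"
proof -
  define N where "N = real DIM('a) + 2 * s"
  obtain C where C: "0 < C"
    "\<And>v (x0::'a) r k x. \<lbrakk>tail_integrable s v; 0 < r; continuous_on (cball x0 r) v;
        \<And>x. x \<in> ball x0 r \<Longrightarrow> pv_superharmonic_at s v x; x \<in> ball x0 (r / 2)\<rbrakk> \<Longrightarrow>
      k - C * (LBINT y. max 0 (k - v y) * tail_weight s r (y - x0)) \<le> v x"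
    by (rule local_lower_bound[OF s, where 'a = 'a]) blast
  have main: "AE x in lborel. x \<in> ball x0 (r / 2) \<longrightarrow>
        k - C * 2 powr N * (LBINT y. max 0 (k - u y) * tail_weight s r (y - x0)) \<le> u x"
    if u: "tail_integrable s u" and r: "0 < r" and e0: "0 < \<epsilon>\<^sub>0"
      and sup: "\<And>\<epsilon> x. 0 < \<epsilon> \<Longrightarrow> \<epsilon> < \<epsilon>\<^sub>0 \<Longrightarrow> x \<in> ball x0 r \<Longrightarrow> pv_superharmonic_at s (mollify u \<epsilon>) x"
    for u and x0 :: 'a and r k \<epsilon>\<^sub>0
  proof (rule AE_ge_of_mollify_ge[OF u s(1), where \<epsilon>\<^sub>0 = "min \<epsilon>\<^sub>0 r"])
    show "0 < min \<epsilon>\<^sub>0 r" using e0 r by simp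
    fix \<epsilon> x assume e: "0 < \<epsilon>" "\<epsilon> < min \<epsilon>\<^sub>0 r" and x: "x \<in> ball x0 (r / 2)"
    have "C * (LBINT y. max 0 (k - mollify u \<epsilon> y) * tail_weight s r (y - x0))
        \<le> C * (2 powr N * (LBINT y. max 0 (k - u y) * tail_weight s r (y - x0)))"
      unfolding N_def using e C(1) by (intro mult_left_mono mollify_negative_part u s) auto
    moreover have "k - C * (LBINT y. max 0 (k - mollify u \<epsilon> y) * tail_weight s r (y - x0)) \<le> mollify u \<epsilon> x"
      using e by (intro C(2)[OF _ r _ _ x] mollify_tail_integrable mollify_continuous[OF u] u s sup) auto
    ultimately show "k - C * 2 powr N * (LBINT y. max 0 (k - u y) * tail_weight s r (y - x0)) \<le> mollify u \<epsilon> x"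
      by (simp add: mult.assoc)
  qed
  have "0 < C * 2 powr N" using C(1) by simp
  then show ?thesis using main by (rule that)
qed

text \<open>For m < q < u(x) with q rational, the positive part of q - u vanishes at x, so at some
  small radius its weighted integral is below (q - m)/C, and the local bound with k = q exceeds m
  near x. The second claim needs no smallness and so holds at every point: with k = 0 and any
  admissible radius the bound is some finite number.\<close>

lemma AE_ess_lower_semicontinuous:
  fixes u :: "'a::euclidean_space \<Rightarrow> real"
  assumes s: "0 < s" "s < 1" and u: "tail_integrable s u" and \<Omega>: "open \<Omega>"
    and sup: "\<And>\<epsilon> x. 0 < \<epsilon> \<Longrightarrow> cball x (2 * \<epsilon>) \<subseteq> \<Omega> \<Longrightarrow> pv_superharmonic_at s (mollify u \<epsilon>) x"
  shows "AE x in lborel. x \<in> \<Omega> \<longrightarrow>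
      (\<forall>m<u x. \<exists>r>0. ball x r \<subseteq> \<Omega> \<and> (AE y in lborel. y \<in> ball x r \<longrightarrow> m \<le> u y))"
    and "x0 \<in> \<Omega> \<Longrightarrow> \<exists>m. \<exists>r>0. ball x0 r \<subseteq> \<Omega> \<and> (AE y in lborel. y \<in> ball x0 r \<longrightarrow> m \<le> u y)"
proof -
  obtain C where C: "0 < C"
    "\<And>u (x0::'a) r k \<epsilon>\<^sub>0. \<lbrakk>tail_integrable s u; 0 < r; 0 < \<epsilon>\<^sub>0;
        \<And>\<epsilon> x. 0 < \<epsilon> \<Longrightarrow> \<epsilon> < \<epsilon>\<^sub>0 \<Longrightarrow> x \<in> ball x0 r \<Longrightarrow> pv_superharmonic_at s (mollify u \<epsilon>) x\<rbrakk> \<Longrightarrow>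
      AE x in lborel. x \<in> ball x0 (r / 2) \<longrightarrow>
        k - C * (LBINT y. max 0 (k - u y) * tail_weight s r (y - x0)) \<le> u x"
    by (rule local_ess_lower_bound[OF s, where 'a = 'a]) blast
  have est: "AE x in lborel. x \<in> ball x0 (r / 2) \<longrightarrow>
        k - C * (LBINT y. max 0 (k - u y) * tail_weight s r (y - x0)) \<le> u x"
    if r: "0 < r" "cball x0 (2 * r) \<subseteq> \<Omega>" for r x0 k
  proof (rule C(2)[OF u r(1), of "r / 2"])
    show "0 < r / 2" using r by simp
    fix \<epsilon> x assume e: "0 < \<epsilon>" "\<epsilon> < r / 2" and "x \<in> ball x0 r"
    then have "dist x x0 + 2 * \<epsilon> \<le> 2 * r" by (simp add: dist_commute)
    then have "cball x (2 * \<epsilon>) \<subseteq> cball x0 (2 * r)"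
      by (intro cball_subset_cball_iff[THEN iffD2] disjI1)
    from order_trans[OF this r(2)] show "pv_superharmonic_at s (mollify u \<epsilon>) x" by (rule sup[OF e(1)])
  qed
  have room: "\<exists>R>0. cball x (2 * R) \<subseteq> \<Omega>" if x: "x \<in> \<Omega>" for x
  proof -
    obtain R where "0 < R" "cball x R \<subseteq> \<Omega>"  using \<Omega> x open_contains_cball by blast
    then show ?thesis by (intro exI[of _ "R / 2"]) auto
  qed
  define f where "f q y = max 0 (of_rat q - u y)" for q y
  have f: "tail_integrable s (f q)" "0 \<le> f q y" for q y
    unfolding f_def using tail_integrable_pos_part[OF u s(1)] by auto
  have "AE x in lborel. \<forall>q. f q x = 0 \<longrightarrow>
    (\<forall>e>0. \<forall>\<delta>>0. \<exists>r. 0 < r \<and> r < \<delta> \<and> (LBINT y. f q y * tail_weight s r (y - x)) < e)"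
    unfolding AE_all_countable using AE_tail_weight_average_zero[OF f s(1)] by blast
  then show "AE x in lborel. x \<in> \<Omega> \<longrightarrow>
      (\<forall>m<u x. \<exists>r>0. ball x r \<subseteq> \<Omega> \<and> (AE y in lborel. y \<in> ball x r \<longrightarrow> m \<le> u y))"
  proof eventually_elim
    case (elim x)
    show ?case
    proof (intro impI allI)
      fix m assume x: "x \<in> \<Omega>" and "m < u x"
      then obtain q where q: "m < of_rat q" "of_rat q < u x" using of_rat_dense by blast
      obtain R where R: "0 < R" "cball x (2 * R) \<subseteq> \<Omega>" using room[OF x] by blast
      have "f q x = 0" using q by (simp add: f_def)
      moreover have "0 < (of_rat q - m) / C" using q C by simp
      ultimately obtain r where r: "0 < r" "r < R"
        "(LBINT y. f q y * tail_weight s r (y - x)) < (of_rat q - m) / C"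
        using elim R(1) by blast
      have sub: "cball x (2 * r) \<subseteq> \<Omega>"
        using r R by (intro order_trans[OF subset_cball R(2)]) auto
      have "C * (LBINT y. f q y * tail_weight s r (y - x)) < of_rat q - m"
        using r(3) C(1) by (simp add: field_simps)
      then have "m \<le> of_rat q - C * (LBINT y. max 0 (of_rat q - u y) * tail_weight s r (y - x))"
        by (simp add: f_def)
      with est[OF r(1) sub, of "of_rat q"] have "AE y in lborel. y \<in> ball x (r / 2) \<longrightarrow> m \<le> u y"
        by (auto elim!: eventually_mono)
      moreover have "ball x (r / 2) \<subseteq> \<Omega>"
        using r by (intro order_trans[OF _ sub]) auto
      ultimately show "\<exists>r>0. ball x r \<subseteq> \<Omega> \<and> (AE y in lborel. y \<in> ball x r \<longrightarrow> m \<le> u y)"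
        using r by (intro exI[of _ "r / 2"]) auto
    qed
  qed
  show "\<exists>m. \<exists>r>0. ball x0 r \<subseteq> \<Omega> \<and> (AE y in lborel. y \<in> ball x0 r \<longrightarrow> m \<le> u y)" if x0: "x0 \<in> \<Omega>"
  proof -
    obtain R where R: "0 < R" "cball x0 (2 * R) \<subseteq> \<Omega>" using room[OF x0] by blast
    have "ball x0 (R / 2) \<subseteq> \<Omega>"
      using R by (intro order_trans[OF _ R(2)]) auto
    then show ?thesis using est[OF R, of 0] R(1) by (intro exI[of _ "0 - _"] exI[of _ "R / 2"] conjI) auto
  qed
qed

text \<open>Since \<open>u\<close> is not almost everywhere m, some mass of u - m sits at positive
  distance from \<open>x0\<close>. Mollification at scale below r retains a fixed fraction of its
  weighted amount outside 2r, so the paraboloid bound gives a gain independent of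
  \<epsilon>.\<close>

lemma ess_strict_minimum:
  fixes u :: "'a::euclidean_space \<Rightarrow> real"
  assumes s: "0 < s" "s < 1" and u: "tail_integrable s u" and \<Omega>: "open \<Omega>"
    and sup: "\<And>\<epsilon> x. 0 < \<epsilon> \<Longrightarrow> cball x (2 * \<epsilon>) \<subseteq> \<Omega> \<Longrightarrow> pv_superharmonic_at s (mollify u \<epsilon>) x"
    and x0: "x0 \<in> \<Omega>" and m: "AE y in lborel. m \<le> u y" and nconst: "\<not> (AE y in lborel. u y = m)"
  shows "\<exists>\<kappa>>0. \<exists>r>0. ball x0 r \<subseteq> \<Omega> \<and> (AE y in lborel. y \<in> ball x0 r \<longrightarrow> m + \<kappa> \<le> u y)"
proof -
  define N where "N = real DIM('a) + 2 * s"
  define g where "g y = max 0 (u y - m)" for y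
  have g: "tail_integrable s g" "\<And>y. 0 \<le> g y"
    unfolding g_def using tail_integrable_pos_part[OF u s(1)] by auto
  have [measurable]: "u \<in> borel_measurable borel" "g \<in> borel_measurable borel" using u g by measurable
  \<comment> \<open>The complement of \<open>x0\<close> is a countable union of exteriors of balls,
    and the point itself is null, so u = m almost everywhere on each exterior would mean u = m
    almost everywhere.\<close>
  have "\<exists>i. \<not> (AE y in lborel. 1 / real (Suc i) \<le> norm (y - x0) \<longrightarrow> u y = m)"
  proof (rule ccontr)
    assume "\<not> ?thesis"
    then have "AE y in lborel. \<forall>i. 1 / real (Suc i) \<le> norm (y - x0) \<longrightarrow> u y = m"
      unfolding AE_all_countable by blast
    moreover have "AE y in lborel. y \<noteq> x0" by (rule AE_lborel_singleton)
    ultimately have "AE y in lborel. u y = m"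
    proof eventually_elim
      case (elim y)
      then have "0 < norm (y - x0)" by simp
      then obtain i where "inverse (real (Suc i)) < norm (y - x0)" using reals_Archimedean by blast
      then have "1 / real (Suc i) \<le> norm (y - x0)" by (simp add: inverse_eq_divide)
      with elim(1) show ?case by blast
    qed
    with nconst show False by contradiction
  qed
  then obtain i where i: "\<not> (AE y in lborel. 1 / real (Suc i) \<le> norm (y - x0) \<longrightarrow> u y = m)" by blast
  obtain R where R: "0 < R" "cball x0 R \<subseteq> \<Omega>"  using \<Omega> x0 open_contains_cball by blast
  \<comment> \<open>3r <= 1/(i+1) puts the surviving mass outside 3r, so after shifts by less than r
    it is still outside 2r. 3r <= R leaves room for r + 2\<epsilon> inside \<Omega> when \<epsilon>
    < r.\<close>
  define r where "r = min (R / 3) (1 / (3 * real (Suc i)))"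
  have r: "0 < r" "3 * r \<le> R" "3 * r \<le> 1 / real (Suc i)"
    using R by (auto simp: r_def min_def field_simps)
  let ?w' = "\<lambda>y. tail_weight s r (y - x0) * indicator {y. 3 * r \<le> norm (y - x0)} y"
  let ?w = "\<lambda>y. 2 powr N * (tail_weight s r (y - x0) * indicator {y. 2 * r \<le> norm (y - x0)} y)"
  have intg: "integrable lborel (\<lambda>y. g y * ?w' y)"
  proof -
    have "integrable lborel (\<lambda>y. g y * tail_weight s r (y - x0))"
      using g s r by (intro tail_integrable_weight)
    then have "integrable lborel (\<lambda>y. g y * tail_weight s r (y - x0) * indicator {y. 3 * r \<le> norm (y - x0)} y)"
      by (intro integrable_real_mult_indicator) measurable
    then show ?thesis by (simp only: mult.assoc)
  qed
  define J where "J = (LBINT y. g y * ?w' y)"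
  have J: "0 < J"
  proof -
    have "0 \<le> J" unfolding J_def using g by (intro integral_nonneg_AE AE_I2 mult_nonneg_nonneg) auto
    moreover have "J \<noteq> 0"
    proof
      assume "J = 0"
      then have "AE y in lborel. g y * ?w' y = 0"
        unfolding J_def using integral_nonneg_eq_0_iff_AE[OF intg] g by auto
      with m have "AE y in lborel. 1 / real (Suc i) \<le> norm (y - x0) \<longrightarrow> u y = m"
      proof eventually_elim
        case (elim y)
        then show ?case using r tail_weight_pos[OF r(1), of s "y - x0"] by (auto simp: g_def)
      qed
      with i show False by contradiction
    qed
    ultimately show ?thesis by simp
  qed
  \<comment> \<open>The mass is lowered by 2^N in advance, the price of shifting the weight by less
    than r.\<close>
  obtain \<kappa> where k: "0 < \<kappa>"
    "\<And>v m x. \<lbrakk>tail_integrable s v; continuous_on (cball x0 r) v;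
        \<And>x. x \<in> ball x0 r \<Longrightarrow> pv_superharmonic_at s v x; \<And>y. m \<le> v y;
        J / 2 powr N \<le> (LBINT y. (v y - m) * tail_weight s r (y - x0) * indicator {y. 2 * r \<le> norm (y - x0)} y);
        x \<in> ball x0 (r / 2)\<rbrakk> \<Longrightarrow> m + \<kappa> \<le> v x"
    by (rule positive_lower_bound[OF s r(1), of "J / 2 powr N" x0]) (use J in auto)
  have "AE y in lborel. y \<in> ball x0 (r / 2) \<longrightarrow> m + \<kappa> \<le> u y"
  proof (rule AE_ge_of_mollify_ge[OF u s(1), where \<epsilon>\<^sub>0 = r])
    fix \<epsilon> x assume e: "0 < \<epsilon>" "\<epsilon> < r" and x: "x \<in> ball x0 (r / 2)"
    have v: "tail_integrable s (mollify u \<epsilon>)"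
      using e by (intro mollify_tail_integrable u s) auto
    \<comment> \<open>\<open>g\<close> changes u - m on a null set only. Its pointwise nonnegativity
      gives m <= mollify u at every point, as the paraboloid bound demands.\<close>
    have vg: "mollify g \<epsilon> y = mollify u \<epsilon> y - m" for y
    proof -
      have "AE y in lborel. g y \<le> u y - m" "AE y in lborel. u y - m \<le> g y"
        using m by (auto simp: g_def)
      then have "mollify g \<epsilon> y = mollify (\<lambda>y. u y - m) \<epsilon> y"
        using g u s e by (intro antisym mollify_mono_AE[of s] tail_integrable_diff tail_integrable_const) auto
      then show ?thesis
        using mollify_diff_const(1)[OF u s(1) e(1)] by simp
    qed
    have g0: "0 \<le> mollify g \<epsilon> y" for y using e(1) g(2) by (rule mollify_nonneg)
    show "m + \<kappa> \<le> mollify u \<epsilon> x"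
    proof (rule k(2)[OF v _ _ _ _ x])
      show "continuous_on (cball x0 r) (mollify u \<epsilon>)" by (rule mollify_continuous[OF u s(1) e(1)])
      show "m \<le> mollify u \<epsilon> y" for y
        using vg[of y] g0[of y] by simp
      fix y assume "y \<in> ball x0 r"
      then have "dist y x0 + 2 * \<epsilon> \<le> R" using e r by (simp add: dist_commute)
      then have "cball y (2 * \<epsilon>) \<subseteq> cball x0 R"
        by (intro cball_subset_cball_iff[THEN iffD2] disjI1)
      from order_trans[OF this R(2)] show "pv_superharmonic_at s (mollify u \<epsilon>) y" by (rule sup[OF e(1)])
    next
      have "ennreal J = (\<integral>\<^sup>+y. ennreal (g y * ?w' y) \<partial>lborel)"
        unfolding J_def using g by (intro nn_integral_eq_integral[symmetric] intg AE_I2 mult_nonneg_nonneg) auto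
      also have "\<dots> \<le> (\<integral>\<^sup>+y. ennreal (mollify g \<epsilon> y * ?w y) \<partial>lborel)"
      proof (rule nn_integral_mollify_ge[OF g s(1) e(1)])
        fix y z :: 'a assume yz: "norm (z - y) < \<epsilon>"
        show "?w' z \<le> ?w y"
        proof (cases "3 * r \<le> norm (z - x0)")
          case True
          have "norm (z - x0) \<le> norm (z - y) + norm (y - x0)"
            using norm_triangle_ineq[of "z - y" "y - x0"] by simp
          then have 2: "2 * r \<le> norm (y - x0)" using True yz e by linarith
          have "norm (z - y) / r \<le> 1" using yz e r by simp
          then have "(1 + norm ((z - x0) - (y - x0)) / r) powr N \<le> 2 powr N"
            using r s by (intro powr_mono2) (auto simp: N_def)
          then have "(1 + norm ((z - x0) - (y - x0)) / r) powr N * tail_weight s r (y - x0) \<le> 2 powr N * tail_weight s r (y - x0)"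
            by (intro mult_right_mono) auto
          then have "tail_weight s r (z - x0) \<le> 2 powr N * tail_weight s r (y - x0)"
            using tail_weight_shift[OF s(1) r(1), of "z - x0" "y - x0"] unfolding N_def by linarith
          then show ?thesis using True 2 by simp
        qed simp
      qed auto
      also have "\<dots> = (\<integral>\<^sup>+y. ennreal (2 powr N * ((mollify u \<epsilon> y - m) * tail_weight s r (y - x0) * indicator {y. 2 * r \<le> norm (y - x0)} y)) \<partial>lborel)"
        by (simp add: vg mult_ac)
      also have "\<dots> = ennreal (2 powr N * (LBINT y. (mollify u \<epsilon> y - m) * tail_weight s r (y - x0) * indicator {y. 2 * r \<le> norm (y - x0)} y))"
      proof (subst nn_integral_eq_integral)
        have "integrable lborel (\<lambda>y. (mollify u \<epsilon> y - m) * tail_weight s r (y - x0))"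
          using v s r by (intro tail_integrable_weight tail_integrable_diff tail_integrable_const) auto
        then show "integrable lborel (\<lambda>y. 2 powr N * ((mollify u \<epsilon> y - m) * tail_weight s r (y - x0) * indicator {y. 2 * r \<le> norm (y - x0)} y))"
          by (intro integrable_mult_right integrable_real_mult_indicator) measurable
        have "0 \<le> mollify u \<epsilon> y - m" for y using vg[of y] g0[of y] by simp
        then show "AE y in lborel. 0 \<le> 2 powr N * ((mollify u \<epsilon> y - m) * tail_weight s r (y - x0) * indicator {y. 2 * r \<le> norm (y - x0)} y)"
          by (intro AE_I2 mult_nonneg_nonneg) auto
      qed simp
      finally have "J \<le> 2 powr N * (LBINT y. (mollify u \<epsilon> y - m) * tail_weight s r (y - x0) * indicator {y. 2 * r \<le> norm (y - x0)} y)"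
        unfolding ennreal_le_iff2 using J by linarith
      then show "J / 2 powr N \<le> (LBINT y. (mollify u \<epsilon> y - m) * tail_weight s r (y - x0) * indicator {y. 2 * r \<le> norm (y - x0)} y)"
        by (simp add: divide_le_eq mult.commute)
    qed
  qed (use r in auto)
  moreover have "ball x0 (r / 2) \<subseteq> \<Omega>"
    using r R by (intro order_trans[OF _ R(2)]) auto
  ultimately show ?thesis using k(1) r(1) by (intro exI[of _ \<kappa>] exI[of _ "r / 2"] conjI) auto
qed

section \<open>From the distributional to the pointwise inequality\<close>

abbreviation lborel2 :: "('a \<times> 'a::euclidean_space) measure" where
  "lborel2 \<equiv> lborel \<Otimes>\<^sub>M lborel"

text \<open>Null sets of either factor are null strips in the product; this carries one-variable
  identities into double integrals.\<close>

lemma AE_lborel_pair: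
  assumes "AE y in lborel. P (y :: 'a::euclidean_space)"
  shows "AE p in lborel. P (fst p) \<and> P (snd (p :: 'a \<times> 'a))"
proof -
  obtain N where N: "\<And>y. y \<in> space lborel - N \<Longrightarrow> P y" "N \<in> null_sets lborel"
    by (rule AE_E3[OF assms]) blast
  have "AE p in lborel2. p \<notin> N \<times> UNIV \<union> UNIV \<times> N"
  proof (rule AE_not_in, rule null_sets.Un)
    show "N \<times> UNIV \<in> null_sets (lborel2 :: ('a \<times> 'a) measure)"
      by (rule lborel.times_in_null_sets1[OF N(2)]) simp
    show "UNIV \<times> N \<in> null_sets (lborel2 :: ('a \<times> 'a) measure)"
      by (rule lborel.times_in_null_sets2[OF _ N(2)]) simp
  qed
  then show ?thesis
    unfolding lborel_prod
  proof eventually_elim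
    case (elim p)
    then show ?case using N(1)[of "fst p"] N(1)[of "snd p"] by (cases p) auto
  qed
qed

section \<open>Integrability on the product space\<close>

lemma integrable_pair_mult:
  fixes f g :: "'a::euclidean_space \<Rightarrow> real"
  assumes f: "integrable lborel f" and g: "integrable lborel g"
  shows "integrable (lborel2) (\<lambda>(y, z). f y * g z)"
proof (rule lborel_pair.Fubini_integrable)
  have [measurable]: "f \<in> borel_measurable borel" "g \<in> borel_measurable borel"
    using f g by (auto dest: borel_measurable_integrable)
  show "(\<lambda>(y, z). f y * g z) \<in> borel_measurable (lborel2)" by measurable
  show "integrable lborel (\<lambda>x. \<integral>y. norm (case (x, y) of (y, z) \<Rightarrow> f y * g z) \<partial>lborel)"
    using f by (simp add: abs_mult)
  show "AE x in lborel. integrable lborel (\<lambda>y. case (x, y) of (y, z) \<Rightarrow> f y * g z)"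
    using g by simp
qed

lemma integrable_lborel_reflect:
  fixes g :: "'a::euclidean_space \<Rightarrow> real"
  assumes g: "integrable lborel g"
  shows "integrable lborel (\<lambda>z. g (y - z))"
proof -
  have [measurable]: "g \<in> borel_measurable borel" using g by (auto dest: borel_measurable_integrable)
  have "integrable (distr lborel borel uminus) g" using g by (simp add: distr_uminus_lborel)
  then have "integrable lborel (\<lambda>z. g (- z))" by (subst (asm) integrable_distr_eq) auto
  then have "integrable lborel (\<lambda>z. g (- (- y + z)))"
    by (subst integrable_lborel_translate_iff[where f = "\<lambda>z. g (- z)"]) auto
  then show ?thesis by simp
qed

lemma integrable_pair_convolution:
  fixes f g :: "'a::euclidean_space \<Rightarrow> real"
  assumes f: "integrable lborel f" and g: "integrable lborel g"
  shows "integrable (lborel2) (\<lambda>(y, z). f y * g (y - z))"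
proof (rule lborel_pair.Fubini_integrable)
  have [measurable]: "f \<in> borel_measurable borel" "g \<in> borel_measurable borel"
    using f g by (auto dest: borel_measurable_integrable)
  show "(\<lambda>(y, z). f y * g (y - z)) \<in> borel_measurable (lborel2)" by measurable
  have "(LBINT z. \<bar>g (y - z)\<bar>) = (LBINT z. \<bar>g (- z)\<bar>)" for y
    using integral_lborel_translate[of "\<lambda>z. \<bar>g (y - z)\<bar>" y] by simp
  then show "integrable lborel (\<lambda>y. \<integral>z. norm (case (y, z) of (y, z) \<Rightarrow> f y * g (y - z)) \<partial>lborel)"
    using f by (simp add: abs_mult)
  show "AE y in lborel. integrable lborel (\<lambda>z. case (y, z) of (y, z) \<Rightarrow> f y * g (y - z))"
    using integrable_lborel_reflect[OF g] by simp
qed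

context
  fixes s \<epsilon> :: real and x :: "'a::euclidean_space" and u :: "'a \<Rightarrow> real"
  assumes s: "0 < s" "s < 1" and u: "tail_integrable s u" and e: "0 < \<epsilon>"
begin

private abbreviation \<phi> :: "'a \<Rightarrow> real" where "\<phi> y \<equiv> mollifier \<epsilon> (y - x)"

private abbreviation K :: "'a \<Rightarrow> real" where "K \<equiv> frac_kernel s"

private lemma u_meas [measurable]: "u \<in> borel_measurable borel"
  using u by measurable

private lemma phi_nonneg: "0 \<le> \<phi> y"
  using e by (rule mollifier_nonneg)

private lemma phi_support: "\<phi> y \<noteq> 0 \<Longrightarrow> norm (y - x) < \<epsilon>"
  using mollifier_support[OF e] by blast

text \<open>For y in the support of the mollifier and |y - z| >= \<rho>, 1 + |z| is at most a
  constant times |y - z|. The kernel is then bounded by a function of z alone, which separates the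
  variables.\<close>

private lemma kernel_bound:
  assumes "0 < \<rho>"
  obtains c where "0 < c"
    "\<And>y z. norm (y - x) < \<epsilon> \<Longrightarrow> \<rho> \<le> norm (y - z) \<Longrightarrow> K (y - z) \<le> c * tail_weight s 1 z"
proof -
  define N where "N = real DIM('a) + 2 * s"
  define A where "A = (1 + norm x + \<epsilon>) / \<rho> + 1"
  have p: "0 < 1 + norm x + \<epsilon>" using e norm_ge_zero[of x] by linarith
  then have A: "0 < A" using assms by (simp add: A_def add_pos_pos)
  have "K (y - z) \<le> A powr N * tail_weight s 1 z" if y: "norm (y - x) < \<epsilon>" and z: "\<rho> \<le> norm (y - z)" for y z
  proof -
    have "norm z \<le> norm x + norm (y - x) + norm (y - z)"
      using norm_triangle_ineq4[of y "y - z"] norm_triangle_ineq[of x "y - x"] by simp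
    then have "1 + norm z \<le> 1 + norm x + \<epsilon> + norm (y - z)" using y by simp
    also have "\<dots> \<le> A * norm (y - z)"
    proof -
      have "1 + norm x + \<epsilon> \<le> (1 + norm x + \<epsilon>) / \<rho> * norm (y - z)"
        using mult_left_mono[OF z, of "1 + norm x + \<epsilon>"] p assms by (simp add: pos_le_divide_eq)
      then show ?thesis by (simp add: A_def distrib_right)
    qed
    finally have "K (y - z) \<le> A powr N / (1 + norm z) powr N"
      unfolding N_def using s by (intro frac_kernel_le) (auto intro: add_pos_nonneg)
    then show ?thesis by (simp add: tail_weight_def N_def)
  qed
  moreover have "0 < A powr N" using A by simp
  ultimately show ?thesis using that by blast
qed

private lemma u_phi_integrable: "integrable lborel (\<lambda>y. u y * \<phi> y)" "integrable lborel (\<lambda>y. \<bar>u y\<bar> * \<phi> y)"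
  "integrable lborel \<phi>"
proof -
  show "integrable lborel (\<lambda>y. u y * \<phi> y)" using u s e by (intro mollify_integrable)
  have "tail_integrable s (\<lambda>y. \<bar>u y\<bar>)" by (rule tail_integrable_bound[OF u]) auto
  then show "integrable lborel (\<lambda>y. \<bar>u y\<bar> * \<phi> y)" using s e by (intro mollify_integrable)
  show "integrable lborel \<phi>"
    using mollify_integrable[OF tail_integrable_const[OF s(1), of 1] s(1) e] by simp
qed

private lemma u_weight_integrable: "integrable lborel (\<lambda>z. \<bar>u z\<bar> * tail_weight s 1 z)"
  "integrable lborel (\<lambda>z::'a. tail_weight s 1 z)"
proof -
  have "tail_integrable s (\<lambda>y. \<bar>u y\<bar>)" by (rule tail_integrable_bound[OF u]) auto
  then show "integrable lborel (\<lambda>z. \<bar>u z\<bar> * tail_weight s 1 z)"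
    using tail_integrable_weight[of s "\<lambda>y. \<bar>u y\<bar>" 1 0] s by simp
  show "integrable lborel (\<lambda>z::'a. tail_weight s 1 z)"
    using tail_weight_integrable[OF s(1), of 1 0] by simp
qed

private lemma off_diagonal_integrable:
  assumes r: "0 < \<rho>"
  shows "integrable (lborel2) (\<lambda>(y, z). u y * \<phi> y * K (y - z) * outside \<rho> (y - z))"
    (is "integrable _ ?f")
    and "integrable (lborel2) (\<lambda>(y, z). u z * \<phi> y * K (y - z) * outside \<rho> (y - z))"
    (is "integrable _ ?g")
proof -
  obtain c where c: "0 < c"
    "\<And>y z. norm (y - x) < \<epsilon> \<Longrightarrow> \<rho> \<le> norm (y - z) \<Longrightarrow> K (y - z) \<le> c * tail_weight s 1 z"
    by (rule kernel_bound[OF r]) blast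
  have le: "\<phi> y * K (y - z) * outside \<rho> (y - z) \<le> \<phi> y * (c * tail_weight s 1 z)" for y z
  proof (cases "\<phi> y \<noteq> 0 \<and> \<rho> \<le> norm (y - z)")
    case True
    then have "K (y - z) \<le> c * tail_weight s 1 z" using c(2) phi_support by blast
    then show ?thesis using True phi_nonneg[of y] by (simp add: mult_left_mono)
  next
    case False
    then show ?thesis using phi_nonneg[of y] c(1) by auto
  qed
  have "integrable (lborel2) (\<lambda>(y, z::'a). (\<bar>u y\<bar> * \<phi> y) * (c * tail_weight s 1 z))"
    by (rule integrable_pair_mult[OF u_phi_integrable(2) integrable_mult_right[OF u_weight_integrable(2), of c]])
  then show "integrable (lborel2) ?f"
  proof (rule Bochner_Integration.integrable_bound)
    show "AE p in lborel2. norm (?f p) \<le> norm (case p of (y, z) \<Rightarrow> (\<bar>u y\<bar> * \<phi> y) * (c * tail_weight s 1 z))"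
    proof (rule AE_I2)
      fix p :: "'a \<times> 'a"
      obtain y z where p: "p = (y, z)" by (cases p)
      have "norm (?f p) = \<bar>u y\<bar> * (\<phi> y * K (y - z) * outside \<rho> (y - z))"
        using phi_nonneg[of y] by (simp add: p abs_mult)
      also have "\<dots> \<le> \<bar>u y\<bar> * (\<phi> y * (c * tail_weight s 1 z))" by (intro mult_left_mono le) auto
      finally show "norm (?f p) \<le> norm (case p of (y, z) \<Rightarrow> (\<bar>u y\<bar> * \<phi> y) * (c * tail_weight s 1 z))"
        using c(1) phi_nonneg[of y] by (simp add: p abs_mult mult_ac)
    qed
  qed measurable
  have "integrable (lborel2) (\<lambda>(y, z). \<phi> y * (c * (\<bar>u z\<bar> * tail_weight s 1 z)))"
    by (rule integrable_pair_mult[OF u_phi_integrable(3) integrable_mult_right[OF u_weight_integrable(1), of c]])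
  then show "integrable (lborel2) ?g"
  proof (rule Bochner_Integration.integrable_bound)
    show "AE p in lborel2. norm (?g p) \<le> norm (case p of (y, z) \<Rightarrow> \<phi> y * (c * (\<bar>u z\<bar> * tail_weight s 1 z)))"
    proof (rule AE_I2)
      fix p :: "'a \<times> 'a"
      obtain y z where p: "p = (y, z)" by (cases p)
      have "norm (?g p) = \<bar>u z\<bar> * (\<phi> y * K (y - z) * outside \<rho> (y - z))"
        using phi_nonneg[of y] by (simp add: p abs_mult)
      also have "\<dots> \<le> \<bar>u z\<bar> * (\<phi> y * (c * tail_weight s 1 z))" by (intro mult_left_mono le) auto
      finally show "norm (?g p) \<le> norm (case p of (y, z) \<Rightarrow> \<phi> y * (c * (\<bar>u z\<bar> * tail_weight s 1 z)))"
        using c(1) phi_nonneg[of y] by (simp add: p abs_mult mult_ac)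
    qed
  qed measurable
qed

private lemma truncated_kernel_integral:
  "(LBINT z. K (y - z) * outside \<rho> (y - z))
    = (LBINT h. K h * outside \<rho> h)"
proof -
  have "(LBINT z. K (y - z) * outside \<rho> (y - z))
      = (LBINT z. K (y - (y + z)) * outside \<rho> (y - (y + z)))"
    by (rule integral_lborel_translate[symmetric]) measurable
  then show ?thesis by (simp add: indicator_def)
qed

private lemma convolution_kernel_integral:
  "(LBINT y. \<phi> y * K (y - z) * outside \<rho> (y - z))
    = (LBINT h. mollifier \<epsilon> (z - (x + h)) * K h * outside \<rho> h)"
proof -
  let ?f = "\<lambda>h. \<phi> (z + h) * K h * outside \<rho> h"
  have "(LBINT y. \<phi> y * K (y - z) * outside \<rho> (y - z))
      = (LBINT h. \<phi> (z + h) * K (z + h - z) * outside \<rho> (z + h - z))"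
    by (rule integral_lborel_translate[symmetric]) measurable
  also have "\<dots> = (LBINT h. ?f h)" by simp
  also have "\<dots> = (\<integral>h. ?f h \<partial>distr lborel borel uminus)" by (simp add: distr_uminus_lborel)
  also have "\<dots> = (LBINT h. ?f (- h))" by (subst integral_distr) auto
  also have "\<dots> = (LBINT h. mollifier \<epsilon> (z - (x + h)) * K h * outside \<rho> h)"
    by (simp add: indicator_def algebra_simps)
  finally show ?thesis .
qed

text \<open>Justifies the exchange of z and h that turns the convolution of kernel and mollifier
  into a mollification at x + h. Integrating in h first leaves at most c |u(z)| times the weight,
  because the mollifier has mass one.\<close>

private lemma mollified_kernel_integrable:
  assumes r: "0 < \<rho>"
  shows "integrable (lborel2) (\<lambda>(z, h). u z * mollifier \<epsilon> (z - (x + h)) * K h * outside \<rho> h)"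
    (is "integrable _ ?f")
proof (rule lborel_pair.Fubini_integrable)
  obtain c where c: "0 < c"
    "\<And>y z. norm (y - x) < \<epsilon> \<Longrightarrow> \<rho> \<le> norm (y - z) \<Longrightarrow> K (y - z) \<le> c * tail_weight s 1 z"
    by (rule kernel_bound[OF r]) blast
  show "?f \<in> borel_measurable (lborel2)" by measurable
  have iK: "integrable lborel (\<lambda>h::'a. K h * outside \<rho> h)"
    using s r by (intro truncated_kernel_integrable)
  obtain B where B: "0 < B" "\<And>y::'a. mollifier \<epsilon> y \<le> B * tail_weight s \<epsilon> y"
    using mollifier_le_tail_weight[OF s(1), where 'a = 'a] e by metis
  have reflect: "mollifier \<epsilon> (z - (x + h)) = mollifier \<epsilon> (h - (z - x))" for z h
    using mollifier_minus[of \<epsilon> "h - (z - x)"] by (simp add: algebra_simps)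
  have tw: "tail_weight s \<epsilon> (y::'a) \<le> tail_weight s \<epsilon> (0::'a)" for y
    unfolding tail_weight_def using e s
    by (intro divide_left_mono powr_mono2 mult_pos_pos powr_gt_zero[THEN iffD2])
       (auto dest: add_pos_nonneg[OF _ norm_ge_zero, of _ y])
  have mb: "mollifier \<epsilon> y \<le> B * tail_weight s \<epsilon> (0::'a)" for y :: 'a
    using B(2)[of y] mult_left_mono[OF tw[of y], of B] B(1) by linarith
  have inner: "integrable lborel (\<lambda>h. mollifier \<epsilon> (z - (x + h)) * (K h * outside \<rho> h))" for z
  proof (rule Bochner_Integration.integrable_bound)
    show "integrable lborel (\<lambda>h::'a. (B * tail_weight s \<epsilon> (0::'a)) * (K h * outside \<rho> h))"
      using iK by (rule integrable_mult_right)
    show "AE h in lborel. norm (mollifier \<epsilon> (z - (x + h)) * (K h * outside \<rho> h))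
        \<le> norm ((B * tail_weight s \<epsilon> (0::'a)) * (K h * outside \<rho> h))"
    proof (rule AE_I2)
      fix h
      have "mollifier \<epsilon> (z - (x + h)) * (K h * outside \<rho> h)
          \<le> (B * tail_weight s \<epsilon> (0::'a)) * (K h * outside \<rho> h)"
        by (intro mult_right_mono mb) auto
      then show "norm (mollifier \<epsilon> (z - (x + h)) * (K h * outside \<rho> h))
        \<le> norm ((B * tail_weight s \<epsilon> (0::'a)) * (K h * outside \<rho> h))"
        using mollifier_nonneg[OF e, of "z - (x + h)"] B(1) by (simp add: abs_mult)
    qed
  qed measurable
  then show "AE z in lborel. integrable lborel (\<lambda>h. ?f (z, h))"
    by (auto simp: mult.assoc intro: integrable_mult_right)
  show "integrable lborel (\<lambda>z. \<integral>h. norm (?f (z, h)) \<partial>lborel)"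
  proof (rule Bochner_Integration.integrable_bound)
    show "integrable lborel (\<lambda>z. c * (\<bar>u z\<bar> * tail_weight s 1 z))"
      by (intro integrable_mult_right u_weight_integrable)
    show "AE z in lborel. norm (LBINT h. norm (?f (z, h))) \<le> norm (c * (\<bar>u z\<bar> * tail_weight s 1 z))"
    proof (rule AE_I2)
      fix z
      have "(LBINT h. norm (?f (z, h))) = \<bar>u z\<bar> * (LBINT h. mollifier \<epsilon> (z - (x + h)) * (K h * outside \<rho> h))"
        using mollifier_nonneg[OF e, where 'a = 'a] by (simp add: abs_mult mult.assoc)
      also have "\<dots> \<le> \<bar>u z\<bar> * (LBINT h. mollifier \<epsilon> (z - (x + h)) * (c * tail_weight s 1 z))"
      proof (rule mult_left_mono[OF integral_mono[OF inner]])
        have "integrable lborel (\<lambda>h. mollifier \<epsilon> (h - (z - x)))"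
          using mollify_integrable[OF tail_integrable_const[OF s(1), of 1] s(1) e, of "z - x"] by simp
        then show "integrable lborel (\<lambda>h. mollifier \<epsilon> (z - (x + h)) * (c * tail_weight s 1 z))"
          unfolding reflect by (rule integrable_mult_left)
        fix h
        show "mollifier \<epsilon> (z - (x + h)) * (K h * outside \<rho> h) \<le> mollifier \<epsilon> (z - (x + h)) * (c * tail_weight s 1 z)"
        proof (cases "mollifier \<epsilon> (z - (x + h)) \<noteq> 0 \<and> \<rho> \<le> norm h")
          case True
          then have "norm ((z - h) - x) < \<epsilon>" using mollifier_support[OF e, of "z - (x + h)"] by (simp add: algebra_simps)
          then have "K ((z - h) - z) \<le> c * tail_weight s 1 z" using True by (intro c(2)) auto
          then show ?thesis using True mollifier_nonneg[OF e, of "z - (x + h)"] by (simp add: mult_left_mono)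
        next
          case False
          then show ?thesis using mollifier_nonneg[OF e, of "z - (x + h)"] c(1) by auto
        qed
      qed simp
      also have "(LBINT h. mollifier \<epsilon> (z - (x + h)) * (c * tail_weight s 1 z)) = c * tail_weight s 1 z"
      proof -
        have "(LBINT h. mollifier \<epsilon> (z - (x + h))) = 1"
          unfolding reflect by (rule integral_mollifier_shift[OF e])
        then show ?thesis by simp
      qed
      finally show "norm (LBINT h. norm (?f (z, h))) \<le> norm (c * (\<bar>u z\<bar> * tail_weight s 1 z))"
        using c(1) by (simp add: abs_mult mult_ac)
    qed
  qed measurable
qed

text \<open>Away from the diagonal the two terms can be integrated separately: the one with u(y)
  sees the kernel tail as a constant and yields the mollification at x, the one with u(z) yields the
  mollification at x + h.\<close>

private lemma truncated_pairing_half: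
  assumes r: "0 < \<rho>"
  shows "integrable (lborel2) (\<lambda>(y, z). (u y - u z) * \<phi> y * K (y - z) * outside \<rho> (y - z))"
    (is "integrable _ ?H")
    and "(\<integral>(y, z). (u y - u z) * \<phi> y * K (y - z) * outside \<rho> (y - z) \<partial>(lborel2))
      = truncated_laplacian s (mollify u \<epsilon>) x \<rho>"
proof -
  let ?I = "\<lambda>h::'a. outside \<rho> h :: real"
  let ?f = "\<lambda>(y, z). u y * \<phi> y * K (y - z) * ?I (y - z)"
  let ?g = "\<lambda>(y, z). u z * \<phi> y * K (y - z) * ?I (y - z)"
  have H: "?H = (\<lambda>p. ?f p - ?g p)" by (auto simp: fun_eq_iff algebra_simps)
  show "integrable (lborel2) ?H"
    unfolding H by (intro Bochner_Integration.integrable_diff off_diagonal_integrable r)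
  define P where "P = (LBINT h. K h * ?I h)"
  have iK: "integrable lborel (\<lambda>h::'a. K h * ?I h)"
    using s r by (intro truncated_kernel_integrable)
  have f: "integral\<^sup>L (lborel2) ?f = mollify u \<epsilon> x * P"
  proof -
    have "integral\<^sup>L (lborel2) ?f = (LBINT y. (LBINT z. u y * \<phi> y * K (y - z) * ?I (y - z)))"
      using lborel_pair.integral_fst'[OF off_diagonal_integrable(1)[OF r]] by simp
    also have "\<dots> = (LBINT y. u y * \<phi> y * P)"
      unfolding P_def by (simp only: mult.assoc integral_mult_right_zero truncated_kernel_integral)
    also have "\<dots> = mollify u \<epsilon> x * P" by (simp add: mollify_def)
    finally show ?thesis .
  qed
  have g: "integral\<^sup>L (lborel2) ?g = (LBINT h. mollify u \<epsilon> (x + h) * K h * ?I h)"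
  proof -
    have "integral\<^sup>L (lborel2) ?g = (LBINT z. (LBINT y. u z * \<phi> y * K (y - z) * ?I (y - z)))"
      using lborel_pair.integral_snd[OF off_diagonal_integrable(2)[OF r]] by simp
    also have "\<dots> = (LBINT z. u z * (LBINT y. \<phi> y * K (y - z) * ?I (y - z)))"
      by (simp only: mult.assoc integral_mult_right_zero)
    also have "\<dots> = (LBINT z. u z * (LBINT h. mollifier \<epsilon> (z - (x + h)) * K h * ?I h))"
      by (simp only: convolution_kernel_integral)
    also have "\<dots> = (LBINT z. (LBINT h. u z * mollifier \<epsilon> (z - (x + h)) * K h * ?I h))"
      by (simp only: mult.assoc integral_mult_right_zero)
    also have "\<dots> = (LBINT h. (LBINT z. u z * mollifier \<epsilon> (z - (x + h)) * K h * ?I h))"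
      by (rule lborel_pair.Fubini_integral[symmetric]) (rule mollified_kernel_integrable[OF r])
    also have "\<dots> = (LBINT h. mollify u \<epsilon> (x + h) * K h * ?I h)"
      by (simp only: mollify_def integral_mult_left_zero)
    finally show ?thesis .
  qed
  have v: "tail_integrable s (mollify u \<epsilon>)" using u s e by (intro mollify_tail_integrable)
  have "integral\<^sup>L (lborel2) ?H = integral\<^sup>L (lborel2) ?f - integral\<^sup>L (lborel2) ?g"
    unfolding H by (intro Bochner_Integration.integral_diff off_diagonal_integrable r)
  also have "\<dots> = (LBINT h. mollify u \<epsilon> x * (K h * ?I h)) - (LBINT h. mollify u \<epsilon> (x + h) * K h * ?I h)"
    unfolding f g P_def by simp
  also have "\<dots> = (LBINT h. mollify u \<epsilon> x * (K h * ?I h) - mollify u \<epsilon> (x + h) * K h * ?I h)"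
    using v s r by (intro Bochner_Integration.integral_diff[symmetric] integrable_mult_right iK tail_integrable_kernel)
  also have "\<dots> = truncated_laplacian s (mollify u \<epsilon>) x \<rho>"
    unfolding truncated_laplacian_def by (simp add: algebra_simps)
  finally show "integral\<^sup>L (lborel2) ?H = truncated_laplacian s (mollify u \<epsilon>) x \<rho>" .
qed

text \<open>The integrand is the half pairing plus its image under exchanging y and z, which has the
  same integral; hence the factor 2.\<close>

private lemma truncated_pairing:
  assumes r: "0 < \<rho>"
  shows "(\<integral>(y, z). (u y - u z) * (\<phi> y - \<phi> z) * K (y - z) * outside \<rho> (y - z) \<partial>(lborel2))
      = 2 * truncated_laplacian s (mollify u \<epsilon>) x \<rho>"
proof -
  let ?H = "\<lambda>(y, z). (u y - u z) * \<phi> y * K (y - z) * outside \<rho> (y - z)"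
  have sym: "outside \<rho> (z - y) = (outside \<rho> (y - z) :: real)" for y z :: 'a
    by (simp add: indicator_def norm_minus_commute)
  have "(\<lambda>(y, z). (u y - u z) * (\<phi> y - \<phi> z) * K (y - z) * outside \<rho> (y - z))
      = (\<lambda>p. ?H p + (\<lambda>(y, z). ?H (z, y)) p)"
    by (auto simp: fun_eq_iff sym frac_kernel_commute[of s] algebra_simps)
  moreover have "integral\<^sup>L (lborel2) (\<lambda>p. ?H p + (\<lambda>(y, z). ?H (z, y)) p)
      = integral\<^sup>L (lborel2) ?H + integral\<^sup>L (lborel2) (\<lambda>(y, z). ?H (z, y))"
    by (intro Bochner_Integration.integral_add truncated_pairing_half(1)[OF r]
        lborel_pair.integrable_product_swap)
  moreover have "integral\<^sup>L (lborel2) (\<lambda>(y, z). ?H (z, y)) = integral\<^sup>L (lborel2) ?H"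
    by (rule lborel_pair.integral_product_swap) (rule borel_measurable_integrable[OF truncated_pairing_half(1)[OF r]])
  ultimately show ?thesis using truncated_pairing_half(2)[OF r] by simp
qed

private lemma second_moment_integrable:
  "integrable (lborel2) (\<lambda>(y::'a, z). indicator (ball x (2 * \<epsilon>)) y
      * (indicator {h. norm h < 4 * \<epsilon>} (y - z) * ((norm (y - z))\<^sup>2 * K (y - z))))"
proof -
  have "integrable lborel (\<lambda>h::'a. indicator {h. norm h < 4 * \<epsilon>} h * ((norm h)\<^sup>2 * K h))"
    unfolding frac_kernel_def times_divide_eq_right mult_1_right
    by (rule kernel_second_moment[where 'a = 'a, of "real DIM('a) + 2 * s"]) (use s e in auto)
  moreover have "integrable lborel (indicator (ball x (2 * \<epsilon>)) :: 'a \<Rightarrow> real)"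
    using emeasure_lborel_ball_finite[of x "2 * \<epsilon>"] by (intro integrable_real_indicator) auto
  ultimately show ?thesis by (rule integrable_pair_convolution[rotated])
qed

text \<open>If both points lie in the ball of radius 2\<epsilon>, \<open>u\<close> agrees with
  \<open>v\<close> almost everywhere, and the product is bounded by the H^s integrand plus the
  squared Lipschitz bound of the mollifier. Otherwise one mollifier value vanishes, and where the
  other does not, the points are at least \<epsilon> apart and the off-diagonal estimate
  applies.\<close>

private lemma pairing_integrable:
  assumes v: "integrable (lborel2) (\<lambda>(y, z). (v y - v z)\<^sup>2 * K (y - z))"
    and uv: "AE y in lborel. y \<in> ball x (2 * \<epsilon>) \<longrightarrow> u y = v y"
  shows "integrable (lborel2) (\<lambda>(y, z). (u y - u z) * (\<phi> y - \<phi> z) * K (y - z))"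
    (is "integrable _ ?F")
proof -
  obtain L where L: "0 < L"
    "\<And>y z. norm y < 2 * \<epsilon> \<Longrightarrow> norm z < 2 * \<epsilon> \<Longrightarrow> \<bar>mollifier \<epsilon> (y::'a) - mollifier \<epsilon> z\<bar> \<le> L * norm (y - z)"
    by (rule mollifier_lipschitz[OF e, where 'a = 'a]) blast
  let ?I = "\<lambda>h::'a. outside \<epsilon> h :: real"
  let ?V = "\<lambda>(y, z). (v y - v z)\<^sup>2 * K (y - z)"
  let ?M = "\<lambda>(y::'a, z). indicator (ball x (2 * \<epsilon>)) y
      * (indicator {h. norm h < 4 * \<epsilon>} (y - z) * ((norm (y - z))\<^sup>2 * K (y - z))) :: real"
  let ?f = "\<lambda>(y, z). u y * \<phi> y * K (y - z) * ?I (y - z)"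
  let ?g = "\<lambda>(y, z). u z * \<phi> y * K (y - z) * ?I (y - z)"
  let ?T = "\<lambda>p. \<bar>?f p\<bar> + \<bar>?g p\<bar>"
  \<comment> \<open>The swapped copy of \<open>?T\<close> is included because the nonvanishing
    mollifier value may belong to either variable.\<close>
  let ?B = "\<lambda>p. ?V p + L\<^sup>2 * ?M p + (?T p + (\<lambda>(y, z). ?T (z, y)) p)"
  have T: "integrable (lborel2) ?T"
    by (intro Bochner_Integration.integrable_add integrable_abs off_diagonal_integrable e)
  have iB: "integrable (lborel2) ?B"
    by (intro Bochner_Integration.integrable_add integrable_mult_right second_moment_integrable v T
        lborel_pair.integrable_product_swap[OF T])
  have T_ge: "\<bar>u y - u z\<bar> * \<phi> y * K (y - z) \<le> ?T (y, z)" if "\<epsilon> \<le> norm (y - z)" for y z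
  proof -
    have "\<bar>u y - u z\<bar> * (\<phi> y * K (y - z)) \<le> (\<bar>u y\<bar> + \<bar>u z\<bar>) * (\<phi> y * K (y - z))"
      using phi_nonneg[of y] by (intro mult_right_mono) auto
    then show ?thesis using that phi_nonneg[of y] by (simp add: abs_mult distrib_right mult.assoc)
  qed
  have T0: "0 \<le> ?T p" for p by simp
  have V0: "0 \<le> ?V p" for p by (auto split: prod.split)
  have M0: "0 \<le> L\<^sup>2 * ?M p" for p by (auto split: prod.split)
  have "AE p in lborel2. (fst p \<in> ball x (2 * \<epsilon>) \<longrightarrow> u (fst p) = v (fst p))
      \<and> (snd p \<in> ball x (2 * \<epsilon>) \<longrightarrow> u (snd p) = v (snd p))"
    unfolding lborel_prod by (rule AE_lborel_pair[OF uv])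
  then have "AE p in lborel2. norm (?F p) \<le> norm (?B p)"
  proof eventually_elim
    case (elim p)
    obtain y z where p: "p = (y, z)" by (cases p)
    have *: "norm (?F p) = \<bar>u y - u z\<bar> * \<bar>\<phi> y - \<phi> z\<bar> * K (y - z)"
      by (simp add: p abs_mult)
    have "norm (?F p) \<le> ?B p"
    proof (cases "y \<in> ball x (2 * \<epsilon>) \<and> z \<in> ball x (2 * \<epsilon>)")
      case True
      then have uv: "u y = v y" "u z = v z" using elim by (simp_all add: p)
      have n: "norm (y - x) < 2 * \<epsilon>" "norm (z - x) < 2 * \<epsilon>"
        using True by (auto simp: dist_norm norm_minus_commute)
      have "norm (y - z) \<le> norm (y - x) + norm (z - x)"
        using norm_triangle_ineq4[of "y - x" "z - x"] by simp
      then have n4: "norm (y - z) < 4 * \<epsilon>" using n by simp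
      have lip: "\<bar>\<phi> y - \<phi> z\<bar> \<le> L * norm (y - z)" using L(2)[OF n] by simp
      have "\<bar>u y - u z\<bar> * \<bar>\<phi> y - \<phi> z\<bar> \<le> \<bar>v y - v z\<bar> * (L * norm (y - z))"
        unfolding uv by (rule mult_left_mono[OF lip]) simp
      also have "\<dots> \<le> \<bar>v y - v z\<bar>\<^sup>2 + (L * norm (y - z))\<^sup>2"
      proof -
        have "0 \<le> \<bar>v y - v z\<bar> * (L * norm (y - z))" using L(1) by simp
        then show ?thesis using sum_squares_bound[of "\<bar>v y - v z\<bar>" "L * norm (y - z)"] by linarith
      qed
      finally have "\<bar>u y - u z\<bar> * \<bar>\<phi> y - \<phi> z\<bar> * K (y - z)
          \<le> ((v y - v z)\<^sup>2 + L\<^sup>2 * (norm (y - z))\<^sup>2) * K (y - z)"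
        by (intro mult_right_mono) (auto simp: power_mult_distrib)
      also have "\<dots> = ?V p + L\<^sup>2 * ?M p"
        using True n4 by (simp add: p algebra_simps)
      finally show ?thesis unfolding * using T0[of p] T0[of "(z, y)"] by (simp add: p)
    next
      case False
      consider "y \<notin> ball x (2 * \<epsilon>)" | "z \<notin> ball x (2 * \<epsilon>)" using False by blast
      then have "norm (?F p) \<le> ?T (y, z) + ?T (z, y)"
      proof cases
        case 1
        then have y: "2 * \<epsilon> \<le> norm (y - x)" by (simp add: dist_norm norm_minus_commute)
        then have "\<phi> y = 0" using phi_support[of y] e by fastforce
        then have F: "norm (?F p) = \<bar>u z - u y\<bar> * \<phi> z * K (z - y)"
          unfolding * using phi_nonneg[of z] frac_kernel_commute[of s y z] by (simp add: abs_minus_commute)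
        show ?thesis
        proof (cases "\<phi> z = 0")
          case True
          then show ?thesis unfolding F using T0[of "(y, z)"] T0[of "(z, y)"] by simp
        next
          case False
          then have "norm (z - x) < \<epsilon>" by (rule phi_support)
          moreover have "norm (y - x) \<le> norm (z - y) + norm (z - x)"
            using norm_triangle_ineq4[of "z - x" "z - y"] by simp
          ultimately have "\<epsilon> \<le> norm (z - y)" using y by simp
          then show ?thesis unfolding F using T_ge[of z y] T0[of "(y, z)"] by linarith
        qed
      next
        case 2
        then have z: "2 * \<epsilon> \<le> norm (z - x)" by (simp add: dist_norm norm_minus_commute)
        then have "\<phi> z = 0" using phi_support[of z] e by fastforce
        then have F: "norm (?F p) = \<bar>u y - u z\<bar> * \<phi> y * K (y - z)"
          unfolding * using phi_nonneg[of y] by simp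
        show ?thesis
        proof (cases "\<phi> y = 0")
          case True
          then show ?thesis unfolding F using T0[of "(y, z)"] T0[of "(z, y)"] by simp
        next
          case False
          then have "norm (y - x) < \<epsilon>" by (rule phi_support)
          moreover have "norm (z - x) \<le> norm (y - z) + norm (y - x)"
            using norm_triangle_ineq4[of "y - x" "y - z"] by simp
          ultimately have "\<epsilon> \<le> norm (y - z)" using z by simp
          then show ?thesis unfolding F using T_ge[of y z] T0[of "(z, y)"] by linarith
        qed
      qed
      then show ?thesis using V0[of p] M0[of p] by (simp only: p prod.case)
    qed
    then show ?case by simp
  qed
  then show ?thesis
  proof (rule Bochner_Integration.integrable_bound[OF iB, rotated])
    show "?F \<in> borel_measurable (lborel2)" by measurable
  qed
qed

text \<open>Truncations of the absolutely convergent pairing converge to it, and each is twice a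
  truncated Laplacian of the mollification. Existence and sign of the principal value come out
  together.\<close>

lemma pv_superharmonic_mollify:
  assumes v: "integrable (lborel2) (\<lambda>(y, z). (v y - v z)\<^sup>2 * frac_kernel s (y - z))"
    and uv: "AE y in lborel. y \<in> ball x (2 * \<epsilon>) \<longrightarrow> u y = v y"
    and ge: "0 \<le> (\<integral>(y, z). (u y - u z) * (mollifier \<epsilon> (y - x) - mollifier \<epsilon> (z - x)) * frac_kernel s (y - z)
        \<partial>(lborel2))"
  shows "pv_superharmonic_at s (mollify u \<epsilon>) x"
proof -
  let ?F = "\<lambda>(y, z). (u y - u z) * (\<phi> y - \<phi> z) * K (y - z)"
  let ?\<rho> = "\<lambda>j. 1 / real (Suc j)"
  let ?G = "\<lambda>j (y, z). (u y - u z) * (\<phi> y - \<phi> z) * K (y - z) * outside (?\<rho> j) (y - z)"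
  have F: "integrable (lborel2) ?F" by (rule pairing_integrable[OF v uv])
  have "(\<lambda>j. integral\<^sup>L (lborel2) (?G j)) \<longlonglongrightarrow> integral\<^sup>L (lborel2) ?F"
  proof (rule integral_dominated_convergence[where w = "\<lambda>p. norm (?F p)"])
    show "integrable (lborel2) (\<lambda>p. norm (?F p))" using F by (rule integrable_norm)
    show "AE p in lborel2. (\<lambda>j. ?G j p) \<longlonglongrightarrow> ?F p"
    proof (rule AE_I2)
      fix p :: "'a \<times> 'a"
      obtain y z where p: "p = (y, z)" by (cases p)
      show "(\<lambda>j. ?G j p) \<longlonglongrightarrow> ?F p"
      proof (cases "y = z")
        case False
        have "(\<lambda>j. 1 / real (Suc j)) \<longlonglongrightarrow> 0"
          using LIMSEQ_inverse_real_of_nat by (simp add: inverse_eq_divide)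
        then have "\<forall>\<^sub>F j in sequentially. ?\<rho> j < norm (y - z)"
          by (rule order_tendstoD) (use False in simp)
        then have "\<forall>\<^sub>F j in sequentially. ?G j p = ?F p"
          by eventually_elim (simp add: p)
        then show ?thesis by (rule tendsto_eventually)
      qed (simp add: p)
    qed
    show "AE p in lborel2. norm (?G j p) \<le> norm (?F p)" for j
      by (rule AE_I2) (auto simp: indicator_def split: prod.split)
  qed measurable
  then have "(\<lambda>j. 2 * truncated_laplacian s (mollify u \<epsilon>) x (?\<rho> j)) \<longlonglongrightarrow> integral\<^sup>L (lborel2) ?F"
    by (subst (asm) truncated_pairing) auto
  then have "(\<lambda>j. 2 * truncated_laplacian s (mollify u \<epsilon>) x (?\<rho> j) / 2) \<longlonglongrightarrow> integral\<^sup>L (lborel2) ?F / 2"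
    by (intro tendsto_intros) auto
  then show ?thesis
    unfolding pv_superharmonic_at_def using ge
    by (intro exI[of _ "integral\<^sup>L (lborel2) ?F / 2"]) simp
qed

end

section \<open>The lower semicontinuous representative\<close>

text \<open>A local essential bound attached to an open set serves all points of that set, so lower
  semicontinuity is built in; the content is agreement with \<open>u\<close>. \<open>bounded\<close>
  excludes the value -\<infinity>, and \<open>strict\<close> lifts each value above any essential
  lower bound of \<open>u\<close>.\<close>

lemma ess_lsc_representative:
  fixes u :: "'a::euclidean_space \<Rightarrow> real"
  assumes \<Omega>: "open \<Omega>"
    and lower: "AE x in lborel. x \<in> \<Omega> \<longrightarrow>
      (\<forall>m<u x. \<exists>r>0. ball x r \<subseteq> \<Omega> \<and> (AE y in lborel. y \<in> ball x r \<longrightarrow> m \<le> u y))"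
    and bounded: "\<And>x. x \<in> \<Omega> \<Longrightarrow> \<exists>m. \<exists>r>0. ball x r \<subseteq> \<Omega> \<and> (AE y in lborel. y \<in> ball x r \<longrightarrow> m \<le> u y)"
    and strict: "\<And>x m. x \<in> \<Omega> \<Longrightarrow> AE y in lborel. m \<le> u y \<Longrightarrow>
      \<exists>\<kappa>>0. \<exists>r>0. ball x r \<subseteq> \<Omega> \<and> (AE y in lborel. y \<in> ball x r \<longrightarrow> m + \<kappa> \<le> u y)"
  shows "\<exists>w :: 'a \<Rightarrow> ereal.
     (\<exists>N \<subseteq> \<Omega>. N \<in> null_sets lebesgue \<and> (\<forall>x. x \<notin> N \<longrightarrow> w x = ereal (u x)))
     \<and> (\<forall>x. w x \<noteq> -\<infinity>) \<and> lsc_on \<Omega> w \<and> locally_bounded_below_on \<Omega> w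
     \<and> (\<forall>x\<in>\<Omega>. w x > ess_inf lebesgue w)"
proof -
  define S where "S x = {m::real. \<exists>U. open U \<and> x \<in> U \<and> U \<subseteq> \<Omega> \<and> (AE y in lborel. y \<in> U \<longrightarrow> m \<le> u y)}" for x
  define w where "w x = (if x \<in> \<Omega> then Sup (ereal ` S x) else ereal (u x))" for x
  have ballS: "m \<in> S x" if "0 < r" "ball x r \<subseteq> \<Omega>" "AE y in lborel. y \<in> ball x r \<longrightarrow> m \<le> u y" for m x r
    unfolding S_def using that by (auto intro!: exI[of _ "ball x r"])
  have w_ge: "ereal m \<le> w x" if "x \<in> \<Omega>" "m \<in> S x" for m x
    using that by (auto simp: w_def intro: Sup_upper)
  have w_eq: "AE x in lborel. w x = ereal (u x)"
  proof -
    \<comment> \<open>All neighbourhoods together would produce uncountably many null sets; basic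
      open sets and rational levels reduce the inequality \<open>w x\<close> <= \<open>u x\<close>
      to countably many.\<close>
    obtain \<B> :: "'a set set" where B: "countable \<B>" "topological_basis \<B>"
      using ex_countable_basis by blast
    have "AE x in lborel. \<forall>B\<in>\<B>. \<forall>q::rat. (AE y in lborel. y \<in> B \<longrightarrow> of_rat q \<le> u y) \<longrightarrow> x \<in> B \<longrightarrow> of_rat q \<le> u x"
      using B(1) by (subst AE_ball_countable) (auto simp: AE_all_countable)
    with lower show ?thesis
    proof eventually_elim
      case (elim x)
      show ?case
      proof (cases "x \<in> \<Omega>")
        case True
        have "Sup (ereal ` S x) \<le> ereal (u x)"
        proof (rule SUP_least)
          fix m assume "m \<in> S x"
          then obtain U where U: "open U" "x \<in> U" "AE y in lborel. y \<in> U \<longrightarrow> m \<le> u y"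
            by (auto simp: S_def)
          obtain B' where B': "B' \<in> \<B>" "x \<in> B'" "B' \<subseteq> U"
            by (rule topological_basisE[OF B(2) U(1,2)])
          have "m \<le> u x"
          proof (rule ccontr)
            assume "\<not> m \<le> u x"
            then obtain q where q: "u x < of_rat q" "of_rat q < m" using of_rat_dense[of "u x" m] by auto
            have "AE y in lborel. y \<in> B' \<longrightarrow> of_rat q \<le> u y"
              using U(3) by eventually_elim (use B' q in auto)
            then have "of_rat q \<le> u x" using elim(2) B' by blast
            then show False using q by simp
          qed
          then show "ereal m \<le> ereal (u x)" by simp
        qed
        moreover have "ereal (u x) \<le> Sup (ereal ` S x)"
        proof (rule ccontr)
          assume "\<not> ereal (u x) \<le> Sup (ereal ` S x)"
          then have "Sup (ereal ` S x) < ereal (u x)" by (simp only: not_le)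
          then obtain m where m: "Sup (ereal ` S x) < ereal m" "ereal m < ereal (u x)"
            using ereal_dense2 by blast
          then obtain r where "0 < r" "ball x r \<subseteq> \<Omega>" "AE y in lborel. y \<in> ball x r \<longrightarrow> m \<le> u y"
            using elim(1) True by auto
          then have "ereal m \<le> Sup (ereal ` S x)" using ballS by (intro Sup_upper imageI)
          then show False using m(1) by simp
        qed
        ultimately show ?thesis using True by (simp add: w_def)
      qed (simp add: w_def)
    qed
  qed
  define N where "N = {x. w x \<noteq> ereal (u x)}"
  have "AE x in lebesgue. x \<notin> N" unfolding N_def using AE_completion[OF w_eq] by simp
  then have "N \<in> null_sets lebesgue"
    by (simp add: completion.null_sets_iff_AE)
  moreover have "N \<subseteq> \<Omega>" by (auto simp: N_def w_def)
  moreover have "\<forall>x. x \<notin> N \<longrightarrow> w x = ereal (u x)" by (simp add: N_def)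
  moreover have not_minf: "w x \<noteq> -\<infinity>" for x
  proof (cases "x \<in> \<Omega>")
    case True
    then obtain m r where "0 < r" "ball x r \<subseteq> \<Omega>" "AE y in lborel. y \<in> ball x r \<longrightarrow> m \<le> u y"
      using bounded by blast
    then have "ereal m \<le> w x" using w_ge[OF True] ballS by blast
    then show ?thesis by auto
  qed (simp add: w_def)
  moreover have "lsc_on \<Omega> w"
    unfolding lsc_on_def
  proof
    fix x assume x: "x \<in> \<Omega>"
    have "Sup (ereal ` S x) \<le> Liminf (at x within \<Omega>) w"
    proof (rule SUP_least)
      fix m assume "m \<in> S x"
      then obtain U where U: "open U" "x \<in> U" "U \<subseteq> \<Omega>" "AE y in lborel. y \<in> U \<longrightarrow> m \<le> u y"
        by (auto simp: S_def)
      have "ereal m \<le> w y" if "y \<in> U" for y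
        using U that by (intro w_ge) (auto simp: S_def)
      then have "\<forall>\<^sub>F y in at x within \<Omega>. ereal m \<le> w y"
        using U by (auto simp: eventually_at_topological)
      then show "ereal m \<le> Liminf (at x within \<Omega>) w" by (rule Liminf_bounded)
    qed
    then show "w x \<le> Liminf (at x within \<Omega>) w" using x by (simp add: w_def)
  qed
  moreover have "locally_bounded_below_on \<Omega> w"
    unfolding locally_bounded_below_on_def
  proof (intro allI impI)
    fix G assume "compactly_contained G \<Omega>"
    then have G: "compact (closure G)" "closure G \<subseteq> \<Omega>" by (auto simp: compactly_contained_def)
    have "\<exists>m U. open U \<and> x \<in> U \<and> (\<forall>y\<in>U. ereal m \<le> w y)" if "x \<in> closure G" for x
    proof -
      have "x \<in> \<Omega>" using that G by blast
      then obtain m r where r: "0 < r" "ball x r \<subseteq> \<Omega>" "AE y in lborel. y \<in> ball x r \<longrightarrow> m \<le> u y"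
        using bounded by blast
      have "ereal m \<le> w y" if "y \<in> ball x r" for y
        using r that by (intro w_ge) (auto simp: S_def)
      then show ?thesis using r(1) by (intro exI[of _ m] exI[of _ "ball x r"]) auto
    qed
    then obtain m U where mU: "\<And>x. x \<in> closure G \<Longrightarrow> open (U x) \<and> x \<in> U x \<and> (\<forall>y\<in>U x. ereal (m x) \<le> w y)"
      by metis
    obtain D where D: "D \<subseteq> closure G" "finite D" "closure G \<subseteq> (\<Union>c\<in>D. U c)"
      by (rule compactE_image[OF G(1), of "closure G" U]) (use mU in blast)+
    show "\<exists>m::real. \<forall>x\<in>G. ereal m \<le> w x"
    proof (intro exI ballI)
      fix y assume "y \<in> G"
      then obtain c where c: "c \<in> D" "y \<in> U c" using D closure_subset by blast
      have "Min (insert 0 (m ` D)) \<le> m c" using c D by (intro Min_le) auto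
      moreover have "ereal (m c) \<le> w y" using mU c D by blast
      ultimately show "ereal (Min (insert 0 (m ` D))) \<le> w y"
        by (meson ereal_less_eq(3) order_trans)
    qed
  qed
  moreover have "\<forall>x\<in>\<Omega>. w x > ess_inf lebesgue w"
  proof
    fix x assume x: "x \<in> \<Omega>"
    define I where "I = ess_inf lebesgue w"
    show "w x > ess_inf lebesgue w"
    proof (cases "I = -\<infinity>")
      case True
      then show ?thesis using not_minf[of x] by (simp add: I_def)
    next
      case False
      \<comment> \<open>The essential infimum is a supremum of lower bounds, not visibly one itself.
        Each rational below it is a lower bound almost everywhere, and countably many rationals
        suffice.\<close>
      have "AE y in lborel. \<forall>q::rat. ereal (of_rat q) < I \<longrightarrow> of_rat q \<le> u y"
        unfolding AE_all_countable
      proof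
        fix q :: rat
        show "AE y in lborel. ereal (of_rat q) < I \<longrightarrow> of_rat q \<le> u y"
        proof (cases "ereal (of_rat q) < I")
          case True
          then obtain c where c: "AE y in lebesgue. c \<le> w y" "ereal (of_rat q) < c"
            unfolding I_def ess_inf_def less_Sup_iff by blast
          have "AE y in lborel. c \<le> w y" using c(1) by (simp add: AE_completion_iff)
          with w_eq show ?thesis
          proof eventually_elim
            case (elim y)
            then have "c \<le> ereal (u y)" by simp
            with c(2) have "ereal (of_rat q) < ereal (u y)" by (rule less_le_trans)
            then show ?case by simp
          qed
        qed simp
      qed
      then have IAE: "AE y in lborel. I \<le> ereal (u y)"
      proof eventually_elim
        case (elim y)
        show ?case
        proof (rule ccontr)
          assume "\<not> I \<le> ereal (u y)"
          then have "ereal (u y) < I" by simp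
          then obtain z where z: "ereal (u y) < ereal z" "ereal z < I"
            using ereal_dense2 by blast
          then obtain q where "u y < of_rat q" "of_rat q < z" using of_rat_dense[of "u y" z] by auto
          moreover from this z have "ereal (of_rat q) < I" by (metis ereal_less_eq(3) le_less_trans less_imp_le)
          ultimately show False using elim by fastforce
        qed
      qed
      \<comment> \<open>An infinite essential infimum would make the real-valued \<open>u\<close>
        infinite almost everywhere.\<close>
      have "I \<noteq> \<infinity>"
      proof
        assume "I = \<infinity>"
        then have "AE y in (lborel :: 'a measure). False" using IAE by simp
        then show False by (simp add: eventually_False ae_filter_eq_bot_iff emeasure_lborel_UNIV)
      qed
      with False obtain m where m: "I = ereal m" by (cases I) auto
      have "AE y in lborel. m \<le> u y" using IAE by (simp add: m)
      then obtain \<kappa> r where k: "0 < \<kappa>" "0 < r" "ball x r \<subseteq> \<Omega>" "AE y in lborel. y \<in> ball x r \<longrightarrow> m + \<kappa> \<le> u y"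
        using strict[OF x] by blast
      then have "ereal (m + \<kappa>) \<le> w x" using w_ge[OF x] ballS by blast
      moreover have "ereal m < ereal (m + \<kappa>)" using k by simp
      ultimately have "ereal m < w x" by (rule less_le_trans[rotated])
      then show ?thesis using m by (simp add: I_def)
    qed
  qed
  ultimately show ?thesis by blast
qed

section \<open>Lebesgue integrals through Borel representatives\<close>

lemma measurable_lebesgue_cong_AE:
  fixes f f' :: "'a::euclidean_space \<Rightarrow> real"
  assumes [measurable]: "f' \<in> borel_measurable borel" and eq: "AE x in lborel. f x = f' x"
  shows "f \<in> borel_measurable lebesgue"
proof (rule measurableI)
  fix A :: "real set" assume [measurable]: "A \<in> sets borel"
  have [measurable]: "f' \<in> borel_measurable lebesgue" by (rule measurable_completion) simp
  have 1: "Measurable.pred lebesgue (\<lambda>x. f x \<noteq> f' x \<and> f x \<in> A)"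
    using eq by (intro sets_completion_AE) auto
  have 2: "Measurable.pred lebesgue (\<lambda>x. f x \<noteq> f' x)"
    using eq by (intro sets_completion_AE) auto
  have 3: "Measurable.pred lebesgue (\<lambda>x. f' x \<in> A)" by measurable
  have "Measurable.pred lebesgue (\<lambda>x. (\<not> f x \<noteq> f' x) \<and> f' x \<in> A \<or> f x \<noteq> f' x \<and> f x \<in> A)"
    by (intro pred_intros_logic 1 2 3)
  moreover have "(\<lambda>x. (\<not> f x \<noteq> f' x) \<and> f' x \<in> A \<or> f x \<noteq> f' x \<and> f x \<in> A) = (\<lambda>x. f x \<in> A)"
    by auto
  ultimately show "f -` A \<inter> space lebesgue \<in> sets lebesgue"
    by (simp add: pred_def vimage_def)
qed simp

lemma integral_lebesgue_eq_lborel: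
  fixes f f' :: "'a::euclidean_space \<Rightarrow> real"
  assumes f': "f' \<in> borel_measurable borel" and eq: "AE x in lborel. f x = f' x"
  shows "integrable lebesgue f \<longleftrightarrow> integrable lborel f'"
    and "integral\<^sup>L lebesgue f = integral\<^sup>L lborel f'"
proof -
  have f: "f \<in> borel_measurable lebesgue" by (rule measurable_lebesgue_cong_AE[OF assms])
  have fl: "f' \<in> borel_measurable lebesgue" using f' by (intro measurable_completion) simp
  have eq': "AE x in lebesgue. f x = f' x" using eq by (rule AE_completion)
  show "integrable lebesgue f \<longleftrightarrow> integrable lborel f'"
    using integrable_cong_AE[OF f fl eq'] integrable_completion[of f' lborel] f' by simp
  show "integral\<^sup>L lebesgue f = integral\<^sup>L lborel f'"
    using integral_cong_AE[OF f fl eq'] integral_completion[of f' lborel] f' by simp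
qed

lemma frac_const_pos: "0 < s \<Longrightarrow> s < 1 \<Longrightarrow> 0 < frac_const n s"
  unfolding frac_const_def by (intro divide_pos_pos mult_pos_pos Gamma_real_pos) (auto intro: add_nonneg_pos)

theorem corollary4p2:
  fixes s :: real and \<Omega> :: "(real ^ 'n) set" and u :: "real ^ 'n \<Rightarrow> real"
  assumes "0 < s" and "s < 1"
    and "open \<Omega>" and "connected \<Omega>" and "\<Omega> \<noteq> {}"
    and "u \<in> borel_measurable lebesgue"
    and "\<not> (\<exists>c. AE x in lebesgue. u x = c)"
    and "u \<in> Hs_loc s \<Omega>"
    and "integrable lebesgue (\<lambda>x. \<bar>u x\<bar> / (1 + norm x powr (real CARD('n) + 2 * s)))"
    and "frac_superharmonic s \<Omega> u"
  shows "\<exists>w :: real ^ 'n \<Rightarrow> ereal.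
     (\<exists>N \<subseteq> \<Omega>. N \<in> null_sets lebesgue \<and> (\<forall>x. x \<notin> N \<longrightarrow> w x = ereal (u x)))
     \<and> (\<forall>x. w x \<noteq> -\<infinity>)
     \<and> lsc_on \<Omega> w
     \<and> locally_bounded_below_on \<Omega> w
     \<and> (\<forall>x\<in>\<Omega>. w x > ess_inf lebesgue w)"
proof -
  note s = assms(1,2) and \<Omega> = assms(3)
  define N where "N = real CARD('n) + 2 * s"
  \<comment> \<open>One Borel representative is fixed for all translations and product integrals.
    What is proved for it consists of almost-everywhere bounds, which carry back to
    \<open>u\<close>.\<close>
  obtain u' where u'[measurable]: "u' \<in> borel_measurable borel" and uu': "AE x in lborel. u x = u' x"
    using completion_ex_borel_measurable_real[OF assms(6)] by auto
  have tail: "tail_integrable s u'"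
  proof -
    have "AE x in lborel. \<bar>u x\<bar> / (1 + norm x powr N) = \<bar>u' x\<bar> / (1 + norm x powr N)"
      using uu' by eventually_elim simp
    then have "integrable lborel (\<lambda>x. \<bar>u' x\<bar> / (1 + norm x powr N))"
      using assms(9) unfolding N_def[symmetric]
      by (subst (asm) integral_lebesgue_eq_lborel(1)[where f' = "\<lambda>x. \<bar>u' x\<bar> / (1 + norm x powr N)"]) measurable
    \<comment> \<open>The factor 2 comes from 1 + |x|^N <= 2 (1 + |x|)^N, each summand being at most
      (1 + |x|)^N.\<close>
    then have "integrable lborel (\<lambda>x. 2 * (\<bar>u' x\<bar> / (1 + norm x powr N)))" by (rule integrable_mult_right)
    then have "integrable lborel (\<lambda>x. u' x / (1 + norm x) powr N)"
    proof (rule Bochner_Integration.integrable_bound)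
      show "AE x in lborel. norm (u' x / (1 + norm x) powr N) \<le> norm (2 * (\<bar>u' x\<bar> / (1 + norm x powr N)))"
      proof (rule AE_I2)
        fix x :: "real ^ 'n"
        have "norm x powr N \<le> (1 + norm x) powr N"
          using s by (intro powr_mono2) (auto simp: N_def)
        moreover have "1 \<le> (1 + norm x) powr N"
          using s by (intro ge_one_powr_ge_zero) (auto simp: N_def)
        ultimately have le: "1 + norm x powr N \<le> 2 * (1 + norm x) powr N" by simp
        have "0 < 1 + norm x powr N" by (rule add_pos_nonneg) auto
        moreover have "0 < (1 + norm x) powr N" using add_pos_nonneg[of 1 "norm x"] by simp
        ultimately have "1 / (1 + norm x) powr N \<le> 2 / (1 + norm x powr N)"
          using le by (simp add: field_simps)
        then have "\<bar>u' x\<bar> * (1 / (1 + norm x) powr N) \<le> \<bar>u' x\<bar> * (2 / (1 + norm x powr N))"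
          by (intro mult_left_mono) auto
        moreover have "\<bar>1 + norm x powr N\<bar> = 1 + norm x powr N" by simp
        ultimately show "norm (u' x / (1 + norm x) powr N) \<le> norm (2 * (\<bar>u' x\<bar> / (1 + norm x powr N)))"
          by (simp add: abs_mult mult_ac)
      qed
    qed measurable
    then show ?thesis by (simp add: tail_integrable_def N_def)
  qed
  have sup: "pv_superharmonic_at s (mollify u' \<epsilon>) x" if e: "0 < \<epsilon>" and sub: "cball x (2 * \<epsilon>) \<subseteq> \<Omega>" for \<epsilon> x
  proof -
    \<comment> \<open>Radius 2\<epsilon> gives agreement with an H^s function not only on the
      support of the mollifier but also on a collar of width \<epsilon> around it.\<close>
    have "closure (ball x (2 * \<epsilon>)) = cball x (2 * \<epsilon>)" using e by simp
    then have "compactly_contained (ball x (2 * \<epsilon>)) \<Omega>"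
      using sub by (simp add: compactly_contained_def)
    then obtain v where v: "v \<in> Hs_space s" "AE y in lebesgue. y \<in> ball x (2 * \<epsilon>) \<longrightarrow> u y = v y"
      using assms(8) by (auto simp: Hs_loc_def)
    obtain v' where v'[measurable]: "v' \<in> borel_measurable borel" and vv': "AE x in lborel. v x = v' x"
      using completion_ex_borel_measurable_real[of v lborel] v(1) by (auto simp: Hs_space_def)
    have "AE y in lborel. y \<in> ball x (2 * \<epsilon>) \<longrightarrow> u y = v y"
      using v(2) by (simp add: AE_completion_iff)
    with uu' vv' have u'v': "AE y in lborel. y \<in> ball x (2 * \<epsilon>) \<longrightarrow> u' y = v' y"
      by eventually_elim auto
    have "integrable (lborel2) (\<lambda>(y, z). (v' y - v' z)\<^sup>2 * frac_kernel s (y - z))"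
      unfolding lborel_prod
    proof (subst integral_lebesgue_eq_lborel(1)[symmetric, where
          f = "\<lambda>(y, z). (v y - v z)\<^sup>2 / norm (y - z) powr (real CARD('n) + 2 * s)"])
      show "(\<lambda>(y, z). (v' y - v' z)\<^sup>2 * frac_kernel s (y - z)) \<in> borel_measurable borel"
        unfolding borel_prod[symmetric] by measurable
      show "AE p in lborel. (case p of (y, z) \<Rightarrow> (v y - v z)\<^sup>2 / norm (y - z) powr (real CARD('n) + 2 * s))
          = (case p of (y, z) \<Rightarrow> (v' y - v' z)\<^sup>2 * frac_kernel s (y - z))"
        using AE_lborel_pair[OF vv'] by eventually_elim (auto simp: frac_kernel_def)
    qed (use v(1) in \<open>simp add: Hs_space_def\<close>)
    moreover have "0 \<le> (\<integral>(y, z). (u' y - u' z) * (mollifier \<epsilon> (y - x) - mollifier \<epsilon> (z - x)) * frac_kernel s (y - z)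
        \<partial>(lborel2))"
    proof -
      let ?\<phi> = "\<lambda>y. mollifier \<epsilon> (y - x)"
      have "cball x \<epsilon> \<subseteq> \<Omega>" using e by (intro order_trans[OF subset_cball sub]) simp
      then have "?\<phi> \<in> test_functions \<Omega>" by (rule mollifier_test_function[OF e])
      then have "0 \<le> frac_laplacian s u ?\<phi>"
        using assms(10) mollifier_nonneg[OF e, where 'a = "real ^ 'n"] by (auto simp: frac_superharmonic_def)
      \<comment> \<open>The factor C_{n,s}/2 is positive and can be cancelled.\<close>
      then have "0 \<le> (\<integral>(y, z). (u y - u z) * (?\<phi> y - ?\<phi> z) / norm (y - z) powr (real CARD('n) + 2 * s) \<partial>lebesgue)"
        unfolding frac_laplacian_def using frac_const_pos[OF s, of "CARD('n)"] by (simp add: zero_le_mult_iff)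
      also have "\<dots> = (\<integral>(y, z). (u' y - u' z) * (?\<phi> y - ?\<phi> z) * frac_kernel s (y - z) \<partial>lborel)"
      proof (rule integral_lebesgue_eq_lborel(2))
        show "(\<lambda>(y, z). (u' y - u' z) * (?\<phi> y - ?\<phi> z) * frac_kernel s (y - z)) \<in> borel_measurable borel"
          unfolding borel_prod[symmetric] by measurable
        show "AE p in lborel. (case p of (y, z) \<Rightarrow> (u y - u z) * (?\<phi> y - ?\<phi> z) / norm (y - z) powr (real CARD('n) + 2 * s))
            = (case p of (y, z) \<Rightarrow> (u' y - u' z) * (?\<phi> y - ?\<phi> z) * frac_kernel s (y - z))"
          using AE_lborel_pair[OF uu'] by eventually_elim (auto simp: frac_kernel_def)
      qed
      finally show ?thesis unfolding lborel_prod .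
    qed
    ultimately show ?thesis by (rule pv_superharmonic_mollify[OF s tail e _ u'v'])
  qed
  show ?thesis
  proof (rule ess_lsc_representative[OF \<Omega>])
    have cong: "(AE y in lborel. y \<in> U \<longrightarrow> m \<le> u' y) \<longleftrightarrow> (AE y in lborel. y \<in> U \<longrightarrow> m \<le> u y)" for U m
    proof
      show "AE y in lborel. y \<in> U \<longrightarrow> m \<le> u y" if "AE y in lborel. y \<in> U \<longrightarrow> m \<le> u' y"
        using that uu' by eventually_elim simp
      show "AE y in lborel. y \<in> U \<longrightarrow> m \<le> u' y" if "AE y in lborel. y \<in> U \<longrightarrow> m \<le> u y"
        using that uu' by eventually_elim simp
    qed
    show "AE x in lborel. x \<in> \<Omega> \<longrightarrow>
      (\<forall>m<u x. \<exists>r>0. ball x r \<subseteq> \<Omega> \<and> (AE y in lborel. y \<in> ball x r \<longrightarrow> m \<le> u y))"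
    proof -
      have "AE x in lborel. x \<in> \<Omega> \<longrightarrow>
        (\<forall>m<u' x. \<exists>r>0. ball x r \<subseteq> \<Omega> \<and> (AE y in lborel. y \<in> ball x r \<longrightarrow> m \<le> u' y))"
        by (rule AE_ess_lower_semicontinuous(1)[OF s tail \<Omega>]) (rule sup)
      with uu' show ?thesis unfolding cong by eventually_elim simp
    qed
    show "\<exists>m. \<exists>r>0. ball x r \<subseteq> \<Omega> \<and> (AE y in lborel. y \<in> ball x r \<longrightarrow> m \<le> u y)" if "x \<in> \<Omega>" for x
      unfolding cong[symmetric] by (rule AE_ess_lower_semicontinuous(2)[OF s tail \<Omega> _ that]) (rule sup)
    show "\<exists>\<kappa>>0. \<exists>r>0. ball x r \<subseteq> \<Omega> \<and> (AE y in lborel. y \<in> ball x r \<longrightarrow> m + \<kappa> \<le> u y)"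
      if x: "x \<in> \<Omega>" and m: "AE y in lborel. m \<le> u y" for x m
    proof -
      have m': "AE y in lborel. m \<le> u' y" using m uu' by eventually_elim simp
      have nconst: "\<not> (AE y in lborel. u' y = m)"
      proof
        assume "AE y in lborel. u' y = m"
        with uu' have "AE y in lborel. u y = m" by eventually_elim simp
        then have "AE y in lebesgue. u y = m" by (rule AE_completion)
        then show False using assms(7) by blast
      qed
      show ?thesis
        unfolding cong[symmetric]
        by (rule ess_strict_minimum[OF s tail \<Omega> _ x m' nconst]) (rule sup)
    qed
  qed
qed

end
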